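(* Let $U\subset\mathbb{R}^n$ be open and let $g:U\to\mathbb{R}^n\setminus\{0\}$ be locally Lipschitz. Then $g$ satisfies Jacobi's integrability condition if and only if, for every $x^*\in U$, there exists a normal solution $u:V\to\mathbb{R}$ to $\nabla u(x)=\lambda(x)g(x)$ around $x^*$. Moreover, when $g$ is $C^k$ ($k\ge 1$), $g$ satisfies Jacobi's integrability condition if and only if, for every $x^*\in U$, there exists a normal solution $u:V\to\mathbb{R}$ to $\nabla u(x)=\lambda(x)g(x)$ around $x^*$ such that $u$ is $C^k$ and every level set of $u$ is an $(n-1)$-dimensional $C^{k+1}$ manifold.
   Context: A function on an open set is locally Lipschitz if it is Lipschitz on every compact subset; such a function is differentiable almost everywhere (Rademacher). Manifolds are embedded submanifolds of Euclidean space: $X\subset\mathbb{R}^N$ is an $m$-dimensional $C^k$ manifold if each point of $X$ has a relatively open neighborhood in $X$ that is $C^k$ diffeomorphic to an open subset of $\mathbb{R}^m$ (a map on a subset of $\mathbb{R}^N$ is $C^k$ if it locally extends to a $C^k$ map on an open set). $T_x(X)$ denotes the tangent space as a linear subspace of $\mathbb{R}^N$. A vector field $g$ is a normal vector field of $X$ if $g(x)\cdot v=0$ for all $x\in X$ and $v\in T_x(X)$. The level sets of $u:V\to\mathbb{R}$ are the sets $u^{-1}(u(x))$, $x\in V$. Jacobi's integrability condition for $g$: for any $i,j,k\in\{1,\dots,n\}$, the equality $$g_i\left(\frac{\partial g_j}{\partial x_k}-\frac{\partial g_k}{\partial x_j}\right)+g_j\left(\frac{\partial g_k}{\partial x_i}-\frac{\partial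 g_i}{\partial x_k}\right)+g_k\left(\frac{\partial g_i}{\partial x_j}-\frac{\partial g_j}{\partial x_i}\right)=0$$ holds at almost every point of $U$. Normal solution: for $g:U\to\mathbb{R}^n\setminus\{0\}$ locally Lipschitz, a function $u:V\to\mathbb{R}$ is a normal solution to $\nabla u(x)=\lambda(x)g(x)$ if 1) $V$ is open and $V\subset U$; 2) $u$ is locally Lipschitz; 3) every level set of $u$ is an $(n-1)$-dimensional $C^1$ manifold; 4) $g$ is a normal vector field of every level set of $u$; 5) $u$ has no local maximum point and no local minimum point; 6) if $u$ is differentiable at $x$, then $\nabla u(x)\neq 0$. It is a normal solution around $x^*$ if in addition $x^*\in V$. *)

theory Defs
  imports "HOL-Analysis.Analysis"
begin

definition locally_lipschitz_on ::
    "'a::euclidean_space set \<Rightarrow> ('a \<Rightarrow> 'b::euclidean_space) \<Rightarrow> bool" where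
  "locally_lipschitz_on S f \<longleftrightarrow> (\<forall>K. compact K \<and> K \<subseteq> S \<longrightarrow> (\<exists>L. L-lipschitz_on K f))"

text \<open>
  To be used for open \<open>S\<close> only.  The functions \<open>\<lambda>x. frechet_derivative f (at x) v\<close> are the
  directional derivatives of \<open>f\<close>; requiring them to be of class $C^k$ for all \<open>v\<close> amounts to
  requiring it of the partial derivatives.
\<close>

primrec Ck_on ::
    "nat \<Rightarrow> 'a::euclidean_space set \<Rightarrow> ('a \<Rightarrow> 'b::euclidean_space) \<Rightarrow> bool" where
  "Ck_on 0 S f \<longleftrightarrow> continuous_on S f"
| "Ck_on (Suc k) S f \<longleftrightarrow>
     (\<forall>x\<in>S. f differentiable (at x)) \<and>
     (\<forall>v. Ck_on k S (\<lambda>x. frechet_derivative f (at x) v))"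

definition Ck_map ::
    "nat \<Rightarrow> 'a::euclidean_space set \<Rightarrow> ('a \<Rightarrow> 'b::euclidean_space) \<Rightarrow> bool" where
  "Ck_map k A f \<longleftrightarrow>
     (\<forall>x\<in>A. \<exists>Q F. open Q \<and> x \<in> Q \<and> Ck_on k Q F \<and> (\<forall>y\<in>A \<inter> Q. F y = f y))"

definition Ck_diffeomorphic ::
    "nat \<Rightarrow> 'a::euclidean_space set \<Rightarrow> 'b::euclidean_space set \<Rightarrow> bool" where
  "Ck_diffeomorphic k A B \<longleftrightarrow>
     (\<exists>f f'. homeomorphism A B f f' \<and> Ck_map k A f \<and> Ck_map k B f')"

text \<open>
  No type can stand for $\mathbb{R}^m$ with \<open>m\<close> a variable (or \<open>m = 0\<close>), so its role is played by an
  \<open>m\<close>-dimensional linear subspace \<open>E\<close> of the ambient space.  Such an \<open>E\<close> is linearly isometric to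
  $\mathbb{R}^m$, and as \<open>Ck_map\<close> is defined by local extension, maps to and from relatively open
  subsets \<open>W\<close> of \<open>E\<close> are of class $C^k$ in the usual sense.  If \<open>m\<close> exceeds the dimension of the
  ambient space, then only the empty set qualifies, as it should.
\<close>

definition Ck_manifold :: "nat \<Rightarrow> nat \<Rightarrow> 'a::euclidean_space set \<Rightarrow> bool" where
  "Ck_manifold k m X \<longleftrightarrow>
     (\<forall>x\<in>X. \<exists>N. x \<in> N \<and> openin (top_of_set X) N \<and>
        (\<exists>(E::'a set) W. subspace E \<and> dim E = m \<and> openin (top_of_set E) W \<and>
           Ck_diffeomorphic k N W))"

text \<open>For a $C^1$ manifold \<open>X\<close> and \<open>x \<in> X\<close> this set is a linear subspace.\<close>

definition tangent_space :: "'a::euclidean_space set \<Rightarrow> 'a \<Rightarrow> 'a set" where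
  "tangent_space X x =
     {v. \<exists>(\<gamma> :: real \<Rightarrow> 'a) \<epsilon>. \<epsilon> > 0 \<and> Ck_on 1 {-\<epsilon><..<\<epsilon>} \<gamma> \<and> \<gamma> ` {-\<epsilon><..<\<epsilon>} \<subseteq> X \<and>
           \<gamma> 0 = x \<and> (\<gamma> has_vector_derivative v) (at 0)}"

definition normal_vector_field ::
    "('a::euclidean_space \<Rightarrow> 'a) \<Rightarrow> 'a set \<Rightarrow> bool" where
  "normal_vector_field g X \<longleftrightarrow> (\<forall>x\<in>X. \<forall>v\<in>tangent_space X x. g x \<bullet> v = 0)"

definition level_sets :: "'a set \<Rightarrow> ('a \<Rightarrow> real) \<Rightarrow> 'a set set" where
  "level_sets V u = (\<lambda>x. {y\<in>V. u y = u x}) ` V"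

text \<open>
  Here \<open>jacobian g (at x) $ j $ k\<close> is $\partial g_j / \partial x_k$ at \<open>x\<close>.  Because
  \<open>jacobian\<close> is a total function, differentiability is demanded explicitly; for locally
  Lipschitz \<open>g\<close> it holds almost everywhere by Rademacher's theorem.
\<close>

definition jacobi_condition :: "(real^'n) set \<Rightarrow> (real^'n \<Rightarrow> real^'n) \<Rightarrow> bool" where
  "jacobi_condition U g \<longleftrightarrow>
     (\<forall>i j k. AE x in lebesgue. x \<in> U \<longrightarrow>
        g differentiable (at x) \<and>
        (let D = jacobian g (at x) in
           g x $ i * (D $ j $ k - D $ k $ j) +
           g x $ j * (D $ k $ i - D $ i $ k) +
           g x $ k * (D $ i $ j - D $ j $ i) = 0))"

definition local_max_point :: "'a::topological_space set \<Rightarrow> ('a \<Rightarrow> real) \<Rightarrow> 'a \<Rightarrow> bool" where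
  "local_max_point V u x \<longleftrightarrow> x \<in> V \<and> (\<forall>\<^sub>F y in at x within V. u y \<le> u x)"

definition local_min_point :: "'a::topological_space set \<Rightarrow> ('a \<Rightarrow> real) \<Rightarrow> 'a \<Rightarrow> bool" where
  "local_min_point V u x \<longleftrightarrow> x \<in> V \<and> (\<forall>\<^sub>F y in at x within V. u x \<le> u y)"

text \<open>
  The function \<open>u\<close> from \<open>V\<close> to the reals is a normal solution to $\nabla u = \lambda g$, where \<open>g\<close> is
  given on \<open>U\<close>; the values of \<open>u\<close> outside \<open>V\<close> and of \<open>g\<close> outside \<open>U\<close> are irrelevant.
\<close>

definition normal_solution ::
    "(real^'n) set \<Rightarrow> (real^'n \<Rightarrow> real^'n) \<Rightarrow> (real^'n) set \<Rightarrow> (real^'n \<Rightarrow> real) \<Rightarrow> bool" where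
  "normal_solution U g V u \<longleftrightarrow>
     open V \<and> V \<subseteq> U \<and>
     locally_lipschitz_on V u \<and>
     (\<forall>X\<in>level_sets V u. Ck_manifold 1 (CARD('n) - 1) X) \<and>
     (\<forall>X\<in>level_sets V u. normal_vector_field g X) \<and>
     (\<nexists>x. local_max_point V u x) \<and> (\<nexists>x. local_min_point V u x) \<and>
     (\<forall>x\<in>V. \<forall>D. GDERIV u x :> D \<longrightarrow> D \<noteq> 0)"

definition normal_solution_around ::
    "(real^'n) set \<Rightarrow> (real^'n \<Rightarrow> real^'n) \<Rightarrow> real^'n \<Rightarrow> (real^'n) set \<Rightarrow> (real^'n \<Rightarrow> real) \<Rightarrow> bool" where
  "normal_solution_around U g x\<^sub>0 V u \<longleftrightarrow> normal_solution U g V u \<and> x\<^sub>0 \<in> V"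

end

theory Submission
  imports Defs
begin

text \<open>
  Near a point where \<open>g \<bullet> e > 0\<close> for a unit vector \<open>e\<close>, project every direction \<open>h\<close> along \<open>e\<close> onto the
  hyperplane orthogonal to \<open>g\<close>: the Lipschitz fields \<open>X h z = h - (g z \<bullet> h / g z \<bullet> e) e\<close> have global flows
  \<open>flow h\<close>, and Jacobi's condition says that their brackets vanish almost everywhere.  Exchanging the
  order of two flows costs the sum of the commutators of \<open>N\<^sup>2\<close> small parallelograms, each of them
  \<open>o(1/N\<^sup>2)\<close> at almost every base point; averaging over the starting point, dominated convergence
  shows that the flows commute.  Hence \<open>p \<mapsto> flow p x\<close> parametrises an integral hypersurface of \<open>g\<close> as
  a graph over the hyperplane orthogonal to \<open>e\<close>, and \<open>u x\<close> is the height at which the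
  hypersurface through \<open>x\<close> meets the line through the base point in direction \<open>e\<close>.  The derivatives
  of \<open>flow h x\<close> in \<open>h\<close> and \<open>x\<close> are expressed by \<open>g\<close> and the flow itself (in the transversal direction by
  the solution formula for scalar linear equations), so regularity follows by bootstrapping.

  Conversely, at a point where \<open>g\<close> is differentiable the symmetry of a second derivative along the
  level set yields Jacobi's identity, and \<open>g\<close> is differentiable almost everywhere by Rademacher's
  theorem.
\<close>

text \<open>The obstacle is that for merely Lipschitz \<open>g\<close> the brackets exist only off a
  null set, and a single curve, or even the surface swept out by two flows from one point, may lie
  inside that null set. This is why commutation is proved in integrated form and only afterwards, by
  continuity, at each point. Dividing by \<open>g z \<bullet> e\<close> makes commutation the right
  target: all fields \<open>X h\<close> lift constant fields on the hyperplane orthogonal to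
  \<open>e\<close>, so their brackets are multiples of \<open>e\<close>; being tangent to the
  hyperplanes of \<open>g\<close> as well (Jacobi), they vanish instead of merely being combinations
  of the frame. Outside a small ball \<open>g\<close> is replaced by its value at the nearest point
  of the ball; the fields become globally Lipschitz and bounded, flows need no domains, and only
  commutation remains local. Since \<open>u\<close> need not be differentiable, nonzero gradients
  and the absence of extrema come from a lower Lipschitz bound for \<open>u\<close> along
  \<open>e\<close>. Level sets gain a derivative over \<open>u\<close> because \<open>flow\<close>
  is differentiated in its direction without differentiating \<open>g\<close>, but in its starting
  point only through the derivative of \<open>g\<close>.\<close>

section \<open>Rademacher's theorem\<close>

text \<open>A weak form of Lebesgue's density theorem. Enclose \<open>S\<close> in an open
  \<open>T\<close> of nearly the same measure; disjoint balls inside \<open>T\<close> that cover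
  almost all of \<open>S\<close> bound the measure of \<open>S\<close> by \<open>c\<close> times
  that of \<open>T\<close>, which is too small unless \<open>S\<close> is null. The balls contain
  \<open>x\<close> without being centred there, which suits one-sided intervals.\<close>

lemma negligible_if_density_le:
  fixes S :: "'a::euclidean_space set"
  assumes S: "S \<in> lmeasurable" and c: "0 < c" "c < 1"
    and dens: "\<And>x d. x \<in> S \<Longrightarrow> 0 < d \<Longrightarrow> \<exists>a r. 0 < r \<and> r < d \<and> x \<in> cball a r \<and>
      measure lebesgue (S \<inter> cball a r) \<le> c * measure lebesgue (cball a r)"
  shows "negligible S"
proof (rule ccontr)
  assume "\<not> negligible S"
  define m where "m = measure lebesgue S"
  have "m \<noteq> 0"
    using \<open>\<not> negligible S\<close> S by (auto simp: m_def negligible_iff_measure)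
  then have "m > 0"
    by (simp add: m_def zero_less_measure_iff)
  \<comment> \<open>With this excess
    \<open>c * (m + \<epsilon>) = c * m + (1 - c) * m / 2 < m\<close>, the contradiction aimed
    at.\<close>
  define \<epsilon> where "\<epsilon> = (1 - c) * m / (2 * c)"
  have "\<epsilon> > 0"
    using c \<open>m > 0\<close> by (simp add: \<epsilon>_def)
  obtain T where T: "open T" "S \<subseteq> T" "T \<in> lmeasurable" "measure lebesgue T < m + \<epsilon>"
  proof -
    obtain T where T: "open T" "S \<subseteq> T" "T - S \<in> lmeasurable" "emeasure lebesgue (T - S) < ennreal \<epsilon>"
      using sets_lebesgue_outer_open[of S \<epsilon>] S \<open>\<epsilon> > 0\<close> by (metis fmeasurableD)
    have T': "T \<in> lmeasurable"
      using fmeasurable.Un[OF S T(3)] T(2) by (metis Diff_partition)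
    have "measure lebesgue (T - S) < \<epsilon>"
      using T(3,4) \<open>\<epsilon> > 0\<close> by (simp add: emeasure_eq_measure2 ennreal_less_iff)
    moreover have "measure lebesgue (T - S) = measure lebesgue T - measure lebesgue S"
      using T(2) T' S by (simp add: measurable_measure_Diff fmeasurableD)
    ultimately show ?thesis
      using that T T' by (simp add: m_def)
  qed
  define K where "K = {(a, r). 0 < r \<and> cball a r \<subseteq> T \<and>
     measure lebesgue (S \<inter> cball a r) \<le> c * measure lebesgue (cball a r)}"
  obtain C where C: "countable C" "C \<subseteq> K"
    "pairwise (\<lambda>i j. disjnt (cball (fst i) (snd i)) (cball (fst j) (snd j))) C"
    "negligible (S - (\<Union>i\<in>C. cball (fst i) (snd i)))"
  proof (rule Vitali_covering_theorem_cballs[of K snd S fst])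
    show "\<And>i. i \<in> K \<Longrightarrow> 0 < snd i" by (auto simp: K_def)
    fix x :: 'a and d :: real assume x: "x \<in> S" "0 < d"
    then obtain \<rho> where \<rho>: "\<rho> > 0" "ball x \<rho> \<subseteq> T"
      using T by (meson open_contains_ball subsetD)
    obtain a r where ar: "0 < r" "r < min d (\<rho>/2)" "x \<in> cball a r"
      "measure lebesgue (S \<inter> cball a r) \<le> c * measure lebesgue (cball a r)"
      using dens[of x "min d (\<rho>/2)"] x \<rho> by auto
    have "cball a r \<subseteq> ball x \<rho>"
    proof
      fix y assume "y \<in> cball a r"
      then show "y \<in> ball x \<rho>"
        using ar dist_triangle[of x y a] by (auto simp: dist_commute)
    qed
    then show "\<exists>i. i \<in> K \<and> x \<in> cball (fst i) (snd i) \<and> snd i < d"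
      using ar \<rho> by (intro exI[of _ "(a, r)"]) (auto simp: K_def)
  qed
  let ?B = "\<lambda>i. cball (fst i) (snd i :: real) :: 'a set"
  have disj: "disjoint_family_on ?B C"
    using C(3) by (auto simp: disjoint_family_on_def pairwise_def disjnt_def)
  have disj': "disjoint_family_on (\<lambda>i. S \<inter> ?B i) C"
    using disj by (rule disjoint_family_on_bisimulation) auto
  have Slm: "S \<in> sets lebesgue" using S by blast
  have "emeasure lebesgue S \<le> emeasure lebesgue (S - (\<Union>i\<in>C. ?B i)) + emeasure lebesgue (\<Union>i\<in>C. S \<inter> ?B i)"
  proof -
    have "emeasure lebesgue S = emeasure lebesgue ((S - (\<Union>i\<in>C. ?B i)) \<union> (\<Union>i\<in>C. S \<inter> ?B i))"
      by (rule arg_cong[where f="emeasure lebesgue"]) blast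
    also have "\<dots> \<le> emeasure lebesgue (S - (\<Union>i\<in>C. ?B i)) + emeasure lebesgue (\<Union>i\<in>C. S \<inter> ?B i)"
      by (rule emeasure_subadditive) (use Slm C(1) in \<open>auto intro!: sets.countable_UN'\<close>)
    finally show ?thesis .
  qed
  also have "emeasure lebesgue (S - (\<Union>i\<in>C. ?B i)) = 0"
    using C(4) negligible_iff_emeasure0[OF negligible_imp_sets[OF C(4)]] by blast
  also have "emeasure lebesgue (\<Union>i\<in>C. S \<inter> ?B i) = (\<integral>\<^sup>+i. emeasure lebesgue (S \<inter> ?B i) \<partial>count_space C)"
    by (rule emeasure_UN_countable[OF _ C(1) disj']) (use Slm in auto)
  also have "\<dots> \<le> (\<integral>\<^sup>+i. ennreal c * emeasure lebesgue (?B i) \<partial>count_space C)"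
  proof (rule nn_integral_mono)
    fix i assume "i \<in> space (count_space C)"
    then have i: "i \<in> K" using C by auto
    have "S \<inter> ?B i \<in> lmeasurable"
      using S by (intro fmeasurable.Int) auto
    then have "emeasure lebesgue (S \<inter> ?B i) = ennreal (measure lebesgue (S \<inter> ?B i))"
      by (rule emeasure_eq_measure2)
    also have "\<dots> \<le> ennreal (c * measure lebesgue (?B i))"
      using i by (intro ennreal_leI) (auto simp: K_def)
    also have "\<dots> = ennreal c * emeasure lebesgue (?B i)"
      using c by (simp add: ennreal_mult' emeasure_eq_measure2[OF lmeasurable_cball])
    finally show "emeasure lebesgue (S \<inter> ?B i) \<le> ennreal c * emeasure lebesgue (?B i)" .
  qed
  also have "\<dots> = ennreal c * (\<integral>\<^sup>+i. emeasure lebesgue (?B i) \<partial>count_space C)"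
    by (rule nn_integral_cmult) auto
  also have "(\<integral>\<^sup>+i. emeasure lebesgue (?B i) \<partial>count_space C) = emeasure lebesgue (\<Union>i\<in>C. ?B i)"
    by (rule emeasure_UN_countable[symmetric, OF _ C(1) disj]) auto
  also have "\<dots> \<le> emeasure lebesgue T"
    proof (rule emeasure_mono)
    show "(\<Union>i\<in>C. ?B i) \<subseteq> T"
    proof (rule UN_least)
      fix i assume "i \<in> C"
      then have "i \<in> K" using C by blast
      then show "?B i \<subseteq> T" unfolding K_def by auto
    qed
  qed (use T in auto)
  finally have "ennreal m \<le> ennreal c * ennreal (measure lebesgue T)"
    unfolding m_def emeasure_eq_measure2[OF S] emeasure_eq_measure2[OF T(3)] by (simp add: mult_left_mono)
  then have "m \<le> c * measure lebesgue T"
    using c by (simp add: ennreal_mult[symmetric])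
  also have "\<dots> \<le> c * (m + \<epsilon>)"
    using T c by simp
  also have "\<dots> = c * m + (1 - c) * m / 2"
    using c by (simp add: \<epsilon>_def field_simps)
  also have "\<dots> < m"
  proof -
    have "0 < (1 - c) * m" using c \<open>m > 0\<close> by simp
    then show ?thesis by (simp add: field_simps)
  qed
  finally show False by simp
qed

text \<open>Sum the inequality over disjoint intervals that cover almost all of \<open>S\<close>.
  Countable additivity of the Stieltjes measure of \<open>f\<close> bounds the sum of infinitely
  many increments by \<open>f b - f a\<close>.\<close>

lemma increment_ge_of_Vitali_cover:
  fixes f :: "real \<Rightarrow> real"
  assumes mono: "\<And>x y. x \<le> y \<Longrightarrow> f x \<le> f y" and cont: "continuous_on UNIV f" and q: "q > 0"
    and S: "S \<in> lmeasurable" "S \<subseteq> {a<..<b}" and "a < b"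
    and cov: "\<And>x d. x \<in> S \<Longrightarrow> 0 < d \<Longrightarrow> \<exists>u v. u < v \<and> v - u < d \<and> x \<in> {u..v} \<and> q * (v - u) \<le> f v - f u"
  shows "q * measure lebesgue S \<le> f b - f a"
proof -
  let ?\<mu> = "interval_measure f"
  have \<mu>: "emeasure ?\<mu> {u<..v} = ennreal (f v - f u)" if "u \<le> v" for u v
    using that mono cont
    by (intro emeasure_interval_measure_Ioc)
       (auto simp: continuous_on_eq_continuous_at intro: continuous_at_imp_continuous_at_within)
  \<comment> \<open>An interval is coded by its midpoint \<open>m\<close> and half-length
    \<open>r\<close>, since the covering theorem speaks of balls.\<close>
  define K where "K = {(m, r). 0 < r \<and> {m - r..m + r} \<subseteq> {a<..<b} \<and> q * (2 * r) \<le> f (m + r) - f (m - r)}"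
  obtain C where C: "countable C" "C \<subseteq> K"
    "pairwise (\<lambda>i j. disjnt (cball (fst i) (snd i)) (cball (fst j) (snd j))) C"
    "negligible (S - (\<Union>i\<in>C. cball (fst i) (snd i)))"
  proof (rule Vitali_covering_theorem_cballs[of K snd S fst])
    show "\<And>i. i \<in> K \<Longrightarrow> 0 < snd i" by (auto simp: K_def)
    fix x :: real and d :: real assume x: "x \<in> S" "0 < d"
    then have ab: "a < x" "x < b" using S by auto
    obtain u v where uv: "u < v" "v - u < min d (min (x - a) (b - x))" "x \<in> {u..v}" "q * (v - u) \<le> f v - f u"
      using cov[of x "min d (min (x - a) (b - x))"] x ab by auto
    show "\<exists>i. i \<in> K \<and> x \<in> cball (fst i) (snd i) \<and> snd i < d"
      using uv ab
      by (intro exI[of _ "((u + v)/2, (v - u)/2)"])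
         (auto simp: K_def field_simps dist_real_def abs_le_iff)
  qed
  let ?B = "\<lambda>i. cball (fst i) (snd i :: real)"
  let ?I = "\<lambda>i. {fst i - snd i<..fst i + snd i :: real}"
  have B: "?B i = {fst i - snd i..fst i + snd i}" for i
    by (auto simp: dist_real_def abs_le_iff)
  have disj: "disjoint_family_on ?B C"
    using C(3) by (auto simp: disjoint_family_on_def pairwise_def disjnt_def)
  have disj': "disjoint_family_on ?I C"
    using disj unfolding B by (rule disjoint_family_on_bisimulation) fastforce
  have Slm: "S \<in> sets lebesgue" using S by blast
  have "emeasure lebesgue S \<le> emeasure lebesgue (S - (\<Union>i\<in>C. ?B i)) + emeasure lebesgue (\<Union>i\<in>C. ?B i)"
  proof -
    have "emeasure lebesgue S \<le> emeasure lebesgue ((S - (\<Union>i\<in>C. ?B i)) \<union> (\<Union>i\<in>C. ?B i))"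
      by (rule emeasure_mono) (use Slm C(1) in \<open>auto intro!: sets.countable_UN' sets.Un sets.Diff\<close>)
    also have "\<dots> \<le> emeasure lebesgue (S - (\<Union>i\<in>C. ?B i)) + emeasure lebesgue (\<Union>i\<in>C. ?B i)"
      by (rule emeasure_subadditive) (use Slm C(1) in \<open>auto intro!: sets.countable_UN'\<close>)
    finally show ?thesis .
  qed
  also have "emeasure lebesgue (S - (\<Union>i\<in>C. ?B i)) = 0"
    using C(4) negligible_iff_emeasure0[OF negligible_imp_sets[OF C(4)]] by blast
  also have "emeasure lebesgue (\<Union>i\<in>C. ?B i) = (\<integral>\<^sup>+i. emeasure lebesgue (?B i) \<partial>count_space C)"
    by (rule emeasure_UN_countable[OF _ C(1) disj]) auto
  finally have "ennreal q * emeasure lebesgue S \<le> ennreal q * (\<integral>\<^sup>+i. emeasure lebesgue (?B i) \<partial>count_space C)"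
    by (simp add: mult_left_mono)
  also have "\<dots> = (\<integral>\<^sup>+i. ennreal q * emeasure lebesgue (?B i) \<partial>count_space C)"
    by (rule nn_integral_cmult[symmetric]) auto
  also have "\<dots> \<le> (\<integral>\<^sup>+i. emeasure ?\<mu> (?I i) \<partial>count_space C)"
  proof (rule nn_integral_mono)
    fix i assume "i \<in> space (count_space C)"
    then have i: "i \<in> K" using C by auto
    have "ennreal q * emeasure lebesgue (?B i) = ennreal (q * (2 * snd i))"
      using i q unfolding B by (auto simp: K_def ennreal_mult'[symmetric])
    also have "\<dots> \<le> ennreal (f (fst i + snd i) - f (fst i - snd i))"
      using i by (intro ennreal_leI) (auto simp: K_def)
    also have "\<dots> = emeasure ?\<mu> (?I i)"
      using i by (subst \<mu>) (auto simp: K_def)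
    finally show "ennreal q * emeasure lebesgue (?B i) \<le> emeasure ?\<mu> (?I i)" .
  qed
  also have "\<dots> = emeasure ?\<mu> (\<Union>i\<in>C. ?I i)"
    by (rule emeasure_UN_countable[symmetric, OF _ C(1) disj']) auto
  also have "\<dots> \<le> emeasure ?\<mu> {a<..b}"
    proof (rule emeasure_mono)
    show "(\<Union>i\<in>C. ?I i) \<subseteq> {a<..b}"
    proof (rule UN_least)
      fix i assume "i \<in> C"
      then have "i \<in> K" using C by blast
      then have "{fst i - snd i..fst i + snd i} \<subseteq> {a<..<b}" unfolding K_def by auto
      then have "?I i \<subseteq> {a<..<b}" by (meson greaterThanAtMost_subseteq_atLeastAtMost_iff order.trans order.refl)
      then show "?I i \<subseteq> {a<..b}" by (auto simp: subset_eq less_imp_le)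
    qed
  qed simp
  also have "\<dots> = ennreal (f b - f a)"
    using \<open>a < b\<close> by (subst \<mu>) auto
  finally have "ennreal (q * measure lebesgue S) \<le> ennreal (f b - f a)"
    using S q by (simp add: emeasure_eq_measure2 ennreal_mult')
  moreover have "f b - f a \<ge> 0"
    using mono[of a b] \<open>a < b\<close> by simp
  ultimately show ?thesis by simp
qed

section \<open>Directional derivatives of Lipschitz functions\<close>

text \<open>Bounded difference quotients that do not converge put \<open>x\<close> into such a set
  for some rational \<open>p < q\<close>, so only countably many of these sets have to be shown
  null. The scales \<open>inverse (Suc m)\<close> make the set a countable intersection of open
  sets, hence Borel, for continuous \<open>f\<close>.\<close>

definition dini_gap :: "('a::euclidean_space \<Rightarrow> real) \<Rightarrow> 'a \<Rightarrow> real \<Rightarrow> real \<Rightarrow> 'a set" where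
  "dini_gap f v p q = (\<Inter>m::nat. {x. \<exists>t. 0 < \<bar>t\<bar> \<and> \<bar>t\<bar> < inverse (Suc m) \<and> (f (x + t *\<^sub>R v) - f x) / t < p}) \<inter>
     (\<Inter>m::nat. {x. \<exists>t. 0 < \<bar>t\<bar> \<and> \<bar>t\<bar> < inverse (Suc m) \<and> q < (f (x + t *\<^sub>R v) - f x) / t})"

lemma dini_gap_borel:
  assumes "continuous_on UNIV f"
  shows "dini_gap f v p q \<in> sets borel"
proof -
  have c: "continuous_on UNIV (\<lambda>x. (f (x + t *\<^sub>R v) - f x) / t)" for t
    unfolding divide_inverse
    by (intro continuous_intros continuous_on_compose2[OF assms]) auto
  have "open {x. \<exists>t. 0 < \<bar>t\<bar> \<and> \<bar>t\<bar> < inverse (Suc m) \<and> (f (x + t *\<^sub>R v) - f x) / t < p}" for m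
  proof -
    have "{x. \<exists>t. 0 < \<bar>t\<bar> \<and> \<bar>t\<bar> < inverse (Suc m) \<and> (f (x + t *\<^sub>R v) - f x) / t < p} =
      (\<Union>t\<in>{t. 0 < \<bar>t\<bar> \<and> \<bar>t\<bar> < inverse (Suc m)}. {x. (f (x + t *\<^sub>R v) - f x) / t < p})" by blast
    then show ?thesis
      using c by (auto intro!: open_UN open_Collect_less)
  qed
  moreover have "open {x. \<exists>t. 0 < \<bar>t\<bar> \<and> \<bar>t\<bar> < inverse (Suc m) \<and> q < (f (x + t *\<^sub>R v) - f x) / t}" for m
  proof -
    have "{x. \<exists>t. 0 < \<bar>t\<bar> \<and> \<bar>t\<bar> < inverse (Suc m) \<and> q < (f (x + t *\<^sub>R v) - f x) / t} =
      (\<Union>t\<in>{t. 0 < \<bar>t\<bar> \<and> \<bar>t\<bar> < inverse (Suc m)}. {x. q < (f (x + t *\<^sub>R v) - f x) / t})" by blast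
    then show ?thesis
      using c by (auto intro!: open_UN open_Collect_less)
  qed
  ultimately show ?thesis
    unfolding dini_gap_def by (intro sets.Int sets.countable_INT) auto
qed

lemma dini_gapD:
  assumes "x \<in> dini_gap f v p q" "0 < d"
  shows "\<exists>t. 0 < \<bar>t\<bar> \<and> \<bar>t\<bar> < d \<and> (f (x + t *\<^sub>R v) - f x) / t < p"
    and "\<exists>t. 0 < \<bar>t\<bar> \<and> \<bar>t\<bar> < d \<and> q < (f (x + t *\<^sub>R v) - f x) / t"
proof -
  obtain m where m: "inverse (real (Suc m)) < d" using reals_Archimedean[OF \<open>0 < d\<close>] by blast
  show "\<exists>t. 0 < \<bar>t\<bar> \<and> \<bar>t\<bar> < d \<and> (f (x + t *\<^sub>R v) - f x) / t < p"
    using assms(1) m unfolding dini_gap_def Int_iff INT_iff mem_Collect_eq by (meson UNIV_I less_trans)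
  show "\<exists>t. 0 < \<bar>t\<bar> \<and> \<bar>t\<bar> < d \<and> q < (f (x + t *\<^sub>R v) - f x) / t"
    using assms(1) m unfolding dini_gap_def Int_iff INT_iff mem_Collect_eq by (meson UNIV_I less_trans)
qed

lemma difference_quotient_interval:
  fixes f :: "real \<Rightarrow> real"
  assumes "t \<noteq> 0"
  obtains u v where "u < v" "v - u = \<bar>t\<bar>" "x \<in> {u..v}" "(f (x + t) - f x) / t = (f v - f u) / (v - u)"
proof (cases "t > 0")
  case True
  then show ?thesis using that[of x "x + t"] by auto
next
  case False
  then show ?thesis using that[of "x + t" x] assms by (auto simp: field_simps)
qed

text \<open>Each point of the set lies in small intervals of growth rate below \<open>p\<close>;
  inside them the intervals of rate above \<open>q\<close> form a Vitali cover. Comparing the two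
  growths, the set fills at most a fixed fraction below 1 of each flat interval, and the density
  criterion applies.\<close>

lemma negligible_dini_gap_real_bounded:
  fixes f :: "real \<Rightarrow> real"
  assumes L: "L-lipschitz_on UNIV f" and "p < q"
  shows "negligible (dini_gap f 1 p q \<inter> {a<..<b})"
proof -
  have L0: "L \<ge> 0" using L by (rule lipschitz_on_nonneg)
  \<comment> \<open>The additional slope \<open>L + 1\<close> makes every increment at least the
    length of its interval, so \<open>F\<close> is increasing, and it shifts both rates by the same
    amount.\<close>
  define F where "F x = f x + (L + 1) * x" for x
  have cf: "continuous_on UNIV f" using L by (rule lipschitz_on_continuous_on)
  have cF: "continuous_on UNIV F" unfolding F_def by (intro continuous_intros cf)
  have inc: "F y - F x \<ge> y - x" if "x \<le> y" for x y
  proof -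
    have "\<bar>f x - f y\<bar> \<le> L * (y - x)"
      using lipschitz_onD[OF L, of x y] that by (simp add: dist_real_def)
    then show ?thesis by (simp add: F_def algebra_simps)
  qed
  have mono: "F x \<le> F y" if "x \<le> y" for x y using inc[OF that] that by simp
  let ?p = "p + L + 1" and ?q = "q + L + 1"
  have quot: "(F v - F u) / (v - u) = (f v - f u) / (v - u) + L + 1" if "u < v" for u v
    using that by (simp add: F_def field_simps)
  define S where "S = dini_gap f 1 p q \<inter> {a<..<b}"
  have Sl: "S \<in> lmeasurable"
    unfolding S_def by (intro bounded_set_imp_lmeasurable) (auto intro!: sets.Int dini_gap_borel cf bounded_Int simp: bounded_box[of a b, unfolded box_real])
  have lo: "\<exists>u v. u < v \<and> v - u < d \<and> x \<in> {u..v} \<and> F v - F u < ?p * (v - u)" if "x \<in> S" "d > 0" for x d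
  proof -
    have "x \<in> dini_gap f 1 p q" using that by (simp add: S_def)
    then obtain t where "0 < \<bar>t\<bar>" "\<bar>t\<bar> < d" "(f (x + t) - f x) / t < p"
      using dini_gapD(1)[OF _ \<open>d > 0\<close>] by (metis real_scaleR_def mult.right_neutral)
    moreover obtain u v where uv: "u < v" "v - u = \<bar>t\<bar>" "x \<in> {u..v}"
      "(f (x + t) - f x) / t = (f v - f u) / (v - u)"
      using difference_quotient_interval[of t x f] \<open>0 < \<bar>t\<bar>\<close> by auto
    ultimately have "(F v - F u) / (v - u) < ?p" "v - u < d"
      using quot[OF uv(1)] by auto
    then show ?thesis
      using uv(1,3) by (intro exI[of _ u] exI[of _ v]) (simp only: pos_divide_less_eq diff_gt_0_iff_gt)
  qed
  have hi: "\<exists>u v. u < v \<and> v - u < d \<and> x \<in> {u..v} \<and> ?q * (v - u) \<le> F v - F u" if "x \<in> S" "d > 0" for x d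
  proof -
    have "x \<in> dini_gap f 1 p q" using that by (simp add: S_def)
    then obtain t where "0 < \<bar>t\<bar>" "\<bar>t\<bar> < d" "q < (f (x + t) - f x) / t"
      using dini_gapD(2)[OF _ \<open>d > 0\<close>] by (metis real_scaleR_def mult.right_neutral)
    moreover obtain u v where uv: "u < v" "v - u = \<bar>t\<bar>" "x \<in> {u..v}"
      "(f (x + t) - f x) / t = (f v - f u) / (v - u)"
      using difference_quotient_interval[of t x f] \<open>0 < \<bar>t\<bar>\<close> by auto
    ultimately have "?q < (F v - F u) / (v - u)" "v - u < d"
      using quot[OF uv(1)] by auto
    then show ?thesis
      using uv(1,3) by (intro exI[of _ u] exI[of _ v]) (simp add: pos_less_divide_eq)
  qed
  have "negligible S"
  proof (cases "?p > 0")
    \<comment> \<open>Increments of at least the length exclude a rate bound \<open>?p\<close> that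
      is not positive; the quotient \<open>?p / ?q\<close> is formed only for
      \<open>?p > 0\<close>.\<close>
    case False
    have "S = {}"
    proof (rule ccontr)
      assume "S \<noteq> {}"
      then obtain x where "x \<in> S" by blast
      then obtain u v where "u < v" "F v - F u < ?p * (v - u)" using lo[of x 1] by auto
      moreover have "?p * (v - u) \<le> 0" using False \<open>u < v\<close> by (simp add: mult_nonpos_nonneg)
      ultimately show False using inc[of u v] by simp
    qed
    then show ?thesis by simp
  next
    case True
    show ?thesis
    proof (rule negligible_if_density_le[OF Sl, of "?p / ?q"])
      show "0 < ?p / ?q" "?p / ?q < 1" using True \<open>p < q\<close> by auto
      fix x d :: real assume x: "x \<in> S" "0 < d"
      then obtain u v where uv: "u < v" "v - u < d" "x \<in> {u..v}" "F v - F u < ?p * (v - u)"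
        using lo by blast
      \<comment> \<open>The steep intervals inside \<open>{u<..<v}\<close> force growth in
        proportion to the measure of \<open>S\<close> there, while the flat interval itself allows
        only \<open>?p * (v - u)\<close>.\<close>
      have "?q * measure lebesgue (S \<inter> {u<..<v}) \<le> F v - F u"
        by (rule increment_ge_of_Vitali_cover[OF mono cF])
           (use True \<open>p < q\<close> uv hi in \<open>auto intro!: fmeasurable_Int_fmeasurable Sl\<close>)
      moreover have "measure lebesgue (S \<inter> {u..v}) = measure lebesgue (S \<inter> {u<..<v})"
      proof (rule measure_negligible_symdiff)
        show "S \<inter> {u<..<v} \<in> lmeasurable" using Sl by (intro fmeasurable_Int_fmeasurable) auto
        have "negligible {u, v}" by (simp add: negligible_finite)
        then show "negligible (S \<inter> {u<..<v} - S \<inter> {u..v} \<union> (S \<inter> {u..v} - S \<inter> {u<..<v}))"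
          by (rule negligible_subset) auto
      qed
      ultimately have "measure lebesgue (S \<inter> {u..v}) \<le> ?p / ?q * (v - u)"
        using uv True \<open>p < q\<close> by (simp add: field_simps)
      moreover have "cball ((u + v)/2) ((v - u)/2) = {u..v}"
        using uv by (auto simp: dist_real_def abs_le_iff field_simps)
      ultimately show "\<exists>a r. 0 < r \<and> r < d \<and> x \<in> cball a r \<and>
          measure lebesgue (S \<inter> cball a r) \<le> ?p / ?q * measure lebesgue (cball a r)"
        using uv x by (intro exI[of _ "(u + v)/2"] exI[of _ "(v - u)/2"]) auto
    qed
  qed
  then show ?thesis by (simp add: S_def)
qed

lemma negligible_dini_gap_real:
  fixes f :: "real \<Rightarrow> real"
  assumes L: "L-lipschitz_on UNIV f" and "p < q"
  shows "negligible (dini_gap f 1 p q)"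
proof -
  have "dini_gap f 1 p q = (\<Union>n::nat. dini_gap f 1 p q \<inter> {- real n<..<real n})"
  proof -
    have "\<exists>n::nat. - real n < x \<and> x < real n" for x
      using reals_Archimedean2[of "\<bar>x\<bar>"] by (metis abs_less_iff minus_less_iff)
    then show ?thesis by auto
  qed
  also have "negligible \<dots>"
    by (intro negligible_countable_Union) (auto intro: negligible_dini_gap_real_bounded assms)
  finally show ?thesis .
qed

text \<open>Fubini without choosing a complement of \<open>v\<close>: by translation invariance the
  measure of \<open>S\<close> is the mean over \<open>t\<close> in \<open>{0..1}\<close> of the
  measures of its translates, and exchanging the integrals leaves lengths of \<open>S\<close> along
  lines. The case \<open>v = 0\<close> is covered as well.\<close>

lemma negligible_if_null_on_lines:
  fixes S :: "'a::euclidean_space set"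
  assumes S: "S \<in> sets borel" and null: "\<And>x. negligible {t::real. x + t *\<^sub>R v \<in> S}"
  shows "negligible S"
proof -
  have transl: "(\<integral>\<^sup>+x. indicator S (x + t *\<^sub>R v) \<partial>lborel) = emeasure lborel S" for t :: real
  proof -
    have "emeasure lborel S = emeasure (distr lborel borel ((+) (t *\<^sub>R v))) S"
      using lborel_distr_plus[of "t *\<^sub>R v"] by simp
    also have "\<dots> = (\<integral>\<^sup>+x. indicator S x \<partial>distr lborel borel ((+) (t *\<^sub>R v)))"
      using S by simp
    also have "\<dots> = (\<integral>\<^sup>+x. indicator S (t *\<^sub>R v + x) \<partial>lborel)"
      using S by (subst nn_integral_distr) auto
    finally show ?thesis by (simp add: add.commute)
  qed
  have meas: "(\<lambda>(t::real, x). indicator S (x + t *\<^sub>R v) * indicator {0..1} t :: ennreal)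
      \<in> borel_measurable (lborel \<Otimes>\<^sub>M lborel)"
    using S by (simp add: borel_prod split_beta')
  have "emeasure lborel S = (\<integral>\<^sup>+t. (\<integral>\<^sup>+x. indicator S (x + t *\<^sub>R v) * indicator {0..1} t \<partial>lborel) \<partial>lborel)"
  proof -
    have "(\<integral>\<^sup>+x. indicator S (x + t *\<^sub>R v) * indicator {0..1} t \<partial>lborel) = emeasure lborel S * indicator {0..1} t" for t
      using S by (subst nn_integral_multc) (auto simp: transl)
    then show ?thesis by (simp add: nn_integral_cmult)
  qed
  also have "\<dots> = (\<integral>\<^sup>+x. (\<integral>\<^sup>+t. indicator S (x + t *\<^sub>R v) * indicator {0..1} t \<partial>lborel) \<partial>lborel)"
    using lborel_pair.Fubini'[OF meas] by simp
  also have "\<dots> = 0"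
  proof -
    have "(\<integral>\<^sup>+t. indicator S (x + t *\<^sub>R v) * indicator {0..1} t \<partial>lborel) = 0" for x
    proof -
      have b: "{t::real. x + t *\<^sub>R v \<in> S} \<in> sets borel"
        using S by measurable
      have "(\<integral>\<^sup>+t. indicator S (x + t *\<^sub>R v) * indicator {0..1} t \<partial>lborel) \<le>
          (\<integral>\<^sup>+t. indicator {t. x + t *\<^sub>R v \<in> S} t \<partial>lborel)"
        by (intro nn_integral_mono) (auto simp: indicator_def)
      also have "\<dots> = emeasure lborel {t. x + t *\<^sub>R v \<in> S}"
        using b by simp
      also have "\<dots> = 0"
        using null[of x] b by (simp add: negligible_iff_null_sets null_sets_def)
      finally show ?thesis by simp
    qed
    then show ?thesis by simp
  qed
  finally show ?thesis
    using S by (simp add: negligible_iff_null_sets null_sets_def)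
qed

lemma negligible_dini_gap:
  fixes f :: "'a::euclidean_space \<Rightarrow> real"
  assumes L: "L-lipschitz_on UNIV f" and "p < q"
  shows "negligible (dini_gap f v p q)"
proof (rule negligible_if_null_on_lines[where v=v])
  show "dini_gap f v p q \<in> sets borel"
    by (intro dini_gap_borel lipschitz_on_continuous_on[OF L])
  fix x
  have "(L * norm v)-lipschitz_on UNIV (\<lambda>t. f (x + t *\<^sub>R v))"
  proof (rule lipschitz_onI)
    show "0 \<le> L * norm v" using lipschitz_on_nonneg[OF L] by simp
    fix s t :: real
    have "dist (f (x + s *\<^sub>R v)) (f (x + t *\<^sub>R v)) \<le> L * dist (x + s *\<^sub>R v) (x + t *\<^sub>R v)"
      using L by (rule lipschitz_onD) auto
    also have "dist (x + s *\<^sub>R v) (x + t *\<^sub>R v) = norm v * dist s t"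
      by (simp add: dist_norm scaleR_diff_left[symmetric])
    finally show "dist (f (x + s *\<^sub>R v)) (f (x + t *\<^sub>R v)) \<le> L * norm v * dist s t" by simp
  qed
  from negligible_dini_gap_real[OF this \<open>p < q\<close>]
  have "negligible (dini_gap (\<lambda>t. f (x + t *\<^sub>R v)) 1 p q)" .
  moreover have "dini_gap (\<lambda>t. f (x + t *\<^sub>R v)) 1 p q = {t. x + t *\<^sub>R v \<in> dini_gap f v p q}"
    by (auto simp: dini_gap_def algebra_simps)
  ultimately show "negligible {t. x + t *\<^sub>R v \<in> dini_gap f v p q}" by simp
qed

text \<open>The limit is the supremum of the eventual lower bounds. If rationals
  \<open>p < q\<close> lie just above it, \<open>p\<close> is no eventual lower bound, so the
  absence of a gap makes \<open>q\<close> an eventual upper bound.\<close>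

lemma tendsto_if_no_gap:
  fixes \<phi> :: "'a \<Rightarrow> real"
  assumes F: "F \<noteq> bot" and bdd: "eventually (\<lambda>t. \<bar>\<phi> t\<bar> \<le> L) F"
    and gap: "\<And>p q. p \<in> \<rat> \<Longrightarrow> q \<in> \<rat> \<Longrightarrow> p < q \<Longrightarrow>
      \<not> (frequently (\<lambda>t. \<phi> t < p) F \<and> frequently (\<lambda>t. q < \<phi> t) F)"
  shows "\<exists>l. (\<phi> \<longlongrightarrow> l) F"
proof -
  define A where "A = {p. eventually (\<lambda>t. p \<le> \<phi> t) F}"
  have "- L \<in> A" using bdd by (auto simp: A_def elim: eventually_mono)
  have up: "p \<le> L" if "p \<in> A" for p
  proof -
    have "eventually (\<lambda>t. p \<le> L) F"
      using that bdd unfolding A_def by (auto elim: eventually_elim2)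
    then show ?thesis using F by (simp add: eventually_const)
  qed
  have bA: "bdd_above A" using up by (auto simp: bdd_above_def)
  define l where "l = Sup A"
  have "eventually (\<lambda>t. dist (\<phi> t) l < \<epsilon>) F" if "\<epsilon> > 0" for \<epsilon>
  proof -
    obtain a where a: "a \<in> A" "l - \<epsilon> < a"
      using less_cSupE[of "l - \<epsilon>" A] \<open>\<epsilon> > 0\<close> \<open>- L \<in> A\<close> unfolding l_def by (metis diff_less_eq empty_iff less_add_same_cancel1)
    obtain p q where pq: "p \<in> \<rat>" "q \<in> \<rat>" "l < p" "p < q" "q < l + \<epsilon>"
      using Rats_dense_in_real[of l "l + \<epsilon>"] Rats_dense_in_real \<open>\<epsilon> > 0\<close> by (metis less_add_same_cancel1)
    have "p \<notin> A" using cSup_upper[OF _ bA, of p] pq by (auto simp: l_def)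
    then have "frequently (\<lambda>t. \<phi> t < p) F"
      by (simp add: A_def frequently_def not_less)
    then have "eventually (\<lambda>t. \<phi> t \<le> q) F"
      using gap[OF pq(1,2,4)] by (simp add: frequently_def not_less)
    moreover have "eventually (\<lambda>t. a \<le> \<phi> t) F" using a by (simp add: A_def)
    ultimately show ?thesis
      by eventually_elim (use a pq in \<open>auto simp: dist_real_def\<close>)
  qed
  then show ?thesis by (auto simp: tendsto_iff)
qed

lemma directional_derivative_if_not_dini_gap:
  fixes f :: "'a::euclidean_space \<Rightarrow> real"
  assumes L: "L-lipschitz_on UNIV f"
    and gap: "\<And>p q. p \<in> \<rat> \<Longrightarrow> q \<in> \<rat> \<Longrightarrow> p < q \<Longrightarrow> x \<notin> dini_gap f v p q"
  shows "\<exists>l. ((\<lambda>t. (f (x + t *\<^sub>R v) - f x) / t) \<longlongrightarrow> l) (at 0)"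
proof (rule tendsto_if_no_gap)
  show "eventually (\<lambda>t. \<bar>(f (x + t *\<^sub>R v) - f x) / t\<bar> \<le> L * norm v) (at 0)"
  proof -
    have "\<bar>(f (x + t *\<^sub>R v) - f x) / t\<bar> \<le> L * norm v" if "t \<noteq> 0" for t
      using lipschitz_onD[OF L, of "x + t *\<^sub>R v" x] that
      by (simp add: dist_norm abs_divide field_simps)
    then show ?thesis by (auto simp: eventually_at intro!: exI[of _ 1])
  qed
  fix p q :: real assume pq: "p \<in> \<rat>" "q \<in> \<rat>" "p < q"
  have fr: "\<exists>t. 0 < \<bar>t\<bar> \<and> \<bar>t\<bar> < inverse (Suc m) \<and> P t"
    if "frequently P (at 0)" for P :: "real \<Rightarrow> bool" and m :: nat
  proof -
    have "frequently (\<lambda>t. P t \<and> (t \<noteq> 0 \<and> \<bar>t\<bar> < inverse (real (Suc m)))) (at 0)"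
      by (rule frequently_rev_mp[OF that])
         (auto simp: eventually_at dist_real_def intro!: exI[of _ "inverse (real (Suc m))"])
    then show ?thesis by (auto dest!: frequently_ex)
  qed
  show "\<not> ((\<exists>\<^sub>F t in at 0. (f (x + t *\<^sub>R v) - f x) / t < p) \<and> (\<exists>\<^sub>F t in at 0. q < (f (x + t *\<^sub>R v) - f x) / t))"
  proof (rule notI, elim conjE)
    assume "\<exists>\<^sub>F t in at 0. (f (x + t *\<^sub>R v) - f x) / t < p" "\<exists>\<^sub>F t in at 0. q < (f (x + t *\<^sub>R v) - f x) / t"
    then have "x \<in> dini_gap f v p q"
      unfolding dini_gap_def using fr by blast
    then show False using gap[OF pq] by blast
  qed
qed simp

section \<open>From partial derivatives to differentiability by porosity\<close>

text \<open>These are the points at which \<open>A\<close> is porous. Off this part, at all small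
  scales \<open>r\<close>, every \<open>z\<close> within \<open>r\<close> of \<open>x\<close> has a
  point of \<open>A\<close> within \<open>c * r\<close> as a substitute.\<close>

definition porous_part :: "real \<Rightarrow> 'a::euclidean_space set \<Rightarrow> 'a set" where
  "porous_part c A = {x\<in>A. \<forall>m::nat. \<exists>r z. 0 < r \<and> r < inverse (Suc m) \<and> dist x z < r \<and> ball z (c * r) \<inter> A = {}}"

lemma porous_partD:
  assumes "x \<in> porous_part c A" "0 < d"
  obtains r z where "0 < r" "r < d" "dist x z < r" "ball z (c * r) \<inter> A = {}"
proof -
  obtain m where m: "inverse (real (Suc m)) < d" using reals_Archimedean[OF \<open>0 < d\<close>] by blast
  show ?thesis
    using assms(1) m that unfolding porous_part_def mem_Collect_eq by (meson less_trans)
qed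

text \<open>The hole of radius \<open>c * r\<close> lies inside \<open>cball x (2 * r)\<close>, so
  \<open>A\<close> misses at least the fraction \<open>(c / 2) ^ DIM('a)\<close> of that ball; the
  density criterion applies to bounded pieces.\<close>

lemma negligible_porous_part:
  fixes A :: "'a::euclidean_space set"
  assumes "closed A" and c: "0 < c" "c < 1"
  shows "negligible (porous_part c A)"
proof -
  let ?P = "porous_part c A"
  \<comment> \<open>Turning the existential quantifiers into unions of open balls shows that the set
    is Borel.\<close>
  have "?P = A \<inter> (\<Inter>m::nat. (\<Union>z. \<Union>r\<in>{r. 0 < r \<and> r < inverse (Suc m) \<and> ball z (c * r) \<inter> A = {}}. ball z r))"
    unfolding porous_part_def by (auto simp: dist_commute; blast)
  also have "\<dots> \<in> sets borel"
    using \<open>closed A\<close> by (intro sets.Int sets.countable_INT borel_closed image_subsetI borel_open open_UN ballI open_ball) auto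
  finally have P: "?P \<in> sets borel" .
  have "negligible (?P \<inter> ball 0 (real n))" for n
  proof (rule negligible_if_density_le[where c="1 - (c / 2) ^ DIM('a)"])
    show S: "?P \<inter> ball 0 (real n) \<in> lmeasurable"
      using P by (intro bounded_set_imp_lmeasurable) (auto intro!: sets.Int bounded_Int)
    show "0 < 1 - (c / 2) ^ DIM('a)"
      using c by (simp add: power_less_one_iff)
    show "1 - (c / 2) ^ DIM('a) < 1"
      using c by simp
    fix x and d :: real assume x: "x \<in> ?P \<inter> ball 0 (real n)" "0 < d"
    then obtain r z where rz: "0 < r" "r < d / 2" "dist x z < r" "ball z (c * r) \<inter> A = {}"
      using porous_partD[of x c A "d/2"] by auto
    have sub: "ball z (c * r) \<subseteq> cball x (2 * r)"
    proof
      fix y assume "y \<in> ball z (c * r)"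
      moreover have "c * r < r" using c rz by simp
      ultimately show "y \<in> cball x (2 * r)"
        using rz dist_triangle[of x y z] unfolding mem_ball mem_cball by linarith
    qed
    have "measure lebesgue (?P \<inter> ball 0 (real n) \<inter> cball x (2 * r)) \<le> measure lebesgue (cball x (2 * r) - ball z (c * r))"
      using rz S by (intro measure_mono_fmeasurable) (auto simp: porous_part_def)
    also have "\<dots> = measure lebesgue (cball x (2 * r)) - measure lebesgue (ball z (c * r))"
      using sub by (intro measurable_measure_Diff) auto
    also have "\<dots> = (1 - (c / 2) ^ DIM('a)) * measure lebesgue (cball x (2 * r))"
      using rz c by (simp add: content_ball content_cball power_mult_distrib power_divide field_simps)
    finally show "\<exists>a r. 0 < r \<and> r < d \<and> x \<in> cball a r \<and>
      measure lebesgue (?P \<inter> ball 0 (real n) \<inter> cball a r) \<le> (1 - (c / 2) ^ DIM('a)) * measure lebesgue (cball a r)"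
      using rz by (intro exI[of _ x] exI[of _ "2 * r"]) auto
  qed
  then have "negligible (\<Union>n. ?P \<inter> ball 0 (real n))"
    by (intro negligible_countable_Union) auto
  moreover have "?P = (\<Union>n. ?P \<inter> ball 0 (real n))"
    using reals_Archimedean2 by auto
  ultimately show ?thesis by simp
qed

text \<open>Fixing the vector \<open>y\<close>, the error \<open>\<epsilon>\<close> and the scale
  \<open>\<delta>\<close> makes the condition closed in \<open>x\<close> and uniform over the set. A
  point with all partial derivatives lies, for each positive error, in such a set with
  \<open>y\<close> from a countable dense set and some \<open>\<delta>\<close>.\<close>

definition approx_partials :: "('a::euclidean_space \<Rightarrow> real) \<Rightarrow> 'a \<Rightarrow> real \<Rightarrow> real \<Rightarrow> 'a set" where
  "approx_partials f y \<epsilon> \<delta> = {x. \<forall>b\<in>Basis. \<forall>t. \<bar>t\<bar> \<le> \<delta> \<longrightarrow> \<bar>f (x + t *\<^sub>R b) - f x - t * (y \<bullet> b)\<bar> \<le> \<epsilon> * \<bar>t\<bar>}"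

lemma closed_approx_partials:
  assumes "continuous_on UNIV f"
  shows "closed (approx_partials f y \<epsilon> \<delta>)"
proof -
  have c: "continuous_on UNIV (\<lambda>x. \<bar>f (x + t *\<^sub>R v) - f x - a\<bar>)" for t v a
    by (intro continuous_intros continuous_on_compose2[OF assms]) auto
  have "approx_partials f y \<epsilon> \<delta> =
      (\<Inter>b\<in>Basis. \<Inter>t\<in>{t. \<bar>t\<bar> \<le> \<delta>}. {x. \<bar>f (x + t *\<^sub>R b) - f x - t * (y \<bullet> b)\<bar> \<le> \<epsilon> * \<bar>t\<bar>})"
    by (auto simp: approx_partials_def)
  then show ?thesis
    by (auto intro!: closed_INT closed_Collect_le c continuous_on_const)
qed

text \<open>Away from its porous part the set comes so close to every intermediate point of a coordinate
  path from \<open>x\<close> to \<open>x + w\<close> that each coordinate step can be started in the set.\<close>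

lemma linear_approx_if_not_porous:
  fixes f :: "'a::euclidean_space \<Rightarrow> real" and L :: real
  assumes L: "L-lipschitz_on UNIV f" and "\<epsilon> > 0" "\<delta> > 0"
    and x: "x \<in> approx_partials f y \<epsilon> \<delta>"
    and np: "x \<notin> porous_part (\<epsilon> / (2 * real DIM('a))) (approx_partials f y \<epsilon> \<delta>)"
  shows "\<exists>d>0. \<forall>w. norm w < d \<longrightarrow> \<bar>f (x + w) - f x - y \<bullet> w\<bar> \<le> DIM('a) * (1 + 2 * L) * \<epsilon> * norm w"
proof -
  let ?A = "approx_partials f y \<epsilon> \<delta>"
  let ?n = "real DIM('a)"
  have L0: "L \<ge> 0" using L by (rule lipschitz_on_nonneg)
  have "\<not> (\<forall>m::nat. \<exists>r z. 0 < r \<and> r < inverse (Suc m) \<and> dist x z < r \<and> ball z (\<epsilon> / (2 * ?n) * r) \<inter> ?A = {})"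
    using np x unfolding porous_part_def mem_Collect_eq by (simp only: simp_thms)
  then obtain m :: nat where m: "\<And>r z. 0 < r \<Longrightarrow> r < inverse (real (Suc m)) \<Longrightarrow> dist x z < r \<Longrightarrow> ball z (\<epsilon> / (2 * ?n) * r) \<inter> ?A \<noteq> {}"
    by (simp only: not_all not_ex) metis
  define d where "d = min \<delta> (inverse (real (Suc m)) / (2 * ?n))"
  have n1: "?n \<ge> 1" using DIM_positive[where 'a='a] by linarith
  have "d > 0" using \<open>\<delta> > 0\<close> n1 by (simp add: d_def)
  moreover have "\<bar>f (x + w) - f x - y \<bullet> w\<bar> \<le> ?n * (1 + 2 * L) * \<epsilon> * norm w" if w: "norm w < d" for w
  proof (cases "w = 0")
    case True then show ?thesis by simp
  next
    case False
    \<comment> \<open>At this scale every intermediate point of the coordinate path lies within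
      \<open>r\<close> of \<open>x\<close>, and the hole radius
      \<open>\<epsilon> / (2 * ?n) * r\<close> equals \<open>\<epsilon> * norm w\<close>.\<close>
    define r where "r = 2 * ?n * norm w"
    have "norm w < inverse (real (Suc m)) / (2 * ?n)"
      using w by (simp add: d_def)
    then have r: "0 < r" "r < inverse (real (Suc m))"
      using False n1 by (simp_all add: r_def pos_less_divide_eq mult.commute)
    have "\<bar>f (x + (\<Sum>b\<in>B. (w \<bullet> b) *\<^sub>R b)) - f x - (\<Sum>b\<in>B. (w \<bullet> b) * (y \<bullet> b))\<bar> \<le> card B * ((1 + 2 * L) * \<epsilon> * norm w)"
      if "finite B" "B \<subseteq> Basis" for B
      using that
    proof (induction rule: finite_induct)
      case empty then show ?case by simp
    next
      case (insert b B)
      define z where "z = x + (\<Sum>b\<in>B. (w \<bullet> b) *\<^sub>R b)"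
      have b: "b \<in> Basis" using insert by auto
      have wb: "\<bar>w \<bullet> b\<bar> \<le> norm w" using b by (rule Basis_le_norm)
      have "norm (\<Sum>b\<in>B. (w \<bullet> b) *\<^sub>R b) \<le> (\<Sum>b\<in>B. norm w)"
        using insert by (intro sum_norm_le) (auto simp: Basis_le_norm)
      also have "\<dots> \<le> ?n * norm w"
        using insert by (simp add: card_mono mult_right_mono)
      also have "\<dots> < r"
        using False n1 by (simp add: r_def)
      finally have "dist x z < r" by (simp add: z_def dist_norm)
      \<comment> \<open>The step starts at \<open>a\<close> instead of \<open>z\<close>. The
        substitution costs \<open>L * (\<epsilon> * norm w)\<close> at either end of the step and
        the step itself \<open>\<epsilon> * norm w\<close>, whence the factor
        \<open>1 + 2 * L\<close> per coordinate.\<close>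
      then obtain a where a: "a \<in> ?A" "dist z a < \<epsilon> * norm w"
        using m[OF r, of z] n1 unfolding r_def by (auto simp: field_simps)
      have 1: "\<bar>f (z + (w \<bullet> b) *\<^sub>R b) - f (a + (w \<bullet> b) *\<^sub>R b)\<bar> \<le> L * (\<epsilon> * norm w)"
        using lipschitz_onD[OF L, of "z + (w \<bullet> b) *\<^sub>R b" "a + (w \<bullet> b) *\<^sub>R b"] a(2) L0
          mult_left_mono[of "dist z a" "\<epsilon> * norm w" L]
        by (simp add: dist_real_def)
      have 2: "\<bar>f a - f z\<bar> \<le> L * (\<epsilon> * norm w)"
        using lipschitz_onD[OF L, of a z] a(2) L0
          mult_left_mono[of "dist z a" "\<epsilon> * norm w" L]
        by (simp add: dist_real_def dist_commute)
      have 3: "\<bar>f (a + (w \<bullet> b) *\<^sub>R b) - f a - (w \<bullet> b) * (y \<bullet> b)\<bar> \<le> \<epsilon> * norm w"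
      proof -
        have "\<bar>f (a + (w \<bullet> b) *\<^sub>R b) - f a - (w \<bullet> b) * (y \<bullet> b)\<bar> \<le> \<epsilon> * \<bar>w \<bullet> b\<bar>"
          using a(1) b wb w unfolding approx_partials_def d_def by auto
        also have "\<dots> \<le> \<epsilon> * norm w"
          using wb \<open>\<epsilon> > 0\<close> by simp
        finally show ?thesis .
      qed
      have 4: "\<bar>f z - f x - (\<Sum>b\<in>B. (w \<bullet> b) * (y \<bullet> b))\<bar> \<le> card B * ((1 + 2 * L) * \<epsilon> * norm w)"
        using insert by (simp add: z_def)
      have eqs: "x + (\<Sum>b\<in>insert b B. (w \<bullet> b) *\<^sub>R b) = z + (w \<bullet> b) *\<^sub>R b"
        "(\<Sum>b\<in>insert b B. (w \<bullet> b) * (y \<bullet> b)) = (w \<bullet> b) * (y \<bullet> b) + (\<Sum>b\<in>B. (w \<bullet> b) * (y \<bullet> b))"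
        "real (card (insert b B)) = real (card B) + 1"
        using insert by (simp_all add: z_def)
      show ?case
        unfolding eqs using 1 2 3 4 by (simp add: algebra_simps abs_le_iff)
    qed
    from this[of Basis] show ?thesis
      by (simp add: euclidean_representation euclidean_inner[of y w] mult.commute mult.left_commute)
  qed
  ultimately show ?thesis by blast
qed

text \<open>Two null sets are discarded: \<open>N1\<close>, off which the partial derivatives exist,
  and \<open>N2\<close>, off which they assemble to a total derivative. Both are countable unions,
  thanks to rational \<open>p\<close> and \<open>q\<close>, candidate gradients from a countable
  dense set, and errors and scales of the form \<open>inverse (Suc m)\<close>.\<close>

theorem Rademacher_real:
  fixes f :: "'a::euclidean_space \<Rightarrow> real"
  assumes L: "L-lipschitz_on UNIV f"
  shows "negligible {x. \<not> f differentiable (at x)}"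
proof -
  let ?n = "real DIM('a)"
  have n1: "?n \<ge> 1" using DIM_positive[where 'a='a] by linarith
  have L0: "L \<ge> 0" using L by (rule lipschitz_on_nonneg)
  have cf: "continuous_on UNIV f" using L by (rule lipschitz_on_continuous_on)
  obtain D :: "'a set" where D: "countable D" "\<And>X. open X \<Longrightarrow> X \<noteq> {} \<Longrightarrow> \<exists>d\<in>D. d \<in> X"
    using countable_dense_exists by metis
  define e :: "nat \<Rightarrow> real" where "e m = inverse (real (Suc m))" for m
  have e: "0 < e m" "e m \<le> 1" for m by (auto simp: e_def field_simps)
  define N1 where "N1 = (\<Union>b\<in>Basis. \<Union>p\<in>\<rat>. \<Union>q\<in>\<rat> \<inter> {p<..}. dini_gap f b p q)"
  define N2 where "N2 = (\<Union>y\<in>D. \<Union>m. \<Union>k. porous_part (e m / (2 * ?n)) (approx_partials f y (e m) (e k)))"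
  have "negligible N1"
    unfolding N1_def
    by (intro negligible_countable_Union countable_image countable_finite countable_rat ballI)
       (auto intro!: negligible_dini_gap[OF L] negligible_countable_Union countable_image countable_rat
         intro: countable_subset[OF _ countable_rat])
  moreover have half: "0 < e m / (2 * ?n)" "e m / (2 * ?n) < 1" for m
  proof -
    have "e m < 2 * ?n" using e(2)[of m] n1 by linarith
    then show "0 < e m / (2 * ?n)" "e m / (2 * ?n) < 1"
      using e(1)[of m] by (simp_all add: divide_less_eq)
  qed
  have "negligible N2"
    unfolding N2_def
    by (intro negligible_countable_Union countable_image ballI D)
       (auto intro!: negligible_porous_part closed_approx_partials cf negligible_countable_Union half)
  ultimately have "negligible (N1 \<union> N2)" by simp
  moreover have "f differentiable (at x)" if x: "x \<notin> N1 \<union> N2" for x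
  proof -
    have "\<exists>l. ((\<lambda>t. (f (x + t *\<^sub>R b) - f x) / t) \<longlongrightarrow> l) (at 0)" if "b \<in> Basis" for b
      using x that by (intro directional_derivative_if_not_dini_gap[OF L]) (auto simp: N1_def)
    then obtain l where l: "\<And>b. b \<in> Basis \<Longrightarrow> ((\<lambda>t. (f (x + t *\<^sub>R b) - f x) / t) \<longlongrightarrow> l b) (at 0)"
      by metis
    define y0 where "y0 = (\<Sum>b\<in>Basis. l b *\<^sub>R b)"
    have y0: "y0 \<bullet> b = l b" if "b \<in> Basis" for b
      using that by (simp add: y0_def)
    have main: "\<exists>d>0. \<forall>w. norm w < d \<longrightarrow> \<bar>f (x + w) - f x - y0 \<bullet> w\<bar> \<le> \<epsilon> * norm w" if "\<epsilon> > 0" for \<epsilon>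
    proof -
      \<comment> \<open>The summand \<open>1\<close> pays for replacing \<open>y\<close> by the
        gradient \<open>y0\<close>; the rest is the constant of
        \<open>linear_approx_if_not_porous\<close>.\<close>
      define C where "C = ?n * (1 + 2 * L) + 1"
      have C: "C > 0" using L0 n1 by (simp add: C_def add_nonneg_pos)
      obtain m where m: "e m < \<epsilon> / C"
        using reals_Archimedean[OF divide_pos_pos[OF \<open>\<epsilon> > 0\<close> C]] unfolding e_def by blast
      obtain y where y: "y \<in> D" "dist y0 y < e m / 2"
      proof -
        have "ball y0 (e m / 2) \<noteq> {}" using e(1)[of m] by simp
        then show ?thesis using D(2)[OF open_ball] that by (meson mem_ball)
      qed
      have "eventually (\<lambda>t. dist ((f (x + t *\<^sub>R b) - f x) / t) (l b) < e m / 2) (at 0)" if "b \<in> Basis" for b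
        using l[OF that] e(1)[of m] unfolding tendsto_iff by (meson half_gt_zero)
      then have "eventually (\<lambda>t. \<forall>b\<in>Basis. dist ((f (x + t *\<^sub>R b) - f x) / t) (l b) < e m / 2) (at 0)"
        by (intro eventually_ball_finite) auto
      then obtain \<delta> where \<delta>: "\<delta> > 0"
        "\<And>t. t \<noteq> 0 \<Longrightarrow> dist t 0 < \<delta> \<Longrightarrow> \<forall>b\<in>Basis. dist ((f (x + t *\<^sub>R b) - f x) / t) (l b) < e m / 2"
        unfolding eventually_at by blast
      obtain k where k: "e k < \<delta>"
        using reals_Archimedean[OF \<open>\<delta> > 0\<close>] unfolding e_def by blast
      have "x \<in> approx_partials f y (e m) (e k)"
        unfolding approx_partials_def
      proof (intro CollectI ballI allI impI)
        fix b :: 'a and t :: real assume b: "b \<in> Basis" and t: "\<bar>t\<bar> \<le> e k"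
        show "\<bar>f (x + t *\<^sub>R b) - f x - t * (y \<bullet> b)\<bar> \<le> e m * \<bar>t\<bar>"
        proof (cases "t = 0")
          case False
          have 1: "\<bar>(f (x + t *\<^sub>R b) - f x) / t - l b\<bar> < e m / 2"
            using \<delta>(2)[OF False] t k b by (simp add: dist_real_def)
          have "\<bar>(y0 - y) \<bullet> b\<bar> \<le> norm (y0 - y)" using b by (rule Basis_le_norm)
          then have 2: "\<bar>l b - y \<bullet> b\<bar> < e m / 2"
            using y b by (simp add: inner_diff_left y0 dist_norm)
          have "\<bar>(f (x + t *\<^sub>R b) - f x) / t - y \<bullet> b\<bar> \<le> e m"
            using 1 2 by linarith
          then have "\<bar>t\<bar> * \<bar>(f (x + t *\<^sub>R b) - f x) / t - y \<bullet> b\<bar> \<le> \<bar>t\<bar> * e m"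
            by (intro mult_left_mono) auto
          also have "\<bar>t\<bar> * \<bar>(f (x + t *\<^sub>R b) - f x) / t - y \<bullet> b\<bar> = \<bar>f (x + t *\<^sub>R b) - f x - t * (y \<bullet> b)\<bar>"
            using False unfolding abs_mult[symmetric] right_diff_distrib by simp
          finally show ?thesis by (simp add: mult.commute)
        qed simp
      qed
      moreover have "x \<notin> porous_part (e m / (2 * ?n)) (approx_partials f y (e m) (e k))"
        using x y by (auto simp: N2_def)
      ultimately obtain d where d: "d > 0"
        "\<And>w. norm w < d \<Longrightarrow> \<bar>f (x + w) - f x - y \<bullet> w\<bar> \<le> ?n * (1 + 2 * L) * e m * norm w"
        using linear_approx_if_not_porous[OF L e(1) e(1), of x y m k] by blast
      have "\<bar>f (x + w) - f x - y0 \<bullet> w\<bar> \<le> \<epsilon> * norm w" if "norm w < d" for w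
      proof -
        have "\<bar>(y - y0) \<bullet> w\<bar> \<le> norm (y - y0) * norm w" by (rule Cauchy_Schwarz_ineq2)
        also have "\<dots> \<le> e m * norm w"
          using y e(1)[of m] by (intro mult_right_mono) (auto simp: dist_norm norm_minus_commute)
        finally have "\<bar>f (x + w) - f x - y0 \<bullet> w\<bar> \<le> ?n * (1 + 2 * L) * e m * norm w + e m * norm w"
          using d(2)[OF that] by (simp add: inner_diff_left)
        also have "\<dots> = (C * e m) * norm w" by (simp add: C_def algebra_simps)
        also have "\<dots> \<le> \<epsilon> * norm w"
          using m C by (intro mult_right_mono) (auto simp: field_simps)
        finally show ?thesis .
      qed
      then show ?thesis using d(1) by blast
    qed
    have "(f has_derivative (\<lambda>w. y0 \<bullet> w)) (at x)"
      unfolding has_derivative_at_alt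
    proof (intro conjI allI impI)
      show "bounded_linear ((\<bullet>) y0)" by (rule bounded_linear_inner_right)
      fix \<epsilon> :: real assume "\<epsilon> > 0"
      then obtain d where d: "d > 0" "\<And>w. norm w < d \<Longrightarrow> \<bar>f (x + w) - f x - y0 \<bullet> w\<bar> \<le> \<epsilon> * norm w"
        using main by blast
      have "norm (f z - f x - y0 \<bullet> (z - x)) \<le> \<epsilon> * norm (z - x)" if "norm (z - x) < d" for z
        using d(2)[OF that] by simp
      then show "\<exists>d>0. \<forall>z. norm (z - x) < d \<longrightarrow> norm (f z - f x - y0 \<bullet> (z - x)) \<le> \<epsilon> * norm (z - x)"
        using d(1) by blast
    qed
    then show ?thesis by (auto simp: differentiable_def)
  qed
  ultimately show ?thesis
    by (elim negligible_subset) blast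
qed

text \<open>The nearest-point projection onto the convex ball does not increase distances, so the
  constant is kept whatever the space of values.\<close>

lemma lipschitz_extension_from_cball:
  fixes f :: "'a::euclidean_space \<Rightarrow> 'b::metric_space"
  assumes "L-lipschitz_on (cball a r) f" "0 \<le> r"
  shows "L-lipschitz_on UNIV (f \<circ> closest_point (cball a r))"
proof -
  have "1-lipschitz_on UNIV (closest_point (cball a r))"
    by (rule lipschitz_onI) (use assms closest_point_lipschitz[of "cball a r"] in auto)
  moreover have "closest_point (cball a r) ` UNIV \<subseteq> cball a r"
    using assms closest_point_in_set[of "cball a r"] by (auto simp: cball_eq_empty)
  ultimately have "(L * 1)-lipschitz_on UNIV (f \<circ> closest_point (cball a r))"
    using lipschitz_on_subset[OF assms(1)] by (intro lipschitz_on_compose) auto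
  then show ?thesis by simp
qed

text \<open>Negligibility is a local property, and on a small ball \<open>g\<close> coincides with a
  globally Lipschitz map, to whose components the real-valued case applies.\<close>

theorem Rademacher:
  fixes g :: "'a::euclidean_space \<Rightarrow> 'b::euclidean_space"
  assumes "open U" "locally_lipschitz_on U g"
  shows "negligible {x\<in>U. \<not> g differentiable (at x)}"
proof (subst locally_negligible_alt, rule ballI)
  fix x assume x: "x \<in> {x \<in> U. \<not> g differentiable (at x)}"
  then obtain r where r: "r > 0" "cball x r \<subseteq> U"
    using \<open>open U\<close> open_contains_cball by blast
  obtain L where L: "L-lipschitz_on (cball x r) g"
    using assms(2) r compact_cball unfolding locally_lipschitz_on_def by blast
  define h where "h = g \<circ> closest_point (cball x r)"
  have h: "L-lipschitz_on UNIV h"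
    unfolding h_def using L r by (intro lipschitz_extension_from_cball) auto
  have "L-lipschitz_on UNIV (\<lambda>x. h x \<bullet> b)" if "b \<in> Basis" for b
  proof (rule lipschitz_onI)
    fix y z
    have "dist (h y \<bullet> b) (h z \<bullet> b) \<le> dist (h y) (h z)"
      using Basis_le_norm[OF that, of "h y - h z"] by (simp add: dist_norm inner_diff_left)
    also have "\<dots> \<le> L * dist y z" using h by (rule lipschitz_onD) auto
    finally show "dist (h y \<bullet> b) (h z \<bullet> b) \<le> L * dist y z" .
  qed (rule lipschitz_on_nonneg[OF h])
  then have "negligible (\<Union>b\<in>Basis. {x. \<not> (\<lambda>x. h x \<bullet> b) differentiable (at x)})"
    by (intro negligible_Union) (auto intro: Rademacher_real)
  moreover have "{x \<in> U. \<not> g differentiable (at x)} \<inter> ball x r \<subseteq> (\<Union>b\<in>Basis. {x. \<not> (\<lambda>x. h x \<bullet> b) differentiable (at x)})"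
  proof
    fix y assume y: "y \<in> {x \<in> U. \<not> g differentiable (at x)} \<inter> ball x r"
    have "\<not> h differentiable (at y)"
    proof
      assume "h differentiable (at y)"
      moreover have "g z = h z" if "z \<in> ball x r" for z
        using that by (simp add: h_def closest_point_self)
      ultimately have "g differentiable (at y)"
        using y has_derivative_transform_within_open[of h _ y UNIV "ball x r" g]
        unfolding differentiable_def by (metis IntD2 UNIV_I open_ball)
      then show False using y by blast
    qed
    then show "y \<in> (\<Union>b\<in>Basis. {x. \<not> (\<lambda>x. h x \<bullet> b) differentiable (at x)})"
      using differentiable_componentwise_within[of h y UNIV] by auto
  qed
  ultimately have "negligible ({x \<in> U. \<not> g differentiable (at x)} \<inter> ball x r)"
    by (rule negligible_subset)
  then show "\<exists>V. openin (top_of_set {x \<in> U. \<not> g differentiable (at x)}) V \<and> x \<in> V \<and> negligible V"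
    using x r by (intro exI[of _ "{x \<in> U. \<not> g differentiable (at x)} \<inter> ball x r"]) (auto intro: openin_open_Int)
qed

section \<open>Symmetry of second derivatives and Jacobi's condition\<close>

text \<open>As \<open>u\<close> vanishes at \<open>a\<close>, no derivative of \<open>v\<close>
  enters the product rule and continuity of \<open>v\<close> suffices. This admits the derivative of
  a \<open>C\<^sup>1\<close> chart as second factor.\<close>

lemma has_derivative_inner_of_zero:
  fixes u v :: "'a::real_normed_vector \<Rightarrow> 'b::real_inner"
  assumes u: "(u has_derivative u') (at a)" and "u a = 0" and v: "isCont v a"
  shows "((\<lambda>x. u x \<bullet> v x) has_derivative (\<lambda>h. u' h \<bullet> v a)) (at a)"
proof -
  have bl: "bounded_linear u'" using u by (rule has_derivative_bounded_linear)
  have lim: "((\<lambda>y. norm (u y - u a - u' (y - a)) / norm (y - a)) \<longlongrightarrow> 0) (at a)"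
    using u by (simp add: has_derivative_iff_norm)
  obtain K where K: "\<And>h. norm (u' h) \<le> norm h * K"
    using bounded_linear.bounded[OF bl] by blast
  show ?thesis
    unfolding has_derivative_iff_norm
  proof (intro conjI)
    show "bounded_linear (\<lambda>h. u' h \<bullet> v a)"
      using bl by (rule bounded_linear_compose[OF bounded_linear_inner_left])
    have "((\<lambda>y. norm (u y - u a - u' (y - a)) / norm (y - a) * norm (v y) + K * norm (v y - v a)) \<longlongrightarrow> 0 * norm (v a) + K * norm (v a - v a)) (at a)"
      using v lim unfolding isCont_def by (intro tendsto_intros)
    then have "((\<lambda>y. norm (u y - u a - u' (y - a)) / norm (y - a) * norm (v y) + K * norm (v y - v a)) \<longlongrightarrow> 0) (at a)"
      by simp
    then show "((\<lambda>y. norm (u y \<bullet> v y - u a \<bullet> v a - u' (y - a) \<bullet> v a) / norm (y - a)) \<longlongrightarrow> 0) (at a)"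
    proof (rule tendsto_sandwich[OF _ _ tendsto_const, rotated 2])
      show "\<forall>\<^sub>F y in at a. norm (u y \<bullet> v y - u a \<bullet> v a - u' (y - a) \<bullet> v a) / norm (y - a) \<le>
          norm (u y - u a - u' (y - a)) / norm (y - a) * norm (v y) + K * norm (v y - v a)"
      proof (rule eventually_at_filter[THEN iffD2], rule always_eventually, intro allI impI)
        fix y assume "y \<noteq> a"
        then have n: "norm (y - a) > 0" by simp
        have "u y \<bullet> v y - u a \<bullet> v a - u' (y - a) \<bullet> v a = (u y - u a - u' (y - a)) \<bullet> v y + u' (y - a) \<bullet> (v y - v a)"
          using \<open>u a = 0\<close> by (simp add: inner_diff_left inner_diff_right)
        also have "norm \<dots> \<le> norm (u y - u a - u' (y - a)) * norm (v y) + norm (u' (y - a)) * norm (v y - v a)"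
          unfolding real_norm_def by (intro order_trans[OF abs_triangle_ineq] add_mono Cauchy_Schwarz_ineq2)
        also have "\<dots> \<le> norm (u y - u a - u' (y - a)) * norm (v y) + norm (y - a) * K * norm (v y - v a)"
          using K by (intro add_left_mono mult_right_mono) auto
        finally have "norm (u y \<bullet> v y - u a \<bullet> v a - u' (y - a) \<bullet> v a) / norm (y - a) \<le>
            (norm (u y - u a - u' (y - a)) * norm (v y) + norm (y - a) * K * norm (v y - v a)) / norm (y - a)"
          using n by (intro divide_right_mono) auto
        also have "\<dots> = norm (u y - u a - u' (y - a)) / norm (y - a) * norm (v y) + K * norm (v y - v a)"
          using n by (simp add: add_divide_distrib)
        finally show "norm (u y \<bullet> v y - u a \<bullet> v a - u' (y - a) \<bullet> v a) / norm (y - a) \<le>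
          norm (u y - u a - u' (y - a)) / norm (y - a) * norm (v y) + K * norm (v y - v a)" .
      qed
    qed simp
  qed
qed

text \<open>The mean value theorem for \<open>\<lambda>s. \<phi> s t - \<phi> s 0\<close> turns the
  second difference into \<open>t\<close> times a difference of \<open>\<phi>s\<close> at two points
  with the same first coordinate; differentiability of \<open>\<phi>s\<close> at the origin
  evaluates that difference up to \<open>o(t)\<close>.\<close>

lemma second_difference_quotient:
  fixes \<phi> :: "real \<Rightarrow> real \<Rightarrow> real"
  assumes r: "r > 0"
    and d1: "\<And>s t. \<bar>s\<bar> < r \<Longrightarrow> \<bar>t\<bar> < r \<Longrightarrow> ((\<lambda>s. \<phi> s t) has_real_derivative \<phi>s s t) (at s)"
    and D1: "((\<lambda>z. \<phi>s (fst z) (snd z)) has_derivative (\<lambda>z. a * fst z + b * snd z)) (at (0, 0))"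
  shows "((\<lambda>t. (\<phi> t t - \<phi> t 0 - \<phi> 0 t + \<phi> 0 0) / t\<^sup>2) \<longlongrightarrow> b) (at_right 0)"
proof (rule tendstoI)
  fix \<epsilon> :: real assume "\<epsilon> > 0"
  then have "\<epsilon> / 4 > 0" by simp
  have "\<exists>d>0. \<forall>z. norm (z - (0, 0)) < d \<longrightarrow>
      norm (\<phi>s (fst z) (snd z) - \<phi>s 0 0 - (a * fst (z - (0, 0)) + b * snd (z - (0, 0)))) \<le> \<epsilon> / 4 * norm (z - (0, 0))"
    using D1[unfolded has_derivative_at_alt, THEN conjunct2, rule_format, OF \<open>\<epsilon> / 4 > 0\<close>] by (simp only: fst_conv snd_conv)
  then obtain d where d: "d > 0" "\<And>z. norm (z - (0, 0)) < d \<Longrightarrow>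
      norm (\<phi>s (fst z) (snd z) - \<phi>s 0 0 - (a * fst (z - (0, 0)) + b * snd (z - (0, 0)))) \<le> \<epsilon> / 4 * norm (z - (0, 0))"
    by blast
  have est: "\<bar>\<phi>s s t - \<phi>s 0 0 - (a * s + b * t)\<bar> \<le> \<epsilon> / 4 * (\<bar>s\<bar> + \<bar>t\<bar>)" if "\<bar>s\<bar> + \<bar>t\<bar> < d" for s t
  proof -
    have n: "norm (s, t) \<le> \<bar>s\<bar> + \<bar>t\<bar>" using norm_Pair_le[of s t] by simp
    have "\<bar>\<phi>s s t - \<phi>s 0 0 - (a * s + b * t)\<bar> \<le> \<epsilon> / 4 * norm (s, t)"
      using d(2)[of "(s, t)"] n that by (simp del: norm_Pair)
    also have "\<dots> \<le> \<epsilon> / 4 * (\<bar>s\<bar> + \<bar>t\<bar>)"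
      using n \<open>\<epsilon> > 0\<close> by (intro mult_left_mono) auto
    finally show ?thesis .
  qed
  have "dist ((\<phi> t t - \<phi> t 0 - \<phi> 0 t + \<phi> 0 0) / t\<^sup>2) b < \<epsilon>" if t: "0 < t" "t < min r (d / 2)" for t
  proof -
    have "\<exists>\<sigma>. 0 < \<sigma> \<and> \<sigma> < t \<and> (\<phi> t t - \<phi> t 0) - (\<phi> 0 t - \<phi> 0 0) = (t - 0) * (\<phi>s \<sigma> t - \<phi>s \<sigma> 0)"
      using t r by (intro MVT2[where f="\<lambda>s. \<phi> s t - \<phi> s 0"] DERIV_diff d1) auto
    then obtain \<sigma> where \<sigma>: "0 < \<sigma>" "\<sigma> < t"
      "\<phi> t t - \<phi> t 0 - \<phi> 0 t + \<phi> 0 0 = t * (\<phi>s \<sigma> t - \<phi>s \<sigma> 0)" by auto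
    have est2: "\<bar>\<phi>s \<sigma> t - \<phi>s 0 0 - (a * \<sigma> + b * t)\<bar> \<le> \<epsilon> / 4 * (\<sigma> + t)"
      "\<bar>\<phi>s \<sigma> 0 - \<phi>s 0 0 - (a * \<sigma> + b * 0)\<bar> \<le> \<epsilon> / 4 * (\<sigma> + 0)"
      using est[of \<sigma> t] est[of \<sigma> 0] \<sigma> t by auto
    have "\<bar>\<phi>s \<sigma> t - \<phi>s \<sigma> 0 - b * t\<bar> \<le> \<epsilon> / 4 * (2 * \<sigma> + t)"
    proof -
      have "\<epsilon> / 4 * (2 * \<sigma> + t) = \<epsilon> / 4 * (\<sigma> + t) + \<epsilon> / 4 * (\<sigma> + 0)" by (simp add: field_simps)
      then show ?thesis using est2 by linarith
    qed
    also have "\<dots> < \<epsilon> * t" 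
    proof -
      have "\<epsilon> / 4 * (2 * \<sigma> + t) < \<epsilon> / 4 * (4 * t)"
        using \<sigma> \<open>\<epsilon> > 0\<close> by (intro mult_strict_left_mono) auto
      then show ?thesis by simp
    qed
    finally have "\<bar>(\<phi>s \<sigma> t - \<phi>s \<sigma> 0 - b * t) / t\<bar> < \<epsilon>"
      using t by (simp add: abs_divide pos_divide_less_eq)
    moreover have "(\<phi>s \<sigma> t - \<phi>s \<sigma> 0 - b * t) / t = (\<phi> t t - \<phi> t 0 - \<phi> 0 t + \<phi> 0 0) / t\<^sup>2 - b"
      unfolding \<sigma>(3) using t by (simp add: diff_divide_distrib power2_eq_square)
    ultimately show ?thesis by (simp add: dist_real_def)
  qed
  then show "\<forall>\<^sub>F t in at_right 0. dist ((\<phi> t t - \<phi> t 0 - \<phi> 0 t + \<phi> 0 0) / t\<^sup>2) b < \<epsilon>"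
    using r d(1) by (intro eventually_at_rightI[of 0 "min r (d / 2)"]) auto
qed

text \<open>Young's form of the symmetry: the second difference is unchanged when the variables are
  exchanged, so both mixed derivatives are its limit. The first partial derivatives are
  differentiated at one point only.\<close>

lemma symmetric_second_derivative:
  fixes \<phi> :: "real \<Rightarrow> real \<Rightarrow> real"
  assumes "r > 0"
    and d1: "\<And>s t. \<bar>s\<bar> < r \<Longrightarrow> \<bar>t\<bar> < r \<Longrightarrow> ((\<lambda>s. \<phi> s t) has_real_derivative \<phi>s s t) (at s)"
    and d2: "\<And>s t. \<bar>s\<bar> < r \<Longrightarrow> \<bar>t\<bar> < r \<Longrightarrow> ((\<lambda>t. \<phi> s t) has_real_derivative \<phi>t s t) (at t)"
    and D1: "((\<lambda>z. \<phi>s (fst z) (snd z)) has_derivative (\<lambda>z. a * fst z + b * snd z)) (at (0, 0))"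
    and D2: "((\<lambda>z. \<phi>t (fst z) (snd z)) has_derivative (\<lambda>z. c * fst z + d * snd z)) (at (0, 0))"
  shows "b = c"
proof -
  have "((\<lambda>t. (\<phi> t t - \<phi> t 0 - \<phi> 0 t + \<phi> 0 0) / t\<^sup>2) \<longlongrightarrow> b) (at_right 0)"
    by (rule second_difference_quotient[OF \<open>r > 0\<close> d1 D1])
  moreover have "((\<lambda>t. (\<phi> t t - \<phi> 0 t - \<phi> t 0 + \<phi> 0 0) / t\<^sup>2) \<longlongrightarrow> c) (at_right 0)"
  proof (rule second_difference_quotient[OF \<open>r > 0\<close>, where \<phi>="\<lambda>s t. \<phi> t s" and \<phi>s="\<lambda>s t. \<phi>t t s"])
    have "((\<lambda>z. \<phi>t (fst (snd z, fst z)) (snd (snd z, fst z))) has_derivative (\<lambda>z. c * fst (snd z, fst z) + d * snd (snd z, fst z))) (at (0, 0))"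
      by (rule has_derivative_compose[where f="\<lambda>z. (snd z, fst z)" and g="\<lambda>z. \<phi>t (fst z) (snd z)" and g'="\<lambda>z. c * fst z + d * snd z"])
         (use D2 in \<open>auto intro!: derivative_eq_intros\<close>)
    then show "((\<lambda>z. \<phi>t (snd z) (fst z)) has_derivative (\<lambda>z. d * fst z + c * snd z)) (at (0, 0))"
      by (simp add: add.commute)
  qed (use d2 in auto)
  ultimately show ?thesis
    by (intro tendsto_unique[OF trivial_limit_at_right_real]) (simp_all add: algebra_simps)
qed

text \<open>Jacobi's identity lists the coefficients of the 3-form obtained by wedging the covector
  \<open>c\<close> with the skew part of \<open>D\<close>. For nonzero \<open>c\<close> this 3-form
  vanishes exactly if the skew part vanishes on the kernel of \<open>c\<close>.\<close>

lemma jacobi_identity_iff_symmetric_on_kernel: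
  fixes c :: "real^'n" and D :: "real^'n^'n"
  assumes "c \<noteq> 0"
  shows "(\<forall>i j k. c $ i * (D $ j $ k - D $ k $ j) + c $ j * (D $ k $ i - D $ i $ k) + c $ k * (D $ i $ j - D $ j $ i) = 0)
    \<longleftrightarrow> (\<forall>v w. c \<bullet> v = 0 \<longrightarrow> c \<bullet> w = 0 \<longrightarrow> (D *v v) \<bullet> w = (D *v w) \<bullet> v)"
    (is "?J \<longleftrightarrow> ?S")
proof
  have expand: "(D *v v) \<bullet> w - (D *v w) \<bullet> v = (\<Sum>j\<in>UNIV. \<Sum>k\<in>UNIV. (D $ j $ k - D $ k $ j) * w $ j * v $ k)" for v w
  proof -
    have "(D *v v) \<bullet> w = (\<Sum>j\<in>UNIV. \<Sum>k\<in>UNIV. D $ j $ k * w $ j * v $ k)" for v w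
      by (simp add: inner_vec_def matrix_vector_mult_def sum_distrib_right sum_distrib_left mult_ac)
    moreover have "(D *v w) \<bullet> v = (\<Sum>j\<in>UNIV. \<Sum>k\<in>UNIV. D $ k $ j * w $ j * v $ k)" for v w
      by (subst sum.swap)
         (simp add: inner_vec_def matrix_vector_mult_def sum_distrib_right sum_distrib_left mult_ac)
    ultimately show ?thesis
      by (simp add: sum_subtractf left_diff_distrib)
  qed
  {
    assume J: ?J
    obtain i where i: "c $ i \<noteq> 0" using \<open>c \<noteq> 0\<close> by (metis vec_eq_iff zero_index)
    show ?S
    proof (intro allI impI)
      fix v w assume v: "c \<bullet> v = 0" and w: "c \<bullet> w = 0"
      \<comment> \<open>The identity expresses the skew part through the entries with index
        \<open>i\<close>. The double sum then splits into two products, one with the factor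
        \<open>c \<bullet> w\<close> and one with \<open>c \<bullet> v\<close>.\<close>
      have "c $ i * ((D $ j $ k - D $ k $ j) * w $ j * v $ k) =
          - ((c $ j * w $ j) * ((D $ k $ i - D $ i $ k) * v $ k)) - (((D $ i $ j - D $ j $ i) * w $ j) * (c $ k * v $ k))" for j k
      proof -
        have "c $ i * (D $ j $ k - D $ k $ j) = - (c $ j * (D $ k $ i - D $ i $ k)) - c $ k * (D $ i $ j - D $ j $ i)"
          using J[rule_format, of i j k] by linarith
        then have "c $ i * (D $ j $ k - D $ k $ j) * (w $ j * v $ k) = (- (c $ j * (D $ k $ i - D $ i $ k)) - c $ k * (D $ i $ j - D $ j $ i)) * (w $ j * v $ k)"
          by simp
        then show ?thesis by (simp add: algebra_simps)
      qed
      then have "c $ i * ((D *v v) \<bullet> w - (D *v w) \<bullet> v) =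
          (\<Sum>j\<in>UNIV. \<Sum>k\<in>UNIV. - ((c $ j * w $ j) * ((D $ k $ i - D $ i $ k) * v $ k)) - ((D $ i $ j - D $ j $ i) * w $ j) * (c $ k * v $ k))"
        unfolding expand sum_distrib_left by (simp only:)
      also have "\<dots> = - (\<Sum>j\<in>UNIV. \<Sum>k\<in>UNIV. (c $ j * w $ j) * ((D $ k $ i - D $ i $ k) * v $ k))
          - (\<Sum>j\<in>UNIV. \<Sum>k\<in>UNIV. ((D $ i $ j - D $ j $ i) * w $ j) * (c $ k * v $ k))"
        by (simp only: sum_subtractf sum_negf)
      also have "\<dots> = - ((\<Sum>j\<in>UNIV. c $ j * w $ j) * (\<Sum>k\<in>UNIV. (D $ k $ i - D $ i $ k) * v $ k))
          - (\<Sum>j\<in>UNIV. (D $ i $ j - D $ j $ i) * w $ j) * (\<Sum>k\<in>UNIV. c $ k * v $ k)"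
        by (simp only: sum_product)
      also have "\<dots> = 0" using v w by (simp add: inner_vec_def)
      finally show "(D *v v) \<bullet> w = (D *v w) \<bullet> v" using i by simp
    qed
  }
  {
    assume S: ?S
    have ax: "(D *v axis k 1) \<bullet> axis j 1 = D $ j $ k" for j k
      by (simp add: matrix_vector_mult_basis inner_axis column_def)
    have *: "c $ i * (D $ j $ k - D $ k $ j) + c $ j * (D $ k $ i - D $ i $ k) + c $ k * (D $ i $ j - D $ j $ i) = 0"
      if "c $ i \<noteq> 0" for i j k
    proof -
      \<comment> \<open>Coordinate vectors \<open>k\<close> and \<open>j\<close>, corrected along
        the \<open>i\<close>-th one so as to lie in the kernel of \<open>c\<close>.\<close>
      define v w where "v = c $ i *\<^sub>R axis k (1::real) - c $ k *\<^sub>R axis i 1" and "w = c $ i *\<^sub>R axis j (1::real) - c $ j *\<^sub>R axis i 1"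
      have "c \<bullet> v = 0" "c \<bullet> w = 0"
        by (simp_all add: v_def w_def inner_diff_right inner_axis)
      then have "(D *v v) \<bullet> w - (D *v w) \<bullet> v = 0" using S by simp
      moreover have "(D *v v) \<bullet> w - (D *v w) \<bullet> v = c $ i * (c $ i * (D $ j $ k - D $ k $ j) + c $ j * (D $ k $ i - D $ i $ k) + c $ k * (D $ i $ j - D $ j $ i))"
        unfolding v_def w_def
        by (simp add: matrix_vector_mult_diff_distrib matrix_vector_mult_scaleR inner_diff_left inner_diff_right ax algebra_simps)
      ultimately show ?thesis using that by simp
    qed
    show ?J
    proof (intro allI)
      fix i j k
      \<comment> \<open>The identity is invariant under cyclic permutations of the indices, so any
        nonzero coefficient can take the first place.\<close>
      consider "c $ i \<noteq> 0" | "c $ j \<noteq> 0" | "c $ k \<noteq> 0" | "c $ i = 0" "c $ j = 0" "c $ k = 0" by blast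
      then show "c $ i * (D $ j $ k - D $ k $ j) + c $ j * (D $ k $ i - D $ i $ k) + c $ k * (D $ i $ j - D $ j $ i) = 0"
      proof cases
        case 1 then show ?thesis by (rule *)
      next
        case 2 from *[OF this, of k i] show ?thesis by linarith
      next
        case 3 from *[OF this, of i j] show ?thesis by linarith
      qed simp
    qed
  }
qed

section \<open>The second derivative along a level set\<close>

lemma Ck_on_curve_through:
  fixes F :: "'a::euclidean_space \<Rightarrow> 'b::euclidean_space"
  assumes F: "Ck_on 1 Q F" and Q: "\<And>s. s \<in> {-\<epsilon><..<\<epsilon>} \<Longrightarrow> y + s *\<^sub>R k \<in> Q"
  shows "Ck_on 1 {-\<epsilon><..<\<epsilon>} (\<lambda>s. F (y + s *\<^sub>R k))"
    and "s \<in> {-\<epsilon><..<\<epsilon>} \<Longrightarrow> ((\<lambda>s. F (y + s *\<^sub>R k)) has_vector_derivative frechet_derivative F (at (y + s *\<^sub>R k)) k) (at s)"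
proof -
  have F': "(F has_derivative frechet_derivative F (at z)) (at z)" if "z \<in> Q" for z
    using F that by (simp add: frechet_derivative_works)
  have cF': "continuous_on Q (\<lambda>z. frechet_derivative F (at z) k)"
    using F by simp
  have d: "((\<lambda>s. F (y + s *\<^sub>R k)) has_derivative (\<lambda>t. frechet_derivative F (at (y + s *\<^sub>R k)) (t *\<^sub>R k))) (at s)"
    if "s \<in> {-\<epsilon><..<\<epsilon>}" for s
    by (rule has_derivative_compose[of "\<lambda>s. y + s *\<^sub>R k", OF _ F'[OF Q[OF that]]]) (auto intro!: derivative_eq_intros)
  have lin: "frechet_derivative F (at z) (t *\<^sub>R k) = t *\<^sub>R frechet_derivative F (at z) k" if "z \<in> Q" for z t
    using has_derivative_linear[OF F'[OF that]] by (simp add: linear_scale)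
  show "((\<lambda>s. F (y + s *\<^sub>R k)) has_vector_derivative frechet_derivative F (at (y + s *\<^sub>R k)) k) (at s)"
    if "s \<in> {-\<epsilon><..<\<epsilon>}" for s
    using d[OF that] lin[OF Q[OF that]] by (simp add: has_vector_derivative_def)
  have "continuous_on {-\<epsilon><..<\<epsilon>} (\<lambda>s. v *\<^sub>R frechet_derivative F (at (y + s *\<^sub>R k)) k)" for v
    by (intro continuous_intros continuous_on_compose2[OF cF']) (use Q in auto)
  moreover have "frechet_derivative (\<lambda>s. F (y + s *\<^sub>R k)) (at s) v = v *\<^sub>R frechet_derivative F (at (y + s *\<^sub>R k)) k"
    if "s \<in> {-\<epsilon><..<\<epsilon>}" for s v
    using frechet_derivative_at[OF d[OF that], symmetric] lin[OF Q[OF that]] by simp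
  ultimately show "Ck_on 1 {-\<epsilon><..<\<epsilon>} (\<lambda>s. F (y + s *\<^sub>R k))"
    unfolding One_nat_def Ck_on.simps using d differentiable_def by (metis (no_types, lifting) continuous_on_cong)
qed

text \<open>In a chart \<open>F\<close> the function \<open>\<phi> = g(x\<^sub>0) \<bullet> F\<close> is only \<open>C\<^sup>1\<close>, but normality turns its derivative
  into \<open>(g(x\<^sub>0) - g \<circ> F) \<bullet> F'\<close>, which is differentiable at the base point; the symmetry of the
  second derivative of \<open>\<phi>\<close> there is the claim.\<close>

lemma symmetric_on_kernel_if_manifold:
  fixes g :: "'a::euclidean_space \<Rightarrow> 'a"
  assumes X: "Ck_manifold 1 (DIM('a) - 1) X" "x0 \<in> X" and normal: "normal_vector_field g X"
    and G: "(g has_derivative G) (at x0)" and g0: "g x0 \<noteq> 0"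
    and v: "g x0 \<bullet> v = 0" and w: "g x0 \<bullet> w = 0"
  shows "G v \<bullet> w = G w \<bullet> v"
proof -
  obtain N and E W :: "'a set" and f f' where N: "x0 \<in> N" "openin (top_of_set X) N" and E: "subspace E" "dim E = DIM('a) - 1"
    and W: "openin (top_of_set E) W" and ff': "homeomorphism N W f f'"
    and fk: "Ck_map 1 N f" and f'k: "Ck_map 1 W f'"
    using bspec[OF X(1)[unfolded Ck_manifold_def] X(2)] unfolding Ck_diffeomorphic_def by (elim exE conjE) (rule that, assumption+)
  define y0 where "y0 = f x0"
  have y0: "y0 \<in> W" "f' y0 = x0"
    using homeomorphism_image1[OF ff'] homeomorphism_apply1[OF ff'] N(1) unfolding y0_def by auto
  obtain Q F where Q: "open Q" "y0 \<in> Q" "Ck_on 1 Q F" and F: "\<And>y. y \<in> W \<inter> Q \<Longrightarrow> F y = f' y"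
    using bspec[OF f'k[unfolded Ck_map_def] y0(1)] by blast
  obtain QH H where QH: "open QH" "x0 \<in> QH" "Ck_on 1 QH H" and H: "\<And>x. x \<in> N \<inter> QH \<Longrightarrow> H x = f x"
    using bspec[OF fk[unfolded Ck_map_def] N(1)] by blast
  obtain T where T: "open T" "W = E \<inter> T" using W by (auto simp: openin_open)
  define F' where "F' y = frechet_derivative F (at y)" for y
  have F': "(F has_derivative F' y) (at y)" if "y \<in> Q" for y
    using Q(3) that by (simp add: F'_def frechet_derivative_works)
  have cF': "continuous_on Q (\<lambda>y. F' y k)" for k
    using Q(3) by (simp add: F'_def)
  have Fy0: "F y0 = x0" using F y0 Q by simp
  obtain r where r: "r > 0" "ball y0 r \<subseteq> Q \<inter> T"
    using open_contains_ball[of "Q \<inter> T"] Q T y0 by (metis IntI Int_iff open_Int)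
  have EN: "F y \<in> N" "F y \<in> X" "y \<in> W" "y \<in> Q" if "y \<in> E" "y \<in> ball y0 r" for y
  proof -
    show "y \<in> W" "y \<in> Q" using that r T by auto
    then show "F y \<in> N" using F homeomorphism_image2[OF ff'] by auto
    then show "F y \<in> X" using N(2) openin_subset by fastforce
  qed
  have y0E: "y0 \<in> E" using y0 T by blast
  have near: "\<exists>\<epsilon>>0. \<forall>s\<in>{-\<epsilon><..<\<epsilon>}. y + s *\<^sub>R k \<in> E \<and> y + s *\<^sub>R k \<in> ball y0 r"
    if "y \<in> E" "y \<in> ball y0 r" "k \<in> E" for y k
  proof -
    define \<epsilon> where "\<epsilon> = (r - dist y0 y) / (norm k + 1)"
    have nk: "norm k + 1 > 0" by (simp add: add_nonneg_pos)
    have "\<epsilon> > 0" using that nk by (simp add: \<epsilon>_def)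
    moreover have "y + s *\<^sub>R k \<in> ball y0 r" if "s \<in> {-\<epsilon><..<\<epsilon>}" for s
    proof -
      have "\<bar>s\<bar> < \<epsilon>" using that by auto
      then have "\<bar>s\<bar> * (norm k + 1) < r - dist y0 y"
        using nk by (simp add: \<epsilon>_def pos_less_divide_eq)
      then have "\<bar>s\<bar> * norm k < r - dist y0 y" by (simp add: distrib_left)
      moreover have "dist y0 (y + s *\<^sub>R k) \<le> dist y0 y + \<bar>s\<bar> * norm k"
        using dist_triangle[of y0 "y + s *\<^sub>R k" y] by (simp add: dist_norm)
      ultimately show ?thesis by simp
    qed
    moreover have "y + s *\<^sub>R k \<in> E" for s
      using E(1) that by (simp add: subspace_add subspace_scale)
    ultimately show ?thesis by blast
  qed
  \<comment> \<open>\<open>F\<close> maps short segments of \<open>E\<close> to curves in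
    \<open>X\<close>, so \<open>F' y k\<close> is a tangent vector and normality applies.\<close>
  have perp: "g (F y) \<bullet> F' y k = 0" if y: "y \<in> E" "y \<in> ball y0 r" "k \<in> E" for y k
  proof -
    obtain \<epsilon> where \<epsilon>: "\<epsilon> > 0" "\<And>s. s \<in> {-\<epsilon><..<\<epsilon>} \<Longrightarrow> y + s *\<^sub>R k \<in> E \<and> y + s *\<^sub>R k \<in> ball y0 r"
      using near[OF y] by blast
    have inQ: "y + s *\<^sub>R k \<in> Q" if "s \<in> {-\<epsilon><..<\<epsilon>}" for s
      using EN \<epsilon> that by blast
    have "F' y k \<in> tangent_space X (F y)"
      unfolding tangent_space_def
      using \<epsilon>(1) Ck_on_curve_through(1)[OF Q(3) inQ] Ck_on_curve_through(2)[OF Q(3) inQ, of \<epsilon> 0] EN(2) \<epsilon>(2)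
      by (intro CollectI exI[of _ "\<lambda>s. F (y + s *\<^sub>R k)"] exI[of _ \<epsilon>]) (auto simp: F'_def)
    then show ?thesis using normal EN(2)[OF y(1,2)] unfolding normal_vector_field_def by blast
  qed
  have y0r: "y0 \<in> ball y0 r" using r by simp
  define A where "A = F' y0"
  have A: "(F has_derivative A) (at y0)" unfolding A_def using F' Q by blast
  have linA: "linear A" using A by (rule has_derivative_linear)
  \<comment> \<open>The extension \<open>H\<close> of the chart satisfies \<open>H (F y) = y\<close>
    for \<open>y\<close> in \<open>E\<close> near \<open>y0\<close>; differentiating along
    \<open>s *\<^sub>R k\<close> recovers \<open>k\<close> from \<open>A k\<close>.\<close>
  have inj: "k = 0" if k: "k \<in> E" "A k = 0" for k
  proof -
    have H': "(H has_derivative frechet_derivative H (at x0)) (at (F y0))"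
      using QH by (simp add: Fy0 frechet_derivative_works)
    obtain \<epsilon> where \<epsilon>: "\<epsilon> > 0" "\<And>s. s \<in> {-\<epsilon><..<\<epsilon>} \<Longrightarrow> y0 + s *\<^sub>R k \<in> E \<and> y0 + s *\<^sub>R k \<in> ball y0 r"
      using near[OF y0E y0r k(1)] by blast
    have 1: "((\<lambda>s. F (y0 + s *\<^sub>R k)) has_derivative (\<lambda>s. A (s *\<^sub>R k))) (at 0)"
      by (rule has_derivative_compose[of "\<lambda>s. y0 + s *\<^sub>R k" _ _ _ F]) (auto intro!: derivative_eq_intros A)
    have "isCont (\<lambda>s. F (y0 + s *\<^sub>R k)) 0" using 1 by (rule has_derivative_continuous)
    then have "\<forall>\<^sub>F s in at 0. F (y0 + s *\<^sub>R k) \<in> QH"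
      using QH Fy0 by (intro topological_tendstoD[where S=QH]) (auto simp: isCont_def)
    moreover have "\<forall>\<^sub>F s in at 0. s \<in> {-\<epsilon><..<\<epsilon>}"
      using \<epsilon>(1) by (intro eventually_at_in_open') auto
    ultimately have "\<forall>\<^sub>F s in at 0. H (F (y0 + s *\<^sub>R k)) = y0 + s *\<^sub>R k"
    proof eventually_elim
      case (elim s)
      then have y: "y0 + s *\<^sub>R k \<in> E" "y0 + s *\<^sub>R k \<in> ball y0 r" using \<epsilon> by auto
      then have "H (F (y0 + s *\<^sub>R k)) = f (f' (y0 + s *\<^sub>R k))" using elim H EN[OF y] F by auto
      then show ?case using homeomorphism_apply2[OF ff'] EN[OF y] by auto
    qed
    moreover have "((\<lambda>s. H (F (y0 + s *\<^sub>R k))) has_derivative (\<lambda>s. frechet_derivative H (at x0) (A (s *\<^sub>R k)))) (at 0)"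
      by (rule has_derivative_compose[OF 1]) (use H' in simp)
    ultimately have "((\<lambda>s. y0 + s *\<^sub>R k) has_derivative (\<lambda>s. frechet_derivative H (at x0) (A (s *\<^sub>R k)))) (at 0)"
      using H[of x0] N QH Fy0 by (elim has_derivative_transform_eventually) (auto simp: y0_def)
    moreover have "((\<lambda>s. y0 + s *\<^sub>R k) has_derivative (\<lambda>s. s *\<^sub>R k)) (at 0)"
      by (auto intro!: derivative_eq_intros)
    ultimately have "(\<lambda>s. frechet_derivative H (at x0) (A (s *\<^sub>R k))) = (\<lambda>s. s *\<^sub>R k)"
      by (rule has_derivative_unique)
    then have "k = frechet_derivative H (at x0) (A (1 *\<^sub>R k))" by (metis scaleR_one)
    also have "\<dots> = 0" using k linear_0[OF has_derivative_linear[OF H']] by simp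
    finally show ?thesis .
  qed
  \<comment> \<open>The tangent directions lie in the kernel of \<open>g x0\<close>, and both
    subspaces have dimension one less than the space.\<close>
  have "A ` E = {z. g x0 \<bullet> z = 0}"
  proof (rule subspace_dim_equal)
    show "subspace (A ` E)" using linA E(1) by (rule linear_subspace_image)
    show "subspace {z. g x0 \<bullet> z = 0}" by (rule subspace_hyperplane)
    show "A ` E \<subseteq> {z. g x0 \<bullet> z = 0}" using perp[OF y0E y0r] Fy0 by (auto simp: A_def)
    have "inj_on A (span E)"
      using inj linear_inj_on_iff_eq_0[OF linA E(1)] E(1) by (simp add: span_eq_iff[THEN iffD2])
    then have "dim (A ` E) = dim E" using linA by (intro dim_image_eq) auto
    then show "dim {z. g x0 \<bullet> z = 0} \<le> dim (A ` E)" using dim_hyperplane[OF g0] E(2) by simp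
  qed
  then obtain h k where hk: "h \<in> E" "k \<in> E" "v = A h" "w = A k" using v w by blast
  define \<sigma> where "\<sigma> z = y0 + fst z *\<^sub>R h + snd z *\<^sub>R k" for z :: "real \<times> real"
  have \<sigma>E: "\<sigma> z \<in> E" for z
    using E(1) hk y0E by (simp add: \<sigma>_def subspace_add subspace_scale)
  have \<sigma>': "(\<sigma> has_derivative (\<lambda>z. fst z *\<^sub>R h + snd z *\<^sub>R k)) (at z)" for z
    unfolding \<sigma>_def by (auto intro!: derivative_eq_intros)
  have "isCont \<sigma> (0, 0)" using \<sigma>' by (rule has_derivative_continuous)
  define \<rho> where "\<rho> = r / (norm h + norm k + 1)"
  have nhk: "norm h + norm k + 1 > 0" by (simp add: add_nonneg_pos)
  have \<rho>0: "\<rho> > 0" using r nhk by (simp add: \<rho>_def)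
  have \<rho>: "\<sigma> (s, t) \<in> ball y0 r" if "\<bar>s\<bar> < \<rho>" "\<bar>t\<bar> < \<rho>" for s t
  proof -
    have "norm (s *\<^sub>R h + t *\<^sub>R k) \<le> \<bar>s\<bar> * norm h + \<bar>t\<bar> * norm k"
      using norm_triangle_ineq[of "s *\<^sub>R h" "t *\<^sub>R k"] by simp
    also have "\<dots> \<le> \<rho> * norm h + \<rho> * norm k"
      using that by (intro add_mono mult_right_mono) auto
    also have "\<dots> < \<rho> * (norm h + norm k + 1)" using \<rho>0 by (simp add: distrib_left)
    also have "\<dots> = r" using nhk by (simp add: \<rho>_def)
    finally have "norm (s *\<^sub>R h + t *\<^sub>R k) < r" .
    moreover have "y0 - \<sigma> (s, t) = - (s *\<^sub>R h + t *\<^sub>R k)" by (simp add: \<sigma>_def)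
    ultimately show ?thesis by (metis dist_norm mem_ball norm_minus_cancel)
  qed
  define \<phi> where "\<phi> s t = g x0 \<bullet> F (\<sigma> (s, t))" for s t
  \<comment> \<open>For \<open>l\<close> in \<open>E\<close> this is the derivative of
    \<open>\<phi>\<close> in the parameter direction \<open>l\<close>. In this form the first factor
    vanishes at the origin and is differentiable there, while the second is only continuous.\<close>
  define \<psi> where "\<psi> l s t = (g x0 - g (F (\<sigma> (s, t)))) \<bullet> F' (\<sigma> (s, t)) l" for l s t
  have D\<phi>: "((\<lambda>z. g x0 \<bullet> F (\<sigma> z)) has_derivative (\<lambda>q. g x0 \<bullet> F' (\<sigma> z) (fst q *\<^sub>R h + snd q *\<^sub>R k))) (at z)"
    if "\<sigma> z \<in> ball y0 r" for z
    by (rule has_derivative_inner_right has_derivative_compose[OF \<sigma>' F'])+ (use that EN(4)[OF \<sigma>E] in auto)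
  have \<psi>_eq: "g x0 \<bullet> F' (\<sigma> (s, t)) l = \<psi> l s t" if "\<bar>s\<bar> < \<rho>" "\<bar>t\<bar> < \<rho>" "l \<in> E" for s t l
    using perp[OF \<sigma>E \<rho>[OF that(1,2)] that(3)] by (simp add: \<psi>_def inner_diff_left)
  have cov: "((\<lambda>z. g x0 - g (F (\<sigma> z))) has_derivative (\<lambda>q. - G (A (fst q *\<^sub>R h + snd q *\<^sub>R k)))) (at (0, 0))"
  proof -
    have 0: "\<sigma> (0, 0) = y0" by (simp add: \<sigma>_def)
    have "((\<lambda>z. F (\<sigma> z)) has_derivative (\<lambda>q. A (fst q *\<^sub>R h + snd q *\<^sub>R k))) (at (0, 0))"
      by (rule has_derivative_compose[OF \<sigma>']) (use A 0 in simp)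
    then have "((\<lambda>z. g (F (\<sigma> z))) has_derivative (\<lambda>q. G (A (fst q *\<^sub>R h + snd q *\<^sub>R k)))) (at (0, 0))"
      by (rule has_derivative_compose) (use G 0 Fy0 in simp)
    from has_derivative_diff[OF has_derivative_const this, of "g x0"] show ?thesis by simp
  qed
  have D\<psi>: "((\<lambda>z. \<psi> l (fst z) (snd z)) has_derivative (\<lambda>q. (- (G (A h) \<bullet> A l)) * fst q + (- (G (A k) \<bullet> A l)) * snd q)) (at (0, 0))" for l
  proof -
    have 0: "\<sigma> (0, 0) = y0" by (simp add: \<sigma>_def)
    have "isCont (\<lambda>y. F' y l) y0" using cF' Q by (simp add: continuous_on_eq_continuous_at)
    then have c: "isCont (\<lambda>z. F' (\<sigma> z) l) (0, 0)"
      using isCont_o2[OF \<open>isCont \<sigma> (0, 0)\<close>, of "\<lambda>y. F' y l"] 0 by simp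
    have "((\<lambda>z. (g x0 - g (F (\<sigma> z))) \<bullet> F' (\<sigma> z) l) has_derivative (\<lambda>q. - G (A (fst q *\<^sub>R h + snd q *\<^sub>R k)) \<bullet> F' (\<sigma> (0, 0)) l)) (at (0, 0))"
      by (rule has_derivative_inner_of_zero[OF cov _ c]) (simp add: 0 Fy0)
    moreover have "- G (A (fst q *\<^sub>R h + snd q *\<^sub>R k)) \<bullet> F' (\<sigma> (0, 0)) l = (- (G (A h) \<bullet> A l)) * fst q + (- (G (A k) \<bullet> A l)) * snd q" for q
      using linA has_derivative_linear[OF G]
      by (simp add: 0 A_def[symmetric] linear_add linear_scale inner_add_left inner_diff_left)
    ultimately show ?thesis by (simp add: \<psi>_def)
  qed
  have "- (G (A k) \<bullet> A h) = - (G (A h) \<bullet> A k)"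
  proof (rule symmetric_second_derivative[where \<phi>=\<phi> and r=\<rho> and \<phi>s="\<psi> h" and \<phi>t="\<psi> k"])
    show "\<rho> > 0" by (rule \<rho>0)
    fix s t :: real assume st: "\<bar>s\<bar> < \<rho>" "\<bar>t\<bar> < \<rho>"
    have lin: "linear (F' (\<sigma> (s, t)))" using F' EN(4)[OF \<sigma>E \<rho>[OF st]] has_derivative_linear by blast
    have "((\<lambda>s. g x0 \<bullet> F (\<sigma> (s, t))) has_derivative (\<lambda>q. g x0 \<bullet> F' (\<sigma> (s, t)) (fst (q, 0::real) *\<^sub>R h + snd (q, 0::real) *\<^sub>R k))) (at s)"
      by (rule has_derivative_compose[of "\<lambda>s. (s, t)", OF _ D\<phi>[OF \<rho>[OF st]]]) (auto intro!: derivative_eq_intros)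
    then show "((\<lambda>s. \<phi> s t) has_real_derivative \<psi> h s t) (at s)"
      using \<psi>_eq[OF st hk(1)] lin by (simp add: \<phi>_def has_field_derivative_def linear_scale mult_commute_abs)
    have "((\<lambda>t. g x0 \<bullet> F (\<sigma> (s, t))) has_derivative (\<lambda>q. g x0 \<bullet> F' (\<sigma> (s, t)) (fst (0::real, q) *\<^sub>R h + snd (0::real, q) *\<^sub>R k))) (at t)"
      by (rule has_derivative_compose[of "\<lambda>t. (s, t)", OF _ D\<phi>[OF \<rho>[OF st]]]) (auto intro!: derivative_eq_intros)
    then show "((\<lambda>t. \<phi> s t) has_real_derivative \<psi> k s t) (at t)"
      using \<psi>_eq[OF st hk(2)] lin by (simp add: \<phi>_def has_field_derivative_def linear_scale mult_commute_abs)
  qed (rule D\<psi>)+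
  then show ?thesis using hk by simp
qed

section \<open>Flows of Lipschitz frames\<close>

lemma gronwall:
  fixes y y' :: "real \<Rightarrow> real"
  assumes d: "\<And>t. 0 \<le> t \<Longrightarrow> t \<le> T \<Longrightarrow> (y has_real_derivative y' t) (at t)"
    and le: "\<And>t. 0 \<le> t \<Longrightarrow> t \<le> T \<Longrightarrow> y' t \<le> K * y t + C" and "K > 0" "0 \<le> T"
  shows "y T + C / K \<le> (y 0 + C / K) * exp (K * T)"
proof -
  define \<phi> where "\<phi> t = (y t + C / K) * exp (- (K * t))" for t
  have "\<phi> T \<le> \<phi> 0"
  proof (rule DERIV_nonpos_imp_nonincreasing[OF \<open>0 \<le> T\<close>])
    fix t assume t: "0 \<le> t" "t \<le> T"
    have "(\<phi> has_real_derivative (y' t - K * y t - C) * exp (- (K * t))) (at t)"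
      unfolding \<phi>_def using d[OF t] \<open>K > 0\<close>
      by (auto intro!: derivative_eq_intros simp: field_simps)
    moreover have "(y' t - K * y t - C) * exp (- (K * t)) \<le> 0"
      using le[OF t] by (intro mult_nonpos_nonneg) auto
    ultimately show "\<exists>z. DERIV \<phi> t :> z \<and> z \<le> 0" by blast
  qed
  then show ?thesis by (simp add: \<phi>_def exp_minus field_simps)
qed

text \<open>The square of the distance is differentiable also where the curves meet. The rate
  \<open>2 * K + 1\<close> and the constant \<open>C\<^sup>2\<close> come from splitting the mixed
  term of its derivative by \<open>sum_squares_bound\<close>.\<close>

lemma norm_integral_curve_diff_le:
  fixes \<gamma> \<gamma>' :: "real \<Rightarrow> 'a::real_inner"
  assumes \<gamma>: "\<And>t. 0 \<le> t \<Longrightarrow> t \<le> T \<Longrightarrow> (\<gamma> has_vector_derivative v t) (at t)"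
    and \<gamma>': "\<And>t. 0 \<le> t \<Longrightarrow> t \<le> T \<Longrightarrow> (\<gamma>' has_vector_derivative v' t) (at t)"
    and le: "\<And>t. 0 \<le> t \<Longrightarrow> t \<le> T \<Longrightarrow> norm (v t - v' t) \<le> K * norm (\<gamma> t - \<gamma>' t) + C"
    and "K > 0" "C \<ge> 0" "0 \<le> T"
  shows "(norm (\<gamma> T - \<gamma>' T))\<^sup>2 + C\<^sup>2 / (2 * K + 1) \<le> ((norm (\<gamma> 0 - \<gamma>' 0))\<^sup>2 + C\<^sup>2 / (2 * K + 1)) * exp ((2 * K + 1) * T)"
  unfolding power2_norm_eq_inner
proof (rule gronwall)
  fix t assume t: "0 \<le> t" "t \<le> T"
  show "((\<lambda>t. (\<gamma> t - \<gamma>' t) \<bullet> (\<gamma> t - \<gamma>' t)) has_real_derivative 2 * ((\<gamma> t - \<gamma>' t) \<bullet> (v t - v' t))) (at t)"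
    using \<gamma>[OF t] \<gamma>'[OF t] unfolding has_vector_derivative_def has_field_derivative_def
    by (auto intro!: derivative_eq_intros simp: inner_commute algebra_simps fun_eq_iff)
  have "(\<gamma> t - \<gamma>' t) \<bullet> (v t - v' t) \<le> norm (\<gamma> t - \<gamma>' t) * norm (v t - v' t)"
    by (rule norm_cauchy_schwarz)
  also have "\<dots> \<le> norm (\<gamma> t - \<gamma>' t) * (K * norm (\<gamma> t - \<gamma>' t) + C)"
    using le[OF t] by (intro mult_left_mono) auto
  finally have "2 * ((\<gamma> t - \<gamma>' t) \<bullet> (v t - v' t)) \<le> 2 * K * (norm (\<gamma> t - \<gamma>' t))\<^sup>2 + 2 * norm (\<gamma> t - \<gamma>' t) * C"
    by (simp add: power2_eq_square algebra_simps)
  also have "2 * norm (\<gamma> t - \<gamma>' t) * C \<le> (norm (\<gamma> t - \<gamma>' t))\<^sup>2 + C\<^sup>2"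
    by (rule sum_squares_bound)
  finally show "2 * ((\<gamma> t - \<gamma>' t) \<bullet> (v t - v' t)) \<le> (2 * K + 1) * ((\<gamma> t - \<gamma>' t) \<bullet> (\<gamma> t - \<gamma>' t)) + C\<^sup>2"
    by (simp add: power2_norm_eq_inner algebra_simps)
qed (use assms in auto)

lemma norm_le_by_derivative_exp_pos:
  fixes G :: "real \<Rightarrow> 'a::real_normed_vector"
  assumes G: "\<And>t. (G has_vector_derivative u t) (at t)" and "G 0 = 0" and "K > 0" "t > 0"
    and u: "\<And>t. t > 0 \<Longrightarrow> norm (u t) \<le> B * exp (K * t)"
  shows "norm (G t) \<le> B / K * (exp (K * t) - 1)"
proof -
  have "norm (G t - G 0) \<le> B / K * exp (K * t) - B / K * exp (K * 0)"
  proof (rule differentiable_bound_general[OF \<open>t > 0\<close>])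
    show "continuous_on {0..t} G"
      using G by (intro continuous_at_imp_continuous_on) (auto intro: has_vector_derivative_continuous)
    show "continuous_on {0..t} (\<lambda>t. B / K * exp (K * t))" by (intro continuous_intros)
    show "\<And>x. 0 < x \<Longrightarrow> x < t \<Longrightarrow> ((\<lambda>t. B / K * exp (K * t)) has_vector_derivative B * exp (K * x)) (at x)"
      using \<open>K > 0\<close> unfolding has_real_derivative_iff_has_vector_derivative[symmetric]
      by (auto intro!: derivative_eq_intros)
  qed (use G u in auto)
  then show ?thesis using \<open>G 0 = 0\<close> by (simp add: algebra_simps)
qed

lemma norm_le_by_derivative_exp:
  fixes G :: "real \<Rightarrow> 'a::real_normed_vector"
  assumes G: "\<And>t. (G has_vector_derivative u t) (at t)" and "G 0 = 0" and "K > 0" "B \<ge> 0"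
    and u: "\<And>t. norm (u t) \<le> B * exp (K * \<bar>t\<bar>)"
  shows "norm (G t) \<le> B / K * (exp (K * \<bar>t\<bar>) - 1)"
proof -
  consider "t > 0" | "t = 0" | "t < 0" by linarith
  then show ?thesis
  proof cases
    case 1
    then show ?thesis using norm_le_by_derivative_exp_pos[OF G \<open>G 0 = 0\<close> \<open>K > 0\<close> 1, of B] u
      by (metis abs_of_pos)
  next
    case 3
    have "norm ((\<lambda>s. G (- s)) (- t)) \<le> B / K * (exp (K * (- t)) - 1)"
    proof (rule norm_le_by_derivative_exp_pos[where u="\<lambda>s. - u (- s)"])
      show "((\<lambda>s. G (- s)) has_vector_derivative - u (- s)) (at s)" for s
      proof -
        have "((\<lambda>s. - s) has_vector_derivative - 1) (at s)"
          by (intro has_vector_derivative_minus has_vector_derivative_id)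
        from vector_diff_chain_at[OF this G] show ?thesis by (simp add: o_def)
      qed
      show "norm (- u (- s)) \<le> B * exp (K * s)" if "s > 0" for s
        using u[of "- s"] that by simp
    qed (use assms 3 in auto)
    then show ?thesis using 3 by simp
  qed (use \<open>G 0 = 0\<close> in simp)
qed

text \<open>The weight \<open>exp (K * \<bar>t\<bar>)\<close> makes the Picard operator a contraction on the whole line.\<close>

lemma Picard_Lindeloef:
  fixes f :: "'a::euclidean_space \<Rightarrow> 'a"
  assumes lip: "\<And>x y. norm (f x - f y) \<le> K0 * norm (x - y)" and bd: "\<And>x. norm (f x) \<le> B"
  obtains \<gamma> where "\<gamma> 0 = x0" "\<And>t. (\<gamma> has_vector_derivative f (\<gamma> t)) (at t)"
proof -
  define L where "L = \<bar>K0\<bar> + 1"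
  \<comment> \<open>The rate \<open>2 * L\<close> gives the contraction factor
    \<open>L / K = 1 / 2\<close>.\<close>
  define K where "K = 2 * L"
  have L: "L > 0" "K > 0" by (auto simp: L_def K_def)
  have lip: "norm (f x - f y) \<le> L * norm (x - y)" for x y
  proof -
    have "K0 * norm (x - y) \<le> L * norm (x - y)" by (intro mult_right_mono) (auto simp: L_def)
    then show ?thesis using lip[of x y] by linarith
  qed
  have B0: "B \<ge> 0" using bd[of x0] norm_ge_zero order_trans by blast
  have cf: "continuous_on UNIV f"
  proof (rule lipschitz_on_continuous_on)
    show "L-lipschitz_on UNIV f" using lip L by (intro lipschitz_onI) (auto simp: dist_norm)
  qed
  \<comment> \<open>The unknown is the bounded continuous \<open>\<eta>\<close>; the curve is
    recovered from it by undoing the weight and adding \<open>x0\<close>.\<close>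
  define c where "c \<eta> t = x0 + exp (K * \<bar>t\<bar>) *\<^sub>R apply_bcontfun \<eta> t" for \<eta> t
  have cc: "continuous_on UNIV (c \<eta>)" for \<eta>
    unfolding c_def by (intro continuous_intros continuous_on_apply_bcontfun)
  have "\<exists>G. \<forall>t. (G has_vector_derivative f (c \<eta> t)) (at t)" for \<eta>
  proof -
    have "continuous_on UNIV (\<lambda>t. f (c \<eta> t))" by (rule continuous_on_compose2[OF cf cc]) auto
    then have "isCont (\<lambda>t. f (c \<eta> t)) t" for t by (simp add: continuous_on_eq_continuous_at)
    then show ?thesis using einterval_antiderivative[of "-\<infinity>" "\<infinity>" "\<lambda>t. f (c \<eta> t)"] by simp
  qed
  then obtain G0 where G0: "\<And>\<eta> t. (G0 \<eta> has_vector_derivative f (c \<eta> t)) (at t)" by metis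
  define G where "G \<eta> t = G0 \<eta> t - G0 \<eta> 0" for \<eta> t
  have G: "(G \<eta> has_vector_derivative f (c \<eta> t)) (at t)" "G \<eta> 0 = 0" for \<eta> t
    unfolding G_def using has_vector_derivative_diff[OF G0 has_vector_derivative_const] by auto
  have cG: "continuous_on UNIV (G \<eta>)" for \<eta>
    using G by (intro continuous_at_imp_continuous_on) (auto intro: has_vector_derivative_continuous)
  have Gb: "norm (G \<eta> t) \<le> B / K * (exp (K * \<bar>t\<bar>) - 1)" for \<eta> t
  proof (rule norm_le_by_derivative_exp[OF G \<open>K > 0\<close> B0])
    fix t
    have "norm (f (c \<eta> t)) \<le> B * 1" using bd by simp
    also have "\<dots> \<le> B * exp (K * \<bar>t\<bar>)" using B0 L by (intro mult_left_mono) auto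
    finally show "norm (f (c \<eta> t)) \<le> B * exp (K * \<bar>t\<bar>)" .
  qed
  define T where "T \<eta> = Bcontfun (\<lambda>t. exp (- (K * \<bar>t\<bar>)) *\<^sub>R G \<eta> t)" for \<eta>
  have T: "apply_bcontfun (T \<eta>) t = exp (- (K * \<bar>t\<bar>)) *\<^sub>R G \<eta> t" for \<eta> t
  proof -
    have "(\<lambda>t. exp (- (K * \<bar>t\<bar>)) *\<^sub>R G \<eta> t) \<in> bcontfun"
    proof (rule bcontfun_normI)
      show "continuous_on UNIV (\<lambda>t. exp (- (K * \<bar>t\<bar>)) *\<^sub>R G \<eta> t)"
        by (intro continuous_intros cG)
      fix t
      have "norm (exp (- (K * \<bar>t\<bar>)) *\<^sub>R G \<eta> t) = exp (- (K * \<bar>t\<bar>)) * norm (G \<eta> t)" by simp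
      also have "\<dots> \<le> exp (- (K * \<bar>t\<bar>)) * (B / K * exp (K * \<bar>t\<bar>))"
      proof (rule mult_left_mono)
        have "B / K * (exp (K * \<bar>t\<bar>) - 1) \<le> B / K * exp (K * \<bar>t\<bar>)"
          using B0 L by (intro mult_left_mono) auto
        then show "norm (G \<eta> t) \<le> B / K * exp (K * \<bar>t\<bar>)" using Gb[of \<eta> t] by linarith
      qed simp
      also have "\<dots> = B / K" by (simp add: exp_minus)
      finally show "norm (exp (- (K * \<bar>t\<bar>)) *\<^sub>R G \<eta> t) \<le> B / K" .
    qed
    then show ?thesis by (simp add: T_def Bcontfun_inverse)
  qed
  have "\<exists>!\<eta>. T \<eta> = \<eta>"
  proof (rule banach_fix_type[of "1/2"])
    show "\<forall>\<eta> \<eta>'. dist (T \<eta>) (T \<eta>') \<le> 1 / 2 * dist \<eta> \<eta>'"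
    proof (intro allI dist_bound)
      fix \<eta> \<eta>' :: "real \<Rightarrow>\<^sub>C 'a" and t
      have d: "((\<lambda>t. G \<eta> t - G \<eta>' t) has_vector_derivative f (c \<eta> t) - f (c \<eta>' t)) (at t)" for t
        by (intro has_vector_derivative_diff G)
      have "norm (G \<eta> t - G \<eta>' t) \<le> (L * dist \<eta> \<eta>') / K * (exp (K * \<bar>t\<bar>) - 1)"
      proof (rule norm_le_by_derivative_exp[OF d])
        fix t
        have "norm (f (c \<eta> t) - f (c \<eta>' t)) \<le> L * norm (c \<eta> t - c \<eta>' t)" by (rule lip)
        also have "c \<eta> t - c \<eta>' t = exp (K * \<bar>t\<bar>) *\<^sub>R (apply_bcontfun \<eta> t - apply_bcontfun \<eta>' t)"
          by (simp add: c_def scaleR_diff_right)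
        also have "L * norm \<dots> = exp (K * \<bar>t\<bar>) * (L * dist (apply_bcontfun \<eta> t) (apply_bcontfun \<eta>' t))"
          by (simp add: dist_norm)
        also have "\<dots> \<le> exp (K * \<bar>t\<bar>) * (L * dist \<eta> \<eta>')"
          using L by (intro mult_left_mono dist_bounded) auto
        finally show "norm (f (c \<eta> t) - f (c \<eta>' t)) \<le> L * dist \<eta> \<eta>' * exp (K * \<bar>t\<bar>)"
          by (simp add: mult_ac)
      qed (use G L in auto)
      also have "\<dots> \<le> (L * dist \<eta> \<eta>') / K * exp (K * \<bar>t\<bar>)"
        using L by (intro mult_left_mono) auto
      finally have le: "norm (G \<eta> t - G \<eta>' t) \<le> 1 / 2 * dist \<eta> \<eta>' * exp (K * \<bar>t\<bar>)"
        using L by (simp add: K_def)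
      have "dist (apply_bcontfun (T \<eta>) t) (apply_bcontfun (T \<eta>') t) = exp (- (K * \<bar>t\<bar>)) * norm (G \<eta> t - G \<eta>' t)"
        by (simp add: T dist_norm flip: scaleR_diff_right)
      also have "\<dots> \<le> exp (- (K * \<bar>t\<bar>)) * (1 / 2 * dist \<eta> \<eta>' * exp (K * \<bar>t\<bar>))"
        using le by (intro mult_left_mono) auto
      also have "\<dots> = 1 / 2 * dist \<eta> \<eta>'" by (simp add: exp_minus)
      finally show "dist (apply_bcontfun (T \<eta>) t) (apply_bcontfun (T \<eta>') t) \<le> 1 / 2 * dist \<eta> \<eta>'" .
    qed
  qed auto
  then obtain \<eta> where \<eta>: "T \<eta> = \<eta>" by blast
  have "c \<eta> t = x0 + G \<eta> t" for t
    using T[of \<eta> t] unfolding \<eta> c_def by (simp add: exp_minus)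
  then have c: "c \<eta> = (\<lambda>t. x0 + G \<eta> t)" by blast
  show ?thesis
  proof
    show "c \<eta> 0 = x0" using G(2) by (simp add: c)
    show "(c \<eta> has_vector_derivative f (c \<eta> t)) (at t)" for t
      using has_vector_derivative_add[OF has_vector_derivative_const G(1), of x0 \<eta> t] by (simp add: c)
  qed
qed

text \<open>Linearity in \<open>h\<close> lets one map carry the vector fields of all directions,
  and bounds that are uniform in \<open>z\<close> and proportional to \<open>norm h\<close> make
  every flow complete.\<close>

locale lipschitz_frame =
  fixes X :: "'a::euclidean_space \<Rightarrow> 'a \<Rightarrow> 'a" and M L :: real
  assumes linear_frame: "linear (\<lambda>h. X h z)"
    and frame_bound: "norm (X h z) \<le> M * norm h"
    and frame_lipschitz: "norm (X h z - X h z') \<le> L * norm h * norm (z - z')"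
    and M_pos: "M > 0" and L_pos: "L > 0"
begin

lemma frame_simps: "X (h + k) z = X h z + X k z" "X (c *\<^sub>R h) z = c *\<^sub>R X h z" "X 0 z = 0" "X (- h) z = - X h z"
  "X (h - k) z = X h z - X k z"
proof -
  note l = linear_frame[of z]
  show "X (h + k) z = X h z + X k z" by (rule linear_add[OF l])
  show "X (c *\<^sub>R h) z = c *\<^sub>R X h z" by (rule linear_scale[OF l])
  show "X 0 z = 0" by (rule linear_0[OF l])
  show "X (- h) z = - X h z" by (rule linear_neg[OF l])
  show "X (h - k) z = X h z - X k z" by (rule linear_diff[OF l])
qed

text \<open>Only the time-one map is named: by linearity \<open>flow (t *\<^sub>R h)\<close> is the
  flow of \<open>X h\<close> at time \<open>t\<close>, also for negative \<open>t\<close>. Integral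
  curves are unique, so the choice does not affect the value (\<open>flow_eqI\<close>).\<close>

definition flow :: "'a \<Rightarrow> 'a \<Rightarrow> 'a" where
  "flow h x = (SOME \<gamma>. \<gamma> 0 = x \<and> (\<forall>t. (\<gamma> has_vector_derivative X h (\<gamma> t)) (at t))) (1::real)"

text \<open>A change of direction enters the comparison as the inhomogeneity
  \<open>M * norm (h - k)\<close>, and the bound \<open>b\<close> on one direction fixes the
  exponential rate.\<close>

lemma integral_curves_diff_le:
  assumes \<gamma>: "\<And>t. 0 \<le> t \<Longrightarrow> t \<le> T \<Longrightarrow> (\<gamma> has_vector_derivative X h (\<gamma> t)) (at t)"
    and \<gamma>': "\<And>t. 0 \<le> t \<Longrightarrow> t \<le> T \<Longrightarrow> (\<gamma>' has_vector_derivative X k (\<gamma>' t)) (at t)"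
    and "0 \<le> T" "norm h \<le> b" "0 < b"
  shows "(norm (\<gamma> T - \<gamma>' T))\<^sup>2 \<le> ((norm (\<gamma> 0 - \<gamma>' 0))\<^sup>2 + (M * norm (h - k))\<^sup>2) * exp ((2 * L * b + 1) * T)"
proof -
  let ?K = "L * b" and ?C = "M * norm (h - k)"
  have K: "?K > 0" using L_pos assms by simp
  have C: "?C \<ge> 0" using M_pos by simp
  have "(norm (\<gamma> T - \<gamma>' T))\<^sup>2 + ?C\<^sup>2 / (2 * ?K + 1) \<le> ((norm (\<gamma> 0 - \<gamma>' 0))\<^sup>2 + ?C\<^sup>2 / (2 * ?K + 1)) * exp ((2 * ?K + 1) * T)"
  proof (rule norm_integral_curve_diff_le[OF \<gamma> \<gamma>' _ K C \<open>0 \<le> T\<close>])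
    fix t
    have "X h (\<gamma> t) - X k (\<gamma>' t) = (X h (\<gamma> t) - X h (\<gamma>' t)) + X (h - k) (\<gamma>' t)"
      by (simp add: frame_simps)
    then have "norm (X h (\<gamma> t) - X k (\<gamma>' t)) \<le> L * norm h * norm (\<gamma> t - \<gamma>' t) + M * norm (h - k)"
      using frame_bound frame_lipschitz by (metis norm_add_rule_thm)
    also have "\<dots> \<le> L * b * norm (\<gamma> t - \<gamma>' t) + M * norm (h - k)"
      using L_pos assms by (intro add_mono mult_right_mono mult_left_mono) auto
    finally show "norm (X h (\<gamma> t) - X k (\<gamma>' t)) \<le> L * b * norm (\<gamma> t - \<gamma>' t) + M * norm (h - k)" .
  qed
  moreover have "?C\<^sup>2 / (2 * ?K + 1) \<ge> 0" using K by simp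
  moreover have "((norm (\<gamma> 0 - \<gamma>' 0))\<^sup>2 + ?C\<^sup>2 / (2 * ?K + 1)) * exp ((2 * ?K + 1) * T) \<le>
      ((norm (\<gamma> 0 - \<gamma>' 0))\<^sup>2 + ?C\<^sup>2) * exp ((2 * ?K + 1) * T)"
  proof -
    have "?C\<^sup>2 / (2 * ?K + 1) \<le> ?C\<^sup>2 / 1" using K by (intro divide_left_mono) auto
    then show ?thesis by (intro mult_right_mono) auto
  qed
  ultimately have "(norm (\<gamma> T - \<gamma>' T))\<^sup>2 \<le> ((norm (\<gamma> 0 - \<gamma>' 0))\<^sup>2 + ?C\<^sup>2) * exp ((2 * ?K + 1) * T)"
    by linarith
  then show ?thesis by (simp only: mult.assoc)
qed

lemma integral_curve_unique:
  assumes \<gamma>: "\<And>t. 0 \<le> t \<Longrightarrow> t \<le> T \<Longrightarrow> (\<gamma> has_vector_derivative X h (\<gamma> t)) (at t)"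
    and \<gamma>': "\<And>t. 0 \<le> t \<Longrightarrow> t \<le> T \<Longrightarrow> (\<gamma>' has_vector_derivative X h (\<gamma>' t)) (at t)"
    and "0 \<le> T" "\<gamma> 0 = \<gamma>' 0"
  shows "\<gamma> T = \<gamma>' T"
  using integral_curves_diff_le[OF \<gamma> \<gamma>' \<open>0 \<le> T\<close>, of "norm h + 1"] assms(4)
  by (simp add: add_nonneg_pos)

lemma flow_exists:
  obtains \<gamma> where "\<gamma> 0 = x" "\<And>t. (\<gamma> has_vector_derivative X h (\<gamma> t)) (at t)"
  using Picard_Lindeloef[of "X h" "L * norm h" "M * norm h" x] frame_lipschitz frame_bound by metis

lemma flow_eqI:
  assumes \<gamma>: "\<And>t. 0 \<le> t \<Longrightarrow> t \<le> 1 \<Longrightarrow> (\<gamma> has_vector_derivative X h (\<gamma> t)) (at t)"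
    and "\<gamma> 0 = x"
  shows "flow h x = \<gamma> 1"
proof -
  define c where "c = (SOME \<gamma>. \<gamma> 0 = x \<and> (\<forall>t::real. (\<gamma> has_vector_derivative X h (\<gamma> t)) (at t)))"
  have "\<exists>\<gamma>. \<gamma> 0 = x \<and> (\<forall>t::real. (\<gamma> has_vector_derivative X h (\<gamma> t)) (at t))"
    by (rule flow_exists[of x h]) blast
  from someI_ex[OF this] have c: "c 0 = x" "\<And>t. (c has_vector_derivative X h (c t)) (at t)"
    unfolding c_def[symmetric] by blast+
  have "c 1 = \<gamma> 1"
    by (rule integral_curve_unique[of 1 c h \<gamma>, OF c(2) \<gamma>]) (use c assms in simp_all)
  then show ?thesis by (simp add: flow_def c_def)
qed

lemma integral_curve_scale:
  assumes "(\<gamma> has_vector_derivative X h (\<gamma> (s * t + b))) (at (s * t + b))"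
  shows "((\<lambda>t. \<gamma> (s * t + b)) has_vector_derivative X (s *\<^sub>R h) (\<gamma> (s * t + b))) (at t)"
proof -
  have "((\<lambda>t. s * t + b) has_vector_derivative s) (at t)"
    by (auto intro!: derivative_eq_intros simp: has_real_derivative_iff_has_vector_derivative[symmetric])
  from vector_diff_chain_at[OF this assms] show ?thesis by (simp add: o_def frame_simps)
qed

lemma flow_curve:
  assumes "\<gamma> 0 = x" and "\<And>t. (\<gamma> has_vector_derivative X h (\<gamma> t)) (at t)"
  shows "flow (t *\<^sub>R h) x = \<gamma> t"
proof -
  have "flow (t *\<^sub>R h) x = (\<lambda>s. \<gamma> (t * s + 0)) 1"
    by (rule flow_eqI, rule integral_curve_scale) (use assms in auto)
  then show ?thesis by simp
qed

lemma flow_has_vector_derivative: "((\<lambda>t. flow (t *\<^sub>R h) x) has_vector_derivative X h (flow (t *\<^sub>R h) x)) (at t)"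
proof -
  obtain \<gamma> where \<gamma>: "\<gamma> 0 = x" "\<And>t. (\<gamma> has_vector_derivative X h (\<gamma> t)) (at t)"
    using flow_exists by blast
  then show ?thesis by (simp add: flow_curve[OF \<gamma>])
qed

lemma flow_0 [simp]: "flow 0 x = x"
  using flow_exists[of x 0] flow_curve[of _ x 0 0] by (metis scaleR_zero_left)

lemma flow_add_scale: "flow ((s + t) *\<^sub>R h) x = flow (s *\<^sub>R h) (flow (t *\<^sub>R h) x)"
proof -
  have "flow (s *\<^sub>R h) (flow (t *\<^sub>R h) x) = (\<lambda>r. flow ((s * r + t) *\<^sub>R h) x) 1"
    by (rule flow_eqI, rule integral_curve_scale) (use flow_has_vector_derivative in auto)
  then show ?thesis by simp
qed

lemma flow_minus [simp]: "flow (- h) (flow h x) = x" "flow h (flow (- h) x) = x"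
  using flow_add_scale[of "-1" 1 h x] flow_add_scale[of 1 "-1" h x] by simp_all

lemma flow_power: "flow (real n *\<^sub>R h) x = (flow h ^^ n) x"
proof (induction n)
  case (Suc n)
  have "flow (real (Suc n) *\<^sub>R h) x = flow ((1 + real n) *\<^sub>R h) x" by simp
  also have "\<dots> = flow h (flow (real n *\<^sub>R h) x)" unfolding flow_add_scale by simp
  finally show ?case using Suc by simp
qed simp

text \<open>Taking square roots in \<open>integral_curves_diff_le\<close> halves the rate, which is
  rounded up to \<open>L * b + 1\<close>. The second direction \<open>k\<close> may be
  arbitrary.\<close>

lemma flow_diff_le:
  assumes "norm h \<le> b" "0 < b"
  shows "norm (flow h x - flow k y) \<le> exp (L * b + 1) * (norm (x - y) + M * norm (h - k))"
proof -
  have "(norm (flow (1 *\<^sub>R h) x - flow (1 *\<^sub>R k) y))\<^sup>2 \<le>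
      ((norm (flow (0 *\<^sub>R h) x - flow (0 *\<^sub>R k) y))\<^sup>2 + (M * norm (h - k))\<^sup>2) * exp ((2 * L * b + 1) * 1)"
    by (rule integral_curves_diff_le) (use flow_has_vector_derivative assms in auto)
  also have "\<dots> \<le> (norm (x - y) + M * norm (h - k))\<^sup>2 * (exp (L * b + 1))\<^sup>2"
  proof (rule mult_mono)
    show "(norm (flow (0 *\<^sub>R h) x - flow (0 *\<^sub>R k) y))\<^sup>2 + (M * norm (h - k))\<^sup>2 \<le> (norm (x - y) + M * norm (h - k))\<^sup>2"
      using M_pos by (simp add: power2_sum)
    show "exp ((2 * L * b + 1) * 1) \<le> (exp (L * b + 1))\<^sup>2"
      by (simp add: power2_eq_square flip: exp_add)
  qed auto
  also have "\<dots> = (exp (L * b + 1) * (norm (x - y) + M * norm (h - k)))\<^sup>2"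
    by (simp add: power_mult_distrib)
  finally show ?thesis
    using M_pos by (simp add: power2_le_iff_abs_le)
qed

lemma flow_dist_le: "norm (flow h x - x) \<le> M * norm h"
proof -
  have "norm (flow (1 *\<^sub>R h) x - flow (0 *\<^sub>R h) x) \<le> (M * norm h) * norm (1 - 0 :: real)"
  proof (rule differentiable_bound[of UNIV "\<lambda>t. flow (t *\<^sub>R h) x" "\<lambda>t r. r *\<^sub>R X h (flow (t *\<^sub>R h) x)"])
    show "\<And>t. ((\<lambda>t. flow (t *\<^sub>R h) x) has_derivative (\<lambda>r. r *\<^sub>R X h (flow (t *\<^sub>R h) x))) (at t within UNIV)"
      using flow_has_vector_derivative[of h x, unfolded has_vector_derivative_def] by simp
    show "\<And>t. onorm (\<lambda>r. r *\<^sub>R X h (flow (t *\<^sub>R h) x)) \<le> M * norm h"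
      using frame_bound by (intro onorm_bound) (auto simp: mult.commute M_pos less_imp_le intro: mult_left_mono)
  qed auto
  then show ?thesis by simp
qed

text \<open>Integrating an affine model of the velocity over unit time produces the factor
  \<open>1/2\<close>. The model is free: \<open>w = 0\<close> yields the first-order estimate, and a
  linearisation of the field yields the second-order one.\<close>

lemma flow_euler:
  assumes v: "\<And>s. 0 \<le> s \<Longrightarrow> s \<le> 1 \<Longrightarrow> norm (X h (flow (s *\<^sub>R h) x) - (v + s *\<^sub>R w)) \<le> B"
  shows "norm (flow h x - x - v - (1/2) *\<^sub>R w) \<le> B"
proof -
  have "norm ((\<lambda>t. flow (t *\<^sub>R h) x - t *\<^sub>R v - (t\<^sup>2 / 2) *\<^sub>R w) 1 - (\<lambda>t. flow (t *\<^sub>R h) x - t *\<^sub>R v - (t\<^sup>2 / 2) *\<^sub>R w) 0)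
      \<le> B * norm (1 - 0 :: real)"
  proof (rule differentiable_bound[of "{0..1}" _ "\<lambda>t r. r *\<^sub>R (X h (flow (t *\<^sub>R h) x) - v - t *\<^sub>R w)"])
    fix t :: real assume t: "t \<in> {0..1}"
    have "((\<lambda>t. flow (t *\<^sub>R h) x) has_derivative (\<lambda>r. r *\<^sub>R X h (flow (t *\<^sub>R h) x))) (at t within {0..1})"
      using flow_has_vector_derivative[of h x t] unfolding has_vector_derivative_def by (rule has_derivative_at_withinI)
    then show "((\<lambda>t. flow (t *\<^sub>R h) x - t *\<^sub>R v - (t\<^sup>2 / 2) *\<^sub>R w) has_derivative
        (\<lambda>r. r *\<^sub>R (X h (flow (t *\<^sub>R h) x) - v - t *\<^sub>R w))) (at t within {0..1})"
      by (auto intro!: derivative_eq_intros simp: algebra_simps fun_eq_iff)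
    have "norm (X h (flow (t *\<^sub>R h) x) - v - t *\<^sub>R w) \<le> B" using v[of t] t by (simp add: diff_diff_eq)
    moreover from this have "0 \<le> B" using norm_ge_zero order_trans by blast
    ultimately show "onorm (\<lambda>r. r *\<^sub>R (X h (flow (t *\<^sub>R h) x) - v - t *\<^sub>R w)) \<le> B"
      by (intro onorm_bound) (auto simp: mult.commute[of B] intro: mult_left_mono)
  qed auto
  then show ?thesis by (simp add: algebra_simps)
qed

lemma flow_first_order: "norm (flow h x - x - X h x) \<le> L * M * (norm h)\<^sup>2"
proof -
  have "norm (flow h x - x - X h x - (1/2) *\<^sub>R 0) \<le> L * M * (norm h)\<^sup>2"
  proof (rule flow_euler)
    fix s :: real assume s: "0 \<le> s" "s \<le> 1"
    have "norm (X h (flow (s *\<^sub>R h) x) - X h x) \<le> L * norm h * norm (flow (s *\<^sub>R h) x - x)"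
      by (rule frame_lipschitz)
    also have "\<dots> \<le> L * norm h * (M * norm (s *\<^sub>R h))"
      using L_pos by (intro mult_left_mono flow_dist_le) auto
    also have "\<dots> \<le> L * norm h * (M * norm h)"
      using L_pos M_pos s by (intro mult_left_mono) (auto intro!: mult_left_le_one_le)
    finally show "norm (X h (flow (s *\<^sub>R h) x) - (X h x + s *\<^sub>R 0)) \<le> L * M * (norm h)\<^sup>2"
      by (simp add: power2_eq_square mult_ac)
  qed
  then show ?thesis by simp
qed

lemma flow_continuous: "continuous_on UNIV (\<lambda>(h, x). flow h x)"
proof -
  have "continuous_on (ball 0 b \<times> UNIV) (\<lambda>(h, x). flow h x)" if "b > 0" for b
  proof (rule lipschitz_on_continuous_on)
    show "(exp (L * b + 1) * (1 + M))-lipschitz_on (ball 0 b \<times> UNIV) (\<lambda>(h, x). flow h x)"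
    proof (rule lipschitz_onI)
      fix p q :: "'a \<times> 'a" assume p: "p \<in> ball 0 b \<times> UNIV"
      obtain h x k y where pq: "p = (h, x)" "q = (k, y)" by fastforce
      have "norm (flow h x - flow k y) \<le> exp (L * b + 1) * (norm (x - y) + M * norm (h - k))"
        using p pq that by (intro flow_diff_le) auto
      also have "\<dots> \<le> exp (L * b + 1) * (dist p q + M * dist p q)"
        using M_pos norm_snd_le[of "x - y" "h - k"] norm_fst_le[of "h - k" "x - y"]
        by (intro mult_left_mono add_mono) (auto simp: pq dist_norm norm_Pair)
      finally show "dist (case p of (h, x) \<Rightarrow> flow h x) (case q of (h, x) \<Rightarrow> flow h x) \<le> exp (L * b + 1) * (1 + M) * dist p q"
        by (simp add: pq dist_norm algebra_simps)
    qed (use M_pos in auto)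
  qed
  note cont = this
  have "isCont (\<lambda>(h, x). flow h x) p" for p
  proof (rule continuous_on_interior[OF cont])
    show "norm (fst p) + 1 > 0" by (simp add: add_nonneg_pos)
    have "p \<in> ball 0 (norm (fst p) + 1) \<times> UNIV" by (simp add: mem_Times_iff)
    then show "p \<in> interior (ball 0 (norm (fst p) + 1) \<times> UNIV)"
      by (simp add: interior_open open_Times)
  qed
  then show ?thesis by (simp add: continuous_on_eq_continuous_at)
qed

lemma continuous_on_flow [continuous_intros]:
  assumes "continuous_on S p" "continuous_on S q"
  shows "continuous_on S (\<lambda>x. flow (p x) (q x))"
  using continuous_on_compose2[OF flow_continuous continuous_on_Pair[OF assms] subset_UNIV] by simp

end

section \<open>Commuting flows\<close>

text \<open>Up to a null set an open set is a disjoint union of balls; the image of a ball of radius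
  \<open>r\<close> lies in a ball of radius \<open>C * r\<close>, and Lipschitz maps preserve null
  sets.\<close>

lemma emeasure_image_open_le:
  fixes f :: "'a::euclidean_space \<Rightarrow> 'a"
  assumes lip: "C-lipschitz_on UNIV f" and inj: "inj f" and "open S" and "C > 0"
  shows "emeasure lebesgue (f ` S) \<le> ennreal (C ^ DIM('a)) * emeasure lebesgue S"
proof -
  define K where "K = {(a, r). 0 < r \<and> cball a r \<subseteq> S}"
  let ?B = "\<lambda>i. cball (fst i) (snd i :: real) :: 'a set"
  obtain I where I: "countable I" "I \<subseteq> K"
    "pairwise (\<lambda>i j. disjnt (?B i) (?B j)) I"
    "negligible (S - (\<Union>i\<in>I. ?B i))"
  proof (rule Vitali_covering_theorem_cballs[of K snd S fst])
    show "\<And>i. i \<in> K \<Longrightarrow> 0 < snd i" by (auto simp: K_def)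
    fix x :: 'a and d :: real assume x: "x \<in> S" "0 < d"
    then obtain \<rho> where \<rho>: "\<rho> > 0" "cball x \<rho> \<subseteq> S"
      using \<open>open S\<close> by (meson open_contains_cball subsetD)
    have "cball x (min \<rho> (d / 2)) \<subseteq> S" using \<rho> by (auto simp: subset_iff)
    then show "\<exists>i. i \<in> K \<and> x \<in> ?B i \<and> snd i < d"
      using x \<rho> by (intro exI[of _ "(x, min \<rho> (d / 2))"]) (auto simp: K_def)
  qed
  have I': "0 < snd i" "?B i \<subseteq> S" if "i \<in> I" for i
    using subsetD[OF I(2) that] by (cases i; simp add: K_def)+
  have disj: "disjoint_family_on ?B I"
    using I(3) by (auto simp: disjoint_family_on_def pairwise_def disjnt_def)
  have disj': "disjoint_family_on (\<lambda>i. f ` ?B i) I"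
    using disj inj by (auto simp: disjoint_family_on_def image_Int[symmetric])
  have "negligible (f ` (S - (\<Union>i\<in>I. ?B i)))"
  proof (rule negligible_locally_Lipschitz_image[OF _ I(4)])
    fix x :: 'a
    show "\<exists>T B. open T \<and> x \<in> T \<and> (\<forall>y\<in>(S - (\<Union>i\<in>I. ?B i)) \<inter> T. norm (f y - f x) \<le> B * norm (y - x))"
      using lipschitz_onD[OF lip] by (intro exI[of _ UNIV] exI[of _ C]) (auto simp: dist_norm)
  qed simp
  then have n: "f ` (S - (\<Union>i\<in>I. ?B i)) \<in> null_sets lebesgue"
    by (simp add: negligible_iff_null_sets)
  have cont: "continuous_on T f" for T
    using lipschitz_on_continuous_on[OF lip] continuous_on_subset by blast
  have m: "f ` ?B i \<in> sets lebesgue" for i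
    by (intro lmeasurable_compact[THEN fmeasurableD] compact_continuous_image cont) simp
  have "f ` S \<subseteq> f ` (S - (\<Union>i\<in>I. ?B i)) \<union> (\<Union>i\<in>I. f ` ?B i)" by blast
  then have "emeasure lebesgue (f ` S) \<le> emeasure lebesgue (f ` (S - (\<Union>i\<in>I. ?B i)) \<union> (\<Union>i\<in>I. f ` ?B i))"
    by (rule emeasure_mono) (use n I(1) m in \<open>auto intro!: sets.countable_UN'\<close>)
  also have "\<dots> = emeasure lebesgue (\<Union>i\<in>I. f ` ?B i)"
    using n I(1) m by (subst Un_commute, intro emeasure_Un_null_set) (auto intro!: sets.countable_UN')
  also have "\<dots> = (\<integral>\<^sup>+i. emeasure lebesgue (f ` ?B i) \<partial>count_space I)"
    by (rule emeasure_UN_countable[OF m I(1) disj'])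
  also have "\<dots> \<le> (\<integral>\<^sup>+i. ennreal (C ^ DIM('a)) * emeasure lebesgue (?B i) \<partial>count_space I)"
  proof (rule nn_integral_mono)
    fix i assume "i \<in> space (count_space I)"
    then have r: "snd i > 0" using I' by simp
    have "f ` ?B i \<subseteq> cball (f (fst i)) (C * snd i)"
    proof
      fix y assume "y \<in> f ` ?B i"
      then obtain x where x: "x \<in> ?B i" "y = f x" by blast
      have "dist (f (fst i)) (f x) \<le> C * dist (fst i) x" by (rule lipschitz_onD[OF lip]) auto
      also have "\<dots> \<le> C * snd i" using x \<open>C > 0\<close> by (intro mult_left_mono) auto
      finally show "y \<in> cball (f (fst i)) (C * snd i)" using x by simp
    qed
    then have "emeasure lebesgue (f ` ?B i) \<le> emeasure lebesgue (cball (f (fst i)) (C * snd i))"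
      by (intro emeasure_mono) auto
    also have "\<dots> = ennreal (C ^ DIM('a)) * emeasure lebesgue (?B i)"
      using r \<open>C > 0\<close> by (simp add: emeasure_cball power_mult_distrib ennreal_mult'[symmetric] mult_ac)
    finally show "emeasure lebesgue (f ` ?B i) \<le> ennreal (C ^ DIM('a)) * emeasure lebesgue (?B i)" .
  qed
  also have "\<dots> = ennreal (C ^ DIM('a)) * (\<integral>\<^sup>+i. emeasure lebesgue (?B i) \<partial>count_space I)"
    by (rule nn_integral_cmult) auto
  also have "(\<integral>\<^sup>+i. emeasure lebesgue (?B i) \<partial>count_space I) = emeasure lebesgue (\<Union>i\<in>I. ?B i)"
    by (rule emeasure_UN_countable[symmetric, OF _ I(1) disj]) auto
  also have "\<dots> \<le> emeasure lebesgue S"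
    using I'(2) \<open>open S\<close> by (intro emeasure_mono UN_least) auto
  finally show ?thesis by (simp add: mult_left_mono)
qed

text \<open>A one-sided change of variables: preimages under \<open>f\<close> are images under its
  Lipschitz inverse \<open>g\<close>. The bound passes from open to Borel sets by outer regularity,
  and to integrals by comparing the pushforward with a multiple of Lebesgue measure.\<close>

lemma nn_integral_compose_le:
  fixes f g :: "'a::euclidean_space \<Rightarrow> 'a"
  assumes lip: "C-lipschitz_on UNIV g" and "C > 0" and inv: "\<And>x. f (g x) = x" "\<And>x. g (f x) = x"
    and f: "continuous_on UNIV f" and F: "F \<in> borel_measurable borel"
  shows "(\<integral>\<^sup>+x. F (f x) \<partial>lborel) \<le> ennreal (C ^ DIM('a)) * (\<integral>\<^sup>+x. F x \<partial>lborel)"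
proof -
  have fm: "f \<in> borel_measurable borel" using f by (rule borel_measurable_continuous_onI)
  have vim: "f -` S = g ` S" for S using inv by (auto simp: image_iff) metis
  have "inj g" using inv(1) by (metis injI)
  have op: "emeasure lborel (f -` S) \<le> ennreal (C ^ DIM('a)) * emeasure lborel S" if "open S" for S
  proof -
    have "open (f -` S)" using f \<open>open S\<close> by (simp add: continuous_on_open_vimage)
    then show ?thesis
      using emeasure_image_open_le[OF lip \<open>inj g\<close> \<open>open S\<close> \<open>C > 0\<close>] \<open>open S\<close> by (simp add: vim)
  qed
  have bo: "emeasure lborel (f -` S) \<le> ennreal (C ^ DIM('a)) * emeasure lborel S" if S: "S \<in> sets borel" for S
  proof (rule ennreal_le_epsilon)
    fix e :: real assume "e > 0"
    define e' where "e' = e / C ^ DIM('a)"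
    have "e' > 0" using \<open>e > 0\<close> \<open>C > 0\<close> by (simp add: e'_def)
    obtain T where T: "open T" "S \<subseteq> T" "emeasure lebesgue (T - S) < ennreal e'"
      using sets_lebesgue_outer_open[of S e'] S \<open>e' > 0\<close> by auto
    have m: "S \<in> sets borel" "T \<in> sets borel" "T - S \<in> sets borel" using S T by auto
    have "emeasure lborel (f -` S) \<le> emeasure lborel (f -` T)"
      using T(2) m measurable_sets[OF fm m(2)] by (intro emeasure_mono) auto
    also have "\<dots> \<le> ennreal (C ^ DIM('a)) * emeasure lborel T" by (rule op[OF T(1)])
    also have "emeasure lborel T \<le> emeasure lborel S + emeasure lborel (T - S)"
      using m T(2) emeasure_subadditive[of S lborel "T - S"] by (simp add: Un_absorb1 Un_Diff_cancel)
    also have "\<dots> \<le> emeasure lborel S + ennreal e'"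
      using T(3) m by (intro add_left_mono) simp
    finally have "emeasure lborel (f -` S) \<le> ennreal (C ^ DIM('a)) * emeasure lborel S + ennreal (C ^ DIM('a)) * ennreal e'"
      by (simp add: distrib_left mult_left_mono)
    also have "ennreal (C ^ DIM('a)) * ennreal e' = ennreal e"
      using \<open>C > 0\<close> \<open>e > 0\<close> by (simp add: e'_def ennreal_mult[symmetric])
    finally show "emeasure lborel (f -` S) \<le> ennreal (C ^ DIM('a)) * emeasure lborel S + ennreal e" .
  qed
  have "(\<integral>\<^sup>+x. F (f x) \<partial>lborel) = (\<integral>\<^sup>+x. F x \<partial>distr lborel borel f)"
    using fm F by (subst nn_integral_distr) auto
  also have "\<dots> \<le> (\<integral>\<^sup>+x. F x \<partial>scale_measure (ennreal (C ^ DIM('a))) lborel)"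
  proof (rule nn_integral_mono_measure)
    show "distr lborel borel f \<le> scale_measure (ennreal (C ^ DIM('a))) lborel"
      using fm bo by (subst le_measure) (auto simp: emeasure_distr)
  qed simp
  also have "\<dots> = ennreal (C ^ DIM('a)) * (\<integral>\<^sup>+x. F x \<partial>lborel)"
    using F by (intro nn_integral_scale_measure) auto
  finally show ?thesis .
qed

lemma has_derivative_if_quadratic:
  fixes f :: "'a::real_normed_vector \<Rightarrow> 'b::real_normed_vector"
  assumes bl: "bounded_linear f'" and "d > 0"
    and le: "\<And>h. norm h < d \<Longrightarrow> norm (f (x + h) - f x - f' h) \<le> C * (norm h)\<^sup>2"
  shows "(f has_derivative f') (at x)"
  unfolding has_derivative_at_alt
proof (intro conjI allI impI bl)
  fix \<epsilon> :: real assume "\<epsilon> > 0"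
  define \<delta> where "\<delta> = min d (\<epsilon> / (\<bar>C\<bar> + 1))"
  have "norm (f y - f x - f' (y - x)) \<le> \<epsilon> * norm (y - x)" if "norm (y - x) < \<delta>" for y
  proof -
    have "norm (f y - f x - f' (y - x)) \<le> C * (norm (y - x))\<^sup>2"
      using le[of "y - x"] that by (simp add: \<delta>_def)
    also have "\<dots> \<le> ((\<bar>C\<bar> + 1) * norm (y - x)) * norm (y - x)"
      by (simp add: power2_eq_square mult.assoc mult_right_mono)
    also have "\<dots> \<le> \<epsilon> * norm (y - x)"
    proof (rule mult_right_mono)
      have "norm (y - x) * (\<bar>C\<bar> + 1) < \<epsilon>"
        using that by (simp add: \<delta>_def pos_less_divide_eq[of "\<bar>C\<bar> + 1"] add_nonneg_pos)
      then show "(\<bar>C\<bar> + 1) * norm (y - x) \<le> \<epsilon>" by (simp add: mult.commute)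
    qed simp
    finally show ?thesis .
  qed
  moreover have "\<delta> > 0" using \<open>d > 0\<close> \<open>\<epsilon> > 0\<close> by (simp add: \<delta>_def add_nonneg_pos)
  ultimately show "\<exists>d>0. \<forall>y. norm (y - x) < d \<longrightarrow> norm (f y - f x - f' (y - x)) \<le> \<epsilon> * norm (y - x)"
    by blast
qed

text \<open>Telescoping over an \<open>N\<close> by \<open>N\<close> grid: each exchange of one
  \<open>A\<close> with one \<open>B\<close> makes an error that the remaining powers of
  \<open>B\<close> and of \<open>A\<close> carry to the end, whence the two factors
  \<open>\<Lambda>\<close>. Bounding the powers instead of \<open>A\<close> and \<open>B\<close>
  keeps the constant independent of \<open>N\<close>.\<close>

lemma norm_commute_powers_le:
  fixes A B :: "'a::real_normed_vector \<Rightarrow> 'a"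
  assumes A: "\<And>i x y. i \<le> N \<Longrightarrow> norm ((A ^^ i) x - (A ^^ i) y) \<le> \<Lambda> * norm (x - y)"
    and B: "\<And>j x y. j \<le> N \<Longrightarrow> norm ((B ^^ j) x - (B ^^ j) y) \<le> \<Lambda> * norm (x - y)"
    and "\<Lambda> \<ge> 0"
  shows "norm ((A ^^ N) ((B ^^ N) x) - (B ^^ N) ((A ^^ N) x)) \<le>
    \<Lambda>\<^sup>2 * (\<Sum>i<N. \<Sum>j<N. norm (A (B ((B ^^ j) ((A ^^ i) x))) - B (A ((B ^^ j) ((A ^^ i) x)))))"
proof -
  define H where "H z = norm (A (B z) - B (A z))" for z
  have 1: "norm (A ((B ^^ j) z) - (B ^^ j) (A z)) \<le> \<Lambda> * (\<Sum>l<j. H ((B ^^ l) z))" if "j \<le> N" for j z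
    using that
  proof (induction j arbitrary: z)
    case (Suc j)
    have "norm (A ((B ^^ Suc j) z) - (B ^^ Suc j) (A z)) \<le>
        norm (A ((B ^^ j) (B z)) - (B ^^ j) (A (B z))) + norm ((B ^^ j) (A (B z)) - (B ^^ j) (B (A z)))"
      unfolding funpow_Suc_right o_def by (metis norm_triangle_ineq diff_add_cancel add_diff_eq)
    also have "\<dots> \<le> \<Lambda> * (\<Sum>l<j. H ((B ^^ l) (B z))) + \<Lambda> * H z"
      using Suc B[of j] by (intro add_mono) (auto simp: H_def)
    also have "\<dots> = \<Lambda> * (\<Sum>l<Suc j. H ((B ^^ l) z))"
      unfolding sum.lessThan_Suc_shift by (simp add: funpow_swap1 algebra_simps)
    finally show ?case .
  qed simp
  have 2: "norm ((A ^^ i) ((B ^^ N) z) - (B ^^ N) ((A ^^ i) z)) \<le> \<Lambda> * (\<Sum>k<i. norm (A ((B ^^ N) ((A ^^ k) z)) - (B ^^ N) (A ((A ^^ k) z))))"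
    if "i \<le> N" for i z
    using that
  proof (induction i arbitrary: z)
    case (Suc i)
    have "norm ((A ^^ Suc i) ((B ^^ N) z) - (B ^^ N) ((A ^^ Suc i) z)) \<le>
        norm ((A ^^ i) (A ((B ^^ N) z)) - (A ^^ i) ((B ^^ N) (A z))) + norm ((A ^^ i) ((B ^^ N) (A z)) - (B ^^ N) ((A ^^ i) (A z)))"
      unfolding funpow_Suc_right o_def by (metis norm_triangle_ineq diff_add_cancel add_diff_eq)
    also have "\<dots> \<le> \<Lambda> * norm (A ((B ^^ N) z) - (B ^^ N) (A z)) + \<Lambda> * (\<Sum>k<i. norm (A ((B ^^ N) ((A ^^ k) (A z))) - (B ^^ N) (A ((A ^^ k) (A z)))))"
      using Suc A[of i] by (intro add_mono) auto
    also have "\<dots> = \<Lambda> * (\<Sum>k<Suc i. norm (A ((B ^^ N) ((A ^^ k) z)) - (B ^^ N) (A ((A ^^ k) z))))"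
      unfolding sum.lessThan_Suc_shift by (simp add: funpow_swap1 algebra_simps)
    finally show ?case .
  qed simp
  have "norm ((A ^^ N) ((B ^^ N) x) - (B ^^ N) ((A ^^ N) x)) \<le> \<Lambda> * (\<Sum>k<N. norm (A ((B ^^ N) ((A ^^ k) x)) - (B ^^ N) (A ((A ^^ k) x))))"
    by (rule 2) simp
  also have "\<dots> \<le> \<Lambda> * (\<Sum>k<N. \<Lambda> * (\<Sum>l<N. H ((B ^^ l) ((A ^^ k) x))))"
    using \<open>\<Lambda> \<ge> 0\<close> by (intro mult_left_mono sum_mono 1) auto
  also have "\<dots> = \<Lambda>\<^sup>2 * (\<Sum>i<N. \<Sum>j<N. H ((B ^^ j) ((A ^^ i) x)))"
    by (simp add: power2_eq_square sum_distrib_left mult.assoc)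
  finally show ?thesis by (simp add: H_def)
qed

section \<open>Commutators of small flows\<close>

context lipschitz_frame
begin

definition commutator_norm :: "'a \<Rightarrow> 'a \<Rightarrow> 'a \<Rightarrow> real" where
  "commutator_norm h k z = norm (flow h (flow k z) - flow k (flow h z))"

text \<open>Both orders agree with \<open>z + X h z + X k z\<close> up to quadratic terms. The bound
  is uniform in \<open>z\<close> and, after multiplication by \<open>N\<^sup>2\<close>, serves as
  dominating function.\<close>

lemma commutator_norm_le: "commutator_norm h k z \<le> 2 * L * M * (norm h + norm k)\<^sup>2"
proof -
  have 1: "norm (flow h (flow k z) - z - X h z - X k z) \<le> L * M * (norm h + norm k)\<^sup>2" for h k
  proof -
    have eq: "flow h (flow k z) - z - X h z - X k z = (flow h (flow k z) - flow k z - X h (flow k z)) + (flow k z - z - X k z)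
        + (X h (flow k z) - X h z)" by simp
    have "norm (X h (flow k z) - X h z) \<le> L * norm h * (M * norm k)"
      using frame_lipschitz[of h "flow k z" z] flow_dist_le[of k z] L_pos
      by (smt (verit) mult_left_mono mult_nonneg_nonneg norm_ge_zero)
    then have "norm (flow h (flow k z) - z - X h z - X k z) \<le> L * M * (norm h)\<^sup>2 + L * M * (norm k)\<^sup>2 + L * norm h * (M * norm k)"
      unfolding eq using flow_first_order[of h "flow k z"] flow_first_order[of k z]
      by (intro norm_triangle_le add_mono) auto
    also have "\<dots> \<le> L * M * (norm h + norm k)\<^sup>2"
      using L_pos M_pos by (simp add: power2_eq_square algebra_simps)
    finally show ?thesis .
  qed
  have "flow h (flow k z) - flow k (flow h z) = (flow h (flow k z) - z - X h z - X k z) - (flow k (flow h z) - z - X k z - X h z)"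
    by simp
  then have "commutator_norm h k z \<le> norm (flow h (flow k z) - z - X h z - X k z) + norm (flow k (flow h z) - z - X k z - X h z)"
    unfolding commutator_norm_def by (metis norm_triangle_ineq4)
  then show ?thesis using 1[of h k] 1[of k h] by (simp add: add.commute)
qed

text \<open>The second arc of a commutator starts at the end of the first, where the fields need not
  be differentiable, so the expansion at \<open>z\<close> must admit starting points near
  \<open>z\<close>. Restricting them to distance \<open>c * a\<close> keeps the differentiability
  error of order \<open>o(a\<^sup>2)\<close>.\<close>

lemma flow_second_order:
  assumes D: "((\<lambda>z. X k z) has_derivative D) (at z)" and "\<epsilon> > 0" and "c \<ge> 0"
  shows "\<exists>\<delta>>0. \<forall>a x. 0 < a \<longrightarrow> a < \<delta> \<longrightarrow> norm (x - z) \<le> c * a \<longrightarrow>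
    norm (flow (a *\<^sub>R k) x - x - a *\<^sub>R X k z - a *\<^sub>R D (x - z) - (a\<^sup>2 / 2) *\<^sub>R D (X k z)) \<le> \<epsilon> * a\<^sup>2"
proof -
  have blD: "bounded_linear D" using D by (rule has_derivative_bounded_linear)
  then have linD: "linear D" by (rule bounded_linear.linear)
  obtain KD where KD: "KD > 0" "\<And>v. norm (D v) \<le> norm v * KD" using bounded_linear.pos_bounded[OF blD] by blast
  \<comment> \<open>In units of \<open>a\<close>, this bounds the distance to \<open>z\<close> along
    the whole arc; \<open>Q\<close> below collects the error that \<open>D\<close> makes of the
    deviation of the arc from a straight line.\<close>
  define c' where "c' = c + M * norm k + 1"
  have c': "c' > 0" using \<open>c \<ge> 0\<close> M_pos by (simp add: c'_def add_nonneg_pos)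
  define Q where "Q = KD * (L * M * (norm k)\<^sup>2 + L * norm k * c) + 1"
  have Q: "Q > 0" using KD L_pos M_pos \<open>c \<ge> 0\<close> by (simp add: Q_def add_nonneg_pos)
  define \<epsilon>' where "\<epsilon>' = \<epsilon> / (2 * c')"
  have "\<epsilon>' > 0" using \<open>\<epsilon> > 0\<close> c' by (simp add: \<epsilon>'_def)
  then obtain d where d: "d > 0" "\<And>y. norm (y - z) < d \<Longrightarrow> norm (X k y - X k z - D (y - z)) \<le> \<epsilon>' * norm (y - z)"
    using D[unfolded has_derivative_at_alt, THEN conjunct2] by blast
  define \<delta> where "\<delta> = min (d / c') (\<epsilon> / (2 * Q))"
  have "\<delta> > 0" using d c' Q \<open>\<epsilon> > 0\<close> by (simp add: \<delta>_def)
  moreover have "norm (flow (a *\<^sub>R k) x - x - a *\<^sub>R X k z - a *\<^sub>R D (x - z) - (a\<^sup>2 / 2) *\<^sub>R D (X k z)) \<le> \<epsilon> * a\<^sup>2"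
    if a: "0 < a" "a < \<delta>" and x: "norm (x - z) \<le> c * a" for a x
  proof -
    have "norm (flow (a *\<^sub>R k) x - x - (a *\<^sub>R X k z + a *\<^sub>R D (x - z)) - (1/2) *\<^sub>R (a\<^sup>2 *\<^sub>R D (X k z))) \<le> \<epsilon> * a\<^sup>2"
    proof (rule flow_euler)
      fix s :: real assume s: "0 \<le> s" "s \<le> 1"
      define y where "y = flow (s *\<^sub>R a *\<^sub>R k) x"
      have sa: "s * a \<le> a" "0 \<le> s * a" using s a by (auto intro: mult_left_le_one_le)
      have "norm (y - x) \<le> M * (a * norm k)"
      proof -
        have "norm (y - x) \<le> M * norm (s *\<^sub>R a *\<^sub>R k)" unfolding y_def by (rule flow_dist_le)
        also have "norm (s *\<^sub>R a *\<^sub>R k) = (s * a) * norm k" using s a by simp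
        also have "M * ((s * a) * norm k) \<le> M * (a * norm k)"
          using sa M_pos by (intro mult_left_mono mult_right_mono) auto
        finally show ?thesis .
      qed
      then have "norm (y - z) \<le> M * (a * norm k) + c * a"
        using x norm_triangle_ineq[of "y - x" "x - z"] by simp
      also have "\<dots> < c' * a" using a by (simp add: c'_def algebra_simps)
      finally have yz: "norm (y - z) < c' * a" .
      also have "\<dots> < d" using a c' by (simp add: \<delta>_def pos_less_divide_eq mult.commute)
      finally have e1: "norm (X k y - X k z - D (y - z)) \<le> \<epsilon>' * (c' * a)"
        using d(2)[of y] yz \<open>\<epsilon>' > 0\<close> by (smt (verit) mult_left_mono)
      have "norm (y - x - (s * a) *\<^sub>R X k z) \<le> norm (y - x - X (s *\<^sub>R a *\<^sub>R k) x) + norm (X (s *\<^sub>R a *\<^sub>R k) x - (s * a) *\<^sub>R X k z)"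
        using norm_triangle_ineq[of "y - x - X (s *\<^sub>R a *\<^sub>R k) x" "X (s *\<^sub>R a *\<^sub>R k) x - (s * a) *\<^sub>R X k z"] by simp
      also have "norm (y - x - X (s *\<^sub>R a *\<^sub>R k) x) \<le> L * M * (norm (s *\<^sub>R a *\<^sub>R k))\<^sup>2"
        unfolding y_def by (rule flow_first_order)
      also have "\<dots> = L * M * ((s * a)\<^sup>2 * (norm k)\<^sup>2)" by (simp add: power_mult_distrib)
      also have "\<dots> \<le> L * M * (a\<^sup>2 * (norm k)\<^sup>2)"
        using sa L_pos M_pos by (intro mult_left_mono mult_right_mono power_mono) auto
      also have "norm (X (s *\<^sub>R a *\<^sub>R k) x - (s * a) *\<^sub>R X k z) = (s * a) * norm (X k x - X k z)"
        using sa by (simp add: frame_simps flip: scaleR_diff_right)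
      also have "\<dots> \<le> a * (L * norm k * (c * a))"
      proof (rule mult_mono)
        have "L * norm k * norm (x - z) \<le> L * norm k * (c * a)"
          using x L_pos by (intro mult_left_mono) auto
        then show "norm (X k x - X k z) \<le> L * norm k * (c * a)"
          using frame_lipschitz[of k x z] by linarith
      qed (use sa a in auto)
      finally have e2: "norm (y - x - (s * a) *\<^sub>R X k z) \<le> (L * M * (norm k)\<^sup>2 + L * norm k * c) * a\<^sup>2"
        by (simp add: power2_eq_square algebra_simps)
      have "D (y - z) = D (x - z) + (s * a) *\<^sub>R D (X k z) + D (y - x - (s * a) *\<^sub>R X k z)"
        by (simp add: linear_diff[OF linD] linear_scale[OF linD])
      then have eq: "X (a *\<^sub>R k) y - (a *\<^sub>R X k z + a *\<^sub>R D (x - z) + s *\<^sub>R a\<^sup>2 *\<^sub>R D (X k z)) =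
          a *\<^sub>R ((X k y - X k z - D (y - z)) + D (y - x - (s * a) *\<^sub>R X k z))"
        by (simp add: frame_simps algebra_simps power2_eq_square)
      have "norm (X (a *\<^sub>R k) y - (a *\<^sub>R X k z + a *\<^sub>R D (x - z) + s *\<^sub>R a\<^sup>2 *\<^sub>R D (X k z))) =
          a * norm ((X k y - X k z - D (y - z)) + D (y - x - (s * a) *\<^sub>R X k z))"
        unfolding eq using a by simp
      also have "\<dots> \<le> a * (\<epsilon>' * (c' * a) + (L * M * (norm k)\<^sup>2 + L * norm k * c) * a\<^sup>2 * KD)"
        using a e1 e2 KD(2)[of "y - x - (s * a) *\<^sub>R X k z"] KD(1)
        by (intro mult_left_mono norm_triangle_le add_mono) (auto elim!: order_trans intro!: mult_right_mono)
      also have "\<dots> \<le> a * (\<epsilon>' * (c' * a) + Q * a\<^sup>2)"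
        using a by (intro mult_left_mono add_left_mono) (auto simp: Q_def algebra_simps)
      also have "\<dots> \<le> a * (\<epsilon> / 2 * a + \<epsilon> / 2 * a)"
      proof (intro mult_left_mono add_mono)
        show "\<epsilon>' * (c' * a) \<le> \<epsilon> / 2 * a" using c' by (simp add: \<epsilon>'_def)
        have "Q * a < \<epsilon> / 2" using a Q by (simp add: \<delta>_def pos_less_divide_eq mult_ac)
        then have "Q * a * a \<le> \<epsilon> / 2 * a" using a by (intro mult_right_mono) auto
        then show "Q * a\<^sup>2 \<le> \<epsilon> / 2 * a" by (simp add: power2_eq_square mult_ac)
      qed (use a in auto)
      finally show "norm (X (a *\<^sub>R k) (flow (s *\<^sub>R a *\<^sub>R k) x) - (a *\<^sub>R X k z + a *\<^sub>R D (x - z) + s *\<^sub>R a\<^sup>2 *\<^sub>R D (X k z))) \<le> \<epsilon> * a\<^sup>2"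
        by (simp add: y_def power2_eq_square algebra_simps)
    qed
    then show ?thesis by (simp add: diff_diff_eq add.assoc)
  qed
  ultimately show ?thesis by blast
qed

text \<open>Expanding all four arcs at \<open>z\<close>, everything cancels except \<open>a\<close>
  times \<open>Dh (x - z) - Dk (y - z)\<close>, where \<open>x\<close> and \<open>y\<close> are the
  ends of the first arcs along \<open>k\<close> and \<open>h\<close>. Its leading part is the
  bracket, zero by \<open>sym\<close>; the remainder is of third order.\<close>

lemma commutator_norm_tendsto:
  assumes Dh: "((\<lambda>z. X h z) has_derivative Dh) (at z)" and Dk: "((\<lambda>z. X k z) has_derivative Dk) (at z)"
    and sym: "Dk (X h z) = Dh (X k z)"
  shows "(\<lambda>n. (real (Suc n))\<^sup>2 * commutator_norm (h /\<^sub>R real (Suc n)) (k /\<^sub>R real (Suc n)) z) \<longlonglongrightarrow> 0"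
proof (rule LIMSEQ_I)
  fix \<epsilon> :: real assume "\<epsilon> > 0"
  have blD: "bounded_linear Dh" "bounded_linear Dk" using Dh Dk by (auto dest: has_derivative_bounded_linear)
  then have linD: "linear Dh" "linear Dk" by (auto dest: bounded_linear.linear)
  obtain K1 where K1: "K1 > 0" "\<And>v. norm (Dh v) \<le> norm v * K1" using bounded_linear.pos_bounded[OF blD(1)] by blast
  obtain K2 where K2: "K2 > 0" "\<And>v. norm (Dk v) \<le> norm v * K2" using bounded_linear.pos_bounded[OF blD(2)] by blast
  define C where "C = K1 * (L * M * (norm k)\<^sup>2) + K2 * (L * M * (norm h)\<^sup>2) + 1"
  have C: "C > 0" using K1 K2 L_pos M_pos by (simp add: C_def add_nonneg_pos)
  have e: "\<epsilon> / 8 > 0" using \<open>\<epsilon> > 0\<close> by simp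
  obtain d1 where d1: "d1 > 0" "\<And>a x. 0 < a \<Longrightarrow> a < d1 \<Longrightarrow> norm (x - z) \<le> M * norm k * a \<Longrightarrow>
    norm (flow (a *\<^sub>R h) x - x - a *\<^sub>R X h z - a *\<^sub>R Dh (x - z) - (a\<^sup>2 / 2) *\<^sub>R Dh (X h z)) \<le> \<epsilon> / 8 * a\<^sup>2"
    using flow_second_order[OF Dh e, of "M * norm k"] M_pos by auto
  obtain d2 where d2: "d2 > 0" "\<And>a x. 0 < a \<Longrightarrow> a < d2 \<Longrightarrow> norm (x - z) \<le> M * norm h * a \<Longrightarrow>
    norm (flow (a *\<^sub>R k) x - x - a *\<^sub>R X k z - a *\<^sub>R Dk (x - z) - (a\<^sup>2 / 2) *\<^sub>R Dk (X k z)) \<le> \<epsilon> / 8 * a\<^sup>2"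
    using flow_second_order[OF Dk e, of "M * norm h"] M_pos by auto
  \<comment> \<open>The four remainders take \<open>\<epsilon> / 8\<close> each, together
    \<open>\<epsilon> / 2\<close>; the last bound on \<open>a\<close> makes the cubic term less than
    \<open>\<epsilon> / 4 * a\<^sup>2\<close>.\<close>
  define d where "d = min (min d1 d2) (\<epsilon> / (4 * C))"
  have "d > 0" using d1 d2 C \<open>\<epsilon> > 0\<close> by (simp add: d_def)
  have main: "commutator_norm (a *\<^sub>R h) (a *\<^sub>R k) z < \<epsilon> * a\<^sup>2" if a: "0 < a" "a < d" for a
  proof -
    let ?x = "flow (a *\<^sub>R k) z" and ?y = "flow (a *\<^sub>R h) z"
    have x: "norm (?x - z) \<le> M * norm k * a" and y: "norm (?y - z) \<le> M * norm h * a"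
      using flow_dist_le[of "a *\<^sub>R k" z] flow_dist_le[of "a *\<^sub>R h" z] a by (auto simp: mult_ac)
    have ad: "a < d1" "a < d2" "a < \<epsilon> / (4 * C)" using a by (auto simp: d_def)
    \<comment> \<open>\<open>e1\<close> and \<open>e2\<close> are the remainders of the second arcs,
      \<open>e3\<close> and \<open>e4\<close> those of the first arcs; the void terms
      \<open>Dh (z - z)\<close> and \<open>Dk (z - z)\<close> give all four the same shape.\<close>
    define e1 where "e1 = flow (a *\<^sub>R h) ?x - ?x - a *\<^sub>R X h z - a *\<^sub>R Dh (?x - z) - (a\<^sup>2 / 2) *\<^sub>R Dh (X h z)"
    define e2 where "e2 = flow (a *\<^sub>R k) ?y - ?y - a *\<^sub>R X k z - a *\<^sub>R Dk (?y - z) - (a\<^sup>2 / 2) *\<^sub>R Dk (X k z)"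
    define e3 where "e3 = ?y - z - a *\<^sub>R X h z - a *\<^sub>R Dh (z - z) - (a\<^sup>2 / 2) *\<^sub>R Dh (X h z)"
    define e4 where "e4 = ?x - z - a *\<^sub>R X k z - a *\<^sub>R Dk (z - z) - (a\<^sup>2 / 2) *\<^sub>R Dk (X k z)"
    have e: "norm e1 \<le> \<epsilon> / 8 * a\<^sup>2" "norm e2 \<le> \<epsilon> / 8 * a\<^sup>2" "norm e3 \<le> \<epsilon> / 8 * a\<^sup>2" "norm e4 \<le> \<epsilon> / 8 * a\<^sup>2"
      unfolding e1_def e2_def e3_def e4_def
      using d1(2)[OF a(1) ad(1) x] d2(2)[OF a(1) ad(2) y] d1(2)[OF a(1) ad(1), of z] d2(2)[OF a(1) ad(2), of z] a M_pos
      by auto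
    define r1 where "r1 = ?x - z - X (a *\<^sub>R k) z"
    define r2 where "r2 = ?y - z - X (a *\<^sub>R h) z"
    have r: "norm r1 \<le> L * M * (a\<^sup>2 * (norm k)\<^sup>2)" "norm r2 \<le> L * M * (a\<^sup>2 * (norm h)\<^sup>2)"
      using flow_first_order[of "a *\<^sub>R k" z] flow_first_order[of "a *\<^sub>R h" z] by (auto simp: r1_def r2_def power_mult_distrib)
    have Dx: "Dh (?x - z) = Dh r1 + a *\<^sub>R Dh (X k z)" and Dy: "Dk (?y - z) = Dk r2 + a *\<^sub>R Dk (X h z)"
      by (simp_all add: r1_def r2_def frame_simps linear_diff[OF linD(1)] linear_diff[OF linD(2)] linear_scale[OF linD(1)] linear_scale[OF linD(2)])
    have "flow (a *\<^sub>R h) ?x - flow (a *\<^sub>R k) ?y = e1 - e2 - e3 + e4 + a *\<^sub>R (Dh (?x - z) - Dk (?y - z))"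
      unfolding e1_def e2_def e3_def e4_def
      by (simp add: linear_0[OF linD(1)] linear_0[OF linD(2)] scaleR_diff_right)
    also have "Dh (?x - z) - Dk (?y - z) = Dh r1 - Dk r2" unfolding Dx Dy sym by simp
    finally have "commutator_norm (a *\<^sub>R h) (a *\<^sub>R k) z = norm (e1 - e2 - e3 + e4 + a *\<^sub>R (Dh r1 - Dk r2))"
      by (simp add: commutator_norm_def)
    also have "\<dots> \<le> norm e1 + norm e2 + norm e3 + norm e4 + a * (norm (Dh r1) + norm (Dk r2))"
    proof -
      have "norm (a *\<^sub>R (Dh r1 - Dk r2)) \<le> a * (norm (Dh r1) + norm (Dk r2))"
        using a norm_triangle_ineq4[of "Dh r1" "Dk r2"] by (simp add: mult_left_mono)
      moreover have "norm (e1 - e2 - e3 + e4) \<le> norm e1 + norm e2 + norm e3 + norm e4"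
        using norm_triangle_ineq[of "e1 - e2 - e3" e4] norm_triangle_ineq4[of "e1 - e2" e3] norm_triangle_ineq4[of e1 e2] by linarith
      ultimately show ?thesis using norm_triangle_ineq[of "e1 - e2 - e3 + e4" "a *\<^sub>R (Dh r1 - Dk r2)"] by linarith
    qed
    also have "\<dots> \<le> \<epsilon> / 2 * a\<^sup>2 + a * (a\<^sup>2 * C)"
    proof -
      have "norm (Dh r1) \<le> L * M * (a\<^sup>2 * (norm k)\<^sup>2) * K1"
        using K1(2)[of r1] r(1) K1(1) by (meson mult_right_mono less_imp_le order_trans)
      moreover have "norm (Dk r2) \<le> L * M * (a\<^sup>2 * (norm h)\<^sup>2) * K2"
        using K2(2)[of r2] r(2) K2(1) by (meson mult_right_mono less_imp_le order_trans)
      ultimately have "norm (Dh r1) + norm (Dk r2) \<le> a\<^sup>2 * (C - 1)"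
        by (simp add: C_def algebra_simps)
      also have "\<dots> \<le> a\<^sup>2 * C" by (intro mult_left_mono) auto
      finally have "a * (norm (Dh r1) + norm (Dk r2)) \<le> a * (a\<^sup>2 * C)" using a by (intro mult_left_mono) auto
      then show ?thesis using e by simp
    qed
    also have "\<dots> < \<epsilon> / 2 * a\<^sup>2 + \<epsilon> / 4 * a\<^sup>2"
    proof -
      have "a * C < \<epsilon> / 4" using ad(3) C by (simp add: pos_less_divide_eq mult_ac)
      then have "a * C * a\<^sup>2 < \<epsilon> / 4 * a\<^sup>2" using a by (intro mult_strict_right_mono) auto
      then show ?thesis by (simp add: mult_ac)
    qed
    also have "\<dots> \<le> \<epsilon> * a\<^sup>2" using \<open>\<epsilon> > 0\<close> by simp
    finally show ?thesis .
  qed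
  obtain n0 where n0: "inverse (real (Suc n0)) < d" using reals_Archimedean[OF \<open>d > 0\<close>] by blast
  have "norm ((real (Suc n))\<^sup>2 * commutator_norm (h /\<^sub>R real (Suc n)) (k /\<^sub>R real (Suc n)) z - 0) < \<epsilon>" if "n \<ge> n0" for n
  proof -
    define a where "a = inverse (real (Suc n))"
    have a0: "a > 0" by (simp add: a_def)
    have "a \<le> inverse (real (Suc n0))" unfolding a_def using that by (intro le_imp_inverse_le) auto
    then have "commutator_norm (a *\<^sub>R h) (a *\<^sub>R k) z < \<epsilon> * a\<^sup>2" using n0 a0 by (intro main) auto
    then have "(real (Suc n))\<^sup>2 * commutator_norm (a *\<^sub>R h) (a *\<^sub>R k) z < (real (Suc n))\<^sup>2 * (\<epsilon> * a\<^sup>2)"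
      by (intro mult_strict_left_mono) auto
    also have "\<dots> = \<epsilon>" by (simp add: a_def power_inverse)
    finally show ?thesis by (simp add: a_def commutator_norm_def)
  qed
  then show "\<exists>no. \<forall>n\<ge>no. norm ((real (Suc n))\<^sup>2 * commutator_norm (h /\<^sub>R real (Suc n)) (k /\<^sub>R real (Suc n)) z - 0) < \<epsilon>"
    by blast
qed

lemma nn_integral_flow_le:
  assumes F: "F \<in> borel_measurable borel" and "norm h \<le> b" "0 < b"
  shows "(\<integral>\<^sup>+x. F (flow h x) \<partial>lborel) \<le> ennreal (exp (L * b + 1) ^ DIM('a)) * (\<integral>\<^sup>+x. F x \<partial>lborel)"
proof (rule nn_integral_compose_le[where g="flow (- h)"])
  show "(exp (L * b + 1))-lipschitz_on UNIV (flow (- h))"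
    using flow_diff_le[of "- h" b _ "- h"] assms by (intro lipschitz_onI) (auto simp: dist_norm)
  show "continuous_on UNIV (flow h)"
    by (rule continuous_on_flow[OF continuous_on_const continuous_on_id])
qed (use F in auto)

text \<open>Flows distort Lebesgue measure by a bounded factor, so the sum of the small commutators along the
  way can be integrated over the starting point \<open>x\<close> term by term.\<close>

lemma flow_commute:
  assumes D: "\<And>l. AE z in lebesgue. z \<in> ball x0 R \<longrightarrow> ((\<lambda>z. X l z) has_derivative D l z) (at z)"
    and sym: "AE z in lebesgue. z \<in> ball x0 R \<longrightarrow> D k z (X h z) = D h z (X k z)"
    and r: "r + M * norm h + M * norm k \<le> R" and x: "x \<in> ball x0 r"
  shows "flow h (flow k x) = flow k (flow h x)"
proof -
  define b where "b = norm h + norm k + 1"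
  have b: "norm h \<le> b" "norm k \<le> b" "b > 0" by (auto simp: b_def add_nonneg_pos)
  define \<Lambda> where "\<Lambda> = exp (L * b + 1)"
  define K where "K = ennreal (\<Lambda> ^ DIM('a))"
  define H where "H n z = commutator_norm (h /\<^sub>R real (Suc n)) (k /\<^sub>R real (Suc n)) z" for n z
  \<comment> \<open>The derivatives are controlled on \<open>ball x0 R\<close> only. The indicator
    discards the rest, and \<open>stay\<close> ensures that every grid point reached from
    \<open>ball x0 r\<close> is kept.\<close>
  define F where "F n z = ennreal (H n z) * indicator (ball x0 R) z" for n z
  have contH: "continuous_on UNIV (H n)" for n
    unfolding H_def commutator_norm_def by (intro continuous_intros)
  have measH [measurable]: "H n \<in> borel_measurable borel" for n
    using contH by (rule borel_measurable_continuous_onI)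
  have measF [measurable]: "F n \<in> borel_measurable borel" for n
    unfolding F_def
    by (intro borel_measurable_times_ennreal borel_measurable_indicator measurable_compose[OF measH measurable_ennreal]) simp
  \<comment> \<open>Both flows are cut into \<open>Suc n\<close> equal pieces; the points on the
    grid are partial flows along \<open>h\<close> followed by partial flows along
    \<open>k\<close>.\<close>
  have le: "norm (flow h (flow k x) - flow k (flow h x)) \<le>
      \<Lambda>\<^sup>2 * (\<Sum>i<Suc n. \<Sum>j<Suc n. H n (flow ((real j / real (Suc n)) *\<^sub>R k) (flow ((real i / real (Suc n)) *\<^sub>R h) x)))" for n x
  proof -
    define A where "A = flow (h /\<^sub>R real (Suc n))"
    define B where "B = flow (k /\<^sub>R real (Suc n))"
    have A: "(A ^^ i) x = flow ((real i / real (Suc n)) *\<^sub>R h) x" for i x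
      using flow_power[of i "h /\<^sub>R real (Suc n)" x] by (simp add: A_def divide_inverse)
    have B: "(B ^^ i) x = flow ((real i / real (Suc n)) *\<^sub>R k) x" for i x
      using flow_power[of i "k /\<^sub>R real (Suc n)" x] by (simp add: B_def divide_inverse)
    have small: "norm ((real i / real (Suc n)) *\<^sub>R l) \<le> b" if "i \<le> Suc n" "norm l \<le> b" for i l
    proof -
      have "norm ((real i / real (Suc n)) *\<^sub>R l) = (real i / real (Suc n)) * norm l" by simp
      also have "\<dots> \<le> 1 * b" using that by (intro mult_mono) (auto simp: divide_le_eq)
      finally show ?thesis by simp
    qed
    have "norm ((A ^^ Suc n) ((B ^^ Suc n) x) - (B ^^ Suc n) ((A ^^ Suc n) x)) \<le>
       \<Lambda>\<^sup>2 * (\<Sum>i<Suc n. \<Sum>j<Suc n. norm (A (B ((B ^^ j) ((A ^^ i) x))) - B (A ((B ^^ j) ((A ^^ i) x)))))"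
    proof (rule norm_commute_powers_le)
      show "norm ((A ^^ i) x - (A ^^ i) y) \<le> \<Lambda> * norm (x - y)" if "i \<le> Suc n" for i x y
        using flow_diff_le[OF small[OF that b(1)] b(3), of x _ y] unfolding A \<Lambda>_def
        by (metis diff_self mult_zero_right norm_zero add_0_right)
      show "norm ((B ^^ i) x - (B ^^ i) y) \<le> \<Lambda> * norm (x - y)" if "i \<le> Suc n" for i x y
        using flow_diff_le[OF small[OF that b(2)] b(3), of x _ y] unfolding B \<Lambda>_def
        by (metis diff_self mult_zero_right norm_zero add_0_right)
    qed (simp add: \<Lambda>_def)
    moreover have "(A ^^ Suc n) z = flow h z" "(B ^^ Suc n) z = flow k z" for z
      unfolding A B by simp_all
    ultimately show ?thesis
      by (simp only: H_def commutator_norm_def A B A_def[symmetric] B_def[symmetric])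
  qed
  have stay: "flow (s *\<^sub>R k) (flow (t *\<^sub>R h) x) \<in> ball x0 R" if "x \<in> ball x0 r" "0 \<le> s" "s \<le> 1" "0 \<le> t" "t \<le> 1" for s t x
  proof -
    have "norm (flow (s *\<^sub>R k) (flow (t *\<^sub>R h) x) - flow (t *\<^sub>R h) x) \<le> M * norm k"
      using flow_dist_le[of "s *\<^sub>R k" "flow (t *\<^sub>R h) x"] that M_pos
      by (smt (verit) mult_left_le_one_le mult_left_mono norm_ge_zero norm_scaleR)
    moreover have "norm (flow (t *\<^sub>R h) x - x) \<le> M * norm h"
      using flow_dist_le[of "t *\<^sub>R h" x] that M_pos
      by (smt (verit) mult_left_le_one_le mult_left_mono norm_ge_zero norm_scaleR)
    moreover have "norm (x - x0) < r" using that by (simp add: dist_norm norm_minus_commute)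
    moreover have "norm (flow (s *\<^sub>R k) (flow (t *\<^sub>R h) x) - x0) \<le>
        norm (flow (s *\<^sub>R k) (flow (t *\<^sub>R h) x) - flow (t *\<^sub>R h) x) + (norm (flow (t *\<^sub>R h) x - x) + norm (x - x0))"
      using norm_triangle_ineq[of "flow (s *\<^sub>R k) (flow (t *\<^sub>R h) x) - flow (t *\<^sub>R h) x" "flow (t *\<^sub>R h) x - x0"]
        norm_triangle_ineq[of "flow (t *\<^sub>R h) x - x" "x - x0"] by simp
    ultimately show ?thesis using r by (simp add: dist_norm norm_minus_commute)
  qed
  define G where "G x = norm (flow h (flow k x) - flow k (flow h x))" for x
  have contG: "continuous_on UNIV G" unfolding G_def by (intro continuous_intros)
  have measG [measurable]: "G \<in> borel_measurable borel"
    using contG by (rule borel_measurable_continuous_onI)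
  \<comment> \<open>A grid point depends on the start through two flows, each costing a factor
    \<open>K\<close> in the integral. All \<open>(Suc n)\<^sup>2\<close> terms are thus bounded by
    the same integral of \<open>F n\<close>.\<close>
  have bound: "(\<integral>\<^sup>+x. ennreal (G x) * indicator (ball x0 r) x \<partial>lborel) \<le>
      ennreal (\<Lambda>\<^sup>2) * (K * K) * (\<integral>\<^sup>+z. ennreal ((real (Suc n))\<^sup>2) * F n z \<partial>lborel)" for n
  proof -
    let ?p = "\<lambda>i j x. flow ((real j / real (Suc n)) *\<^sub>R k) (flow ((real i / real (Suc n)) *\<^sub>R h) x)"
    have mp [measurable]: "?p i j \<in> borel_measurable borel" for i j
      by (intro borel_measurable_continuous_onI continuous_intros)
    have "(\<integral>\<^sup>+x. ennreal (G x) * indicator (ball x0 r) x \<partial>lborel) \<le>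
        (\<integral>\<^sup>+x. ennreal (\<Lambda>\<^sup>2) * (\<Sum>i<Suc n. \<Sum>j<Suc n. F n (?p i j x)) \<partial>lborel)"
    proof (rule nn_integral_mono)
      fix x
      show "ennreal (G x) * indicator (ball x0 r) x \<le> ennreal (\<Lambda>\<^sup>2) * (\<Sum>i<Suc n. \<Sum>j<Suc n. F n (?p i j x))"
      proof (cases "x \<in> ball x0 r")
        case True
        have H0: "0 \<le> H n z" for z by (simp add: H_def commutator_norm_def)
        have "F n (?p i j x) = ennreal (H n (?p i j x))" if "i < Suc n" "j < Suc n" for i j
          using stay[OF True, of "real j / real (Suc n)" "real i / real (Suc n)"] that by (simp add: F_def)
        then have "(\<Sum>i<Suc n. \<Sum>j<Suc n. F n (?p i j x)) = ennreal (\<Sum>i<Suc n. \<Sum>j<Suc n. H n (?p i j x))"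
          using H0 by (simp add: sum_nonneg del: sum.lessThan_Suc)
        then have "ennreal (\<Lambda>\<^sup>2) * (\<Sum>i<Suc n. \<Sum>j<Suc n. F n (?p i j x)) = ennreal (\<Lambda>\<^sup>2 * (\<Sum>i<Suc n. \<Sum>j<Suc n. H n (?p i j x)))"
          using H0 by (simp only: ennreal_mult' zero_le_power2)
        then show ?thesis using le[of x n] True by (simp only: G_def indicator_simps mult_1_right ennreal_leI)
      qed simp
    qed
    also have "\<dots> = ennreal (\<Lambda>\<^sup>2) * (\<Sum>i<Suc n. \<Sum>j<Suc n. (\<integral>\<^sup>+x. F n (?p i j x) \<partial>lborel))"
    proof -
      have m: "(\<lambda>x. F n (?p i j x)) \<in> borel_measurable lborel" for i j by measurable
      have "(\<integral>\<^sup>+x. ennreal (\<Lambda>\<^sup>2) * (\<Sum>i<Suc n. \<Sum>j<Suc n. F n (?p i j x)) \<partial>lborel) =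
          ennreal (\<Lambda>\<^sup>2) * (\<integral>\<^sup>+x. (\<Sum>i<Suc n. \<Sum>j<Suc n. F n (?p i j x)) \<partial>lborel)"
        using m by (intro nn_integral_cmult borel_measurable_sum)
      also have "(\<integral>\<^sup>+x. (\<Sum>i<Suc n. \<Sum>j<Suc n. F n (?p i j x)) \<partial>lborel) = (\<Sum>i<Suc n. (\<integral>\<^sup>+x. (\<Sum>j<Suc n. F n (?p i j x)) \<partial>lborel))"
        using m by (intro nn_integral_sum borel_measurable_sum)
      also have "\<dots> = (\<Sum>i<Suc n. \<Sum>j<Suc n. (\<integral>\<^sup>+x. F n (?p i j x) \<partial>lborel))"
        using m by (intro sum.cong nn_integral_sum refl)
      finally show ?thesis .
    qed
    also have "\<dots> \<le> ennreal (\<Lambda>\<^sup>2) * (\<Sum>i<Suc n. \<Sum>j<Suc n. K * (K * (\<integral>\<^sup>+x. F n x \<partial>lborel)))"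
    proof (intro mult_left_mono sum_mono)
      fix i j assume ij: "i \<in> {..<Suc n}" "j \<in> {..<Suc n}"
      have small: "norm ((real i / real (Suc n)) *\<^sub>R l) \<le> b" if "i \<in> {..<Suc n}" "norm l \<le> b" for i l
      proof -
        have "norm ((real i / real (Suc n)) *\<^sub>R l) = (real i / real (Suc n)) * norm l" by simp
        also have "\<dots> \<le> 1 * b" using that by (intro mult_mono) (auto simp: divide_le_eq)
        finally show ?thesis by simp
      qed
      have "(\<integral>\<^sup>+x. F n (?p i j x) \<partial>lborel) \<le> K * (\<integral>\<^sup>+x. F n (flow ((real j / real (Suc n)) *\<^sub>R k) x) \<partial>lborel)"
        unfolding K_def \<Lambda>_def using small[OF ij(1) b(1)] b(3)
        by (intro nn_integral_flow_le) (auto intro!: borel_measurable_continuous_onI continuous_intros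
            measurable_compose[OF _ measF])
      also have "\<dots> \<le> K * (K * (\<integral>\<^sup>+x. F n x \<partial>lborel))"
        unfolding K_def \<Lambda>_def using small[OF ij(2) b(2)] b(3)
        by (intro mult_left_mono nn_integral_flow_le) auto
      finally show "(\<integral>\<^sup>+x. F n (?p i j x) \<partial>lborel) \<le> K * (K * (\<integral>\<^sup>+x. F n x \<partial>lborel))" .
    qed simp
    also have "\<dots> = ennreal (\<Lambda>\<^sup>2) * (K * K) * (ennreal ((real (Suc n))\<^sup>2) * (\<integral>\<^sup>+x. F n x \<partial>lborel))"
    proof -
      have eq: "(of_nat (Suc n) :: ennreal) * of_nat (Suc n) = ennreal ((real (Suc n))\<^sup>2)"
        by (simp only: ennreal_of_nat_eq_real_of_nat power2_eq_square ennreal_mult' of_nat_0_le_iff)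
      show ?thesis unfolding eq[symmetric] sum_constant card_lessThan by (simp only: mult_ac)
    qed
    also have "ennreal ((real (Suc n))\<^sup>2) * (\<integral>\<^sup>+x. F n x \<partial>lborel) = (\<integral>\<^sup>+z. ennreal ((real (Suc n))\<^sup>2) * F n z \<partial>lborel)"
      by (intro nn_integral_cmult[symmetric]) simp
    finally show ?thesis .
  qed
  \<comment> \<open>The number of grid cells balances the quadratic size of one commutator:
    domination is \<open>commutator_norm_le\<close>, and the pointwise limit vanishes wherever the
    bracket does.\<close>
  have lim: "(\<lambda>n. (\<integral>\<^sup>+z. ennreal ((real (Suc n))\<^sup>2) * F n z \<partial>lborel)) \<longlonglongrightarrow> (\<integral>\<^sup>+z. 0 \<partial>(lborel::'a measure))"
  proof (rule nn_integral_dominated_convergence[where w="\<lambda>z. ennreal (2 * L * M * (norm h + norm k)\<^sup>2) * indicator (ball x0 R) z"])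
    show "AE z in lborel. ennreal ((real (Suc n))\<^sup>2) * F n z \<le> ennreal (2 * L * M * (norm h + norm k)\<^sup>2) * indicator (ball x0 R) z" for n
    proof (intro AE_I2)
      fix z
      define a where "a = inverse (real (Suc n))"
      have "a > 0" by (simp add: a_def)
      have "H n z \<le> 2 * L * M * (norm (a *\<^sub>R h) + norm (a *\<^sub>R k))\<^sup>2"
        unfolding H_def a_def by (rule commutator_norm_le)
      also have "norm (a *\<^sub>R h) + norm (a *\<^sub>R k) = a * (norm h + norm k)"
        using \<open>a > 0\<close> by (simp add: distrib_left)
      finally have "(real (Suc n))\<^sup>2 * H n z \<le> (real (Suc n))\<^sup>2 * (2 * L * M * (a * (norm h + norm k))\<^sup>2)"
        by (intro mult_left_mono) auto
      also have "\<dots> = 2 * L * M * (norm h + norm k)\<^sup>2"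
        by (simp add: a_def power_mult_distrib power_inverse)
      finally have "ennreal ((real (Suc n))\<^sup>2) * ennreal (H n z) \<le> ennreal (2 * L * M * (norm h + norm k)\<^sup>2)"
        by (simp add: ennreal_mult'[symmetric] ennreal_leI)
      then show "ennreal ((real (Suc n))\<^sup>2) * F n z \<le> ennreal (2 * L * M * (norm h + norm k)\<^sup>2) * indicator (ball x0 R) z"
        by (auto simp: F_def indicator_def)
    qed
    show "(\<integral>\<^sup>+z. ennreal (2 * L * M * (norm h + norm k)\<^sup>2) * indicator (ball x0 R) z \<partial>lborel) < \<infinity>"
      by (subst nn_integral_cmult_indicator) (auto simp: ennreal_mult_less_top emeasure_lborel_ball_finite[unfolded infinity_ennreal_def])
    have "AE z in lebesgue. (\<lambda>n. ennreal ((real (Suc n))\<^sup>2) * F n z) \<longlonglongrightarrow> 0"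
      using D[of h] D[of k] sym
    proof eventually_elim
      case (elim z)
      show ?case
      proof (cases "z \<in> ball x0 R")
        case True
        then have "(\<lambda>n. (real (Suc n))\<^sup>2 * H n z) \<longlonglongrightarrow> 0"
          using elim unfolding H_def by (intro commutator_norm_tendsto[where Dh="D h z" and Dk="D k z"]) auto
        then have "(\<lambda>n. ennreal ((real (Suc n))\<^sup>2 * H n z)) \<longlonglongrightarrow> ennreal 0" by (rule tendsto_ennrealI)
        then show ?thesis using True by (simp add: F_def ennreal_mult' del: of_nat_Suc)
      qed (simp add: F_def)
    qed
    then show "AE z in lborel. (\<lambda>n. ennreal ((real (Suc n))\<^sup>2) * F n z) \<longlonglongrightarrow> 0"
      by (simp add: AE_completion_iff)
  qed (auto intro!: borel_measurable_times_ennreal borel_measurable_indicator)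
  have "(\<lambda>n. ennreal (\<Lambda>\<^sup>2) * (K * K) * (\<integral>\<^sup>+z. ennreal ((real (Suc n))\<^sup>2) * F n z \<partial>lborel)) \<longlonglongrightarrow> ennreal (\<Lambda>\<^sup>2) * (K * K) * 0"
    using lim by (intro ennreal_tendsto_cmult) (auto simp: K_def ennreal_mult_less_top)
  then have "(\<integral>\<^sup>+x. ennreal (G x) * indicator (ball x0 r) x \<partial>lborel) \<le> ennreal (\<Lambda>\<^sup>2) * (K * K) * 0"
    by (rule LIMSEQ_le_const) (use bound in blast)
  then have "(\<integral>\<^sup>+x. ennreal (G x) * indicator (ball x0 r) x \<partial>lborel) = 0" by simp
  then have "AE x in lborel. ennreal (G x) * indicator (ball x0 r) x = 0"
    by (subst (asm) nn_integral_0_iff_AE) (auto intro!: borel_measurable_times_ennreal borel_measurable_indicator measurable_compose[OF measG measurable_ennreal])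
  then have ae: "AE x in lborel. \<not> (x \<in> ball x0 r \<and> G x \<noteq> 0)"
    by eventually_elim (auto simp: G_def indicator_def)
  \<comment> \<open>The starting points at which the flows fail to commute form an open null set,
    hence none exist.\<close>
  have op: "open {x. x \<in> ball x0 r \<and> G x \<noteq> 0}"
  proof -
    have "open (ball x0 r \<inter> {x. G x \<noteq> 0})"
      using contG by (intro open_Int open_Collect_neq) auto
    then show ?thesis by (simp add: Int_def del: mem_ball)
  qed
  have "{x. x \<in> ball x0 r \<and> G x \<noteq> 0} \<in> null_sets lborel"
    using AE_iff_null_sets[of "{x. x \<in> ball x0 r \<and> G x \<noteq> 0}" lborel] ae op by simp
  then have "negligible {x. x \<in> ball x0 r \<and> G x \<noteq> 0}"
    using null_sets_completionI by (simp add: negligible_iff_null_sets)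
  then have "{x. x \<in> ball x0 r \<and> G x \<noteq> 0} = {}"
    using op open_not_negligible by blast
  then show ?thesis using x by (auto simp: G_def)
qed

text \<open>The curve \<open>\<lambda>s. flow (s *\<^sub>R h) (flow (s *\<^sub>R k) x)\<close> has
  velocity \<open>X (h + k)\<close>, because commutation moves the increment of the inner flow to
  the outside. Commutation is assumed only for the points met on the way, as it will hold only
  locally.\<close>

lemma flow_add_if_commute:
  assumes comm: "\<And>s t. 0 \<le> s \<Longrightarrow> s \<le> 1 \<Longrightarrow> \<bar>t\<bar> \<le> 1 \<Longrightarrow>
    flow (s *\<^sub>R h) (flow (t *\<^sub>R k) (flow (s *\<^sub>R k) x)) = flow (t *\<^sub>R k) (flow (s *\<^sub>R h) (flow (s *\<^sub>R k) x))"
  shows "flow (h + k) x = flow h (flow k x)"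
proof -
  have "flow (h + k) x = (\<lambda>s. flow (s *\<^sub>R h) (flow (s *\<^sub>R k) x)) 1"
  proof (rule flow_eqI)
    fix s :: real assume s: "0 \<le> s" "s \<le> 1"
    define y where "y = flow (s *\<^sub>R h) (flow (s *\<^sub>R k) x)"
    have eq: "flow ((s + t) *\<^sub>R h) (flow ((s + t) *\<^sub>R k) x) = flow (t *\<^sub>R h) (flow (t *\<^sub>R k) y)" if "\<bar>t\<bar> \<le> 1" for t
    proof -
      have "flow ((s + t) *\<^sub>R h) (flow ((s + t) *\<^sub>R k) x) = flow (t *\<^sub>R h) (flow (s *\<^sub>R h) (flow (t *\<^sub>R k) (flow (s *\<^sub>R k) x)))"
        by (simp only: add.commute[of s t] flow_add_scale)
      also have "flow (s *\<^sub>R h) (flow (t *\<^sub>R k) (flow (s *\<^sub>R k) x)) = flow (t *\<^sub>R k) y"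
        unfolding y_def using s that by (rule comm)
      finally show ?thesis .
    qed
    have "((\<lambda>s. flow (s *\<^sub>R h) (flow (s *\<^sub>R k) x)) has_derivative (\<lambda>t. t *\<^sub>R X (h + k) y)) (at s)"
    proof (rule has_derivative_if_quadratic[where d=1])
      fix t :: real assume t: "norm t < 1"
      define z where "z = flow (t *\<^sub>R k) y"
      have "flow ((s + t) *\<^sub>R h) (flow ((s + t) *\<^sub>R k) x) - y - t *\<^sub>R X (h + k) y =
          (flow (t *\<^sub>R h) z - z - X (t *\<^sub>R h) z) + (z - y - X (t *\<^sub>R k) y) + (X (t *\<^sub>R h) z - X (t *\<^sub>R h) y)"
        using t by (subst eq) (auto simp: z_def frame_simps algebra_simps)
      also have "norm \<dots> \<le> L * M * (norm (t *\<^sub>R h))\<^sup>2 + L * M * (norm (t *\<^sub>R k))\<^sup>2 + L * norm (t *\<^sub>R h) * (M * norm (t *\<^sub>R k))"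
      proof (intro norm_triangle_le add_mono)
        show "norm (flow (t *\<^sub>R h) z - z - X (t *\<^sub>R h) z) \<le> L * M * (norm (t *\<^sub>R h))\<^sup>2" by (rule flow_first_order)
        show "norm (z - y - X (t *\<^sub>R k) y) \<le> L * M * (norm (t *\<^sub>R k))\<^sup>2" unfolding z_def by (rule flow_first_order)
        have "norm (X (t *\<^sub>R h) z - X (t *\<^sub>R h) y) \<le> L * norm (t *\<^sub>R h) * norm (z - y)" by (rule frame_lipschitz)
        also have "\<dots> \<le> L * norm (t *\<^sub>R h) * (M * norm (t *\<^sub>R k))"
          unfolding z_def using L_pos by (intro mult_left_mono flow_dist_le) auto
        finally show "norm (X (t *\<^sub>R h) z - X (t *\<^sub>R h) y) \<le> L * norm (t *\<^sub>R h) * (M * norm (t *\<^sub>R k))" .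
      qed
      also have "\<dots> = (L * M * (norm h)\<^sup>2 + L * M * (norm k)\<^sup>2 + L * M * norm h * norm k) * (norm t)\<^sup>2"
        by (simp add: power_mult_distrib power2_eq_square algebra_simps)
      finally show "norm (flow ((s + t) *\<^sub>R h) (flow ((s + t) *\<^sub>R k) x) - flow (s *\<^sub>R h) (flow (s *\<^sub>R k) x) - t *\<^sub>R X (h + k) y)
          \<le> (L * M * (norm h)\<^sup>2 + L * M * (norm k)\<^sup>2 + L * M * norm h * norm k) * (norm t)\<^sup>2"
        by (simp add: y_def)
    qed (auto intro: bounded_linear_intros)
    then show "((\<lambda>s. flow (s *\<^sub>R h) (flow (s *\<^sub>R k) x)) has_vector_derivative X (h + k) (flow (s *\<^sub>R h) (flow (s *\<^sub>R k) x))) (at s)"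
      by (simp add: has_vector_derivative_def y_def)
  qed simp
  then show ?thesis by simp
qed

end

section \<open>The potential whose level sets are graphs\<close>

text \<open>\<open>X h z\<close> is the projection of \<open>h\<close> along \<open>e\<close> onto
  the hyperplane orthogonal to \<open>a z\<close>. The fields live on the whole space while
  commutation is local, so later statements carry radii.\<close>

locale graph_frame = lipschitz_frame X M L
  for X :: "'a::euclidean_space \<Rightarrow> 'a \<Rightarrow> 'a" and M L :: real +
  fixes e x0 :: 'a and a :: "'a \<Rightarrow> 'a" and \<rho> :: real
  assumes norm_e: "norm e = 1"
    and X_eq: "X h z = h - (a z \<bullet> h) *\<^sub>R e"
    and a_e: "a z \<bullet> e = 1"
    and rho_pos: "\<rho> > 0"
    and commute: "norm (x - x0) < \<rho> \<Longrightarrow> norm h < \<rho> \<Longrightarrow> norm k < \<rho> \<Longrightarrow> flow h (flow k x) = flow k (flow h x)"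
begin

definition proj :: "'a \<Rightarrow> 'a" where
  "proj v = v - (e \<bullet> v) *\<^sub>R e"

lemma e_e [simp]: "e \<bullet> e = 1"
  using norm_e by (simp add: norm_eq_1)

lemma proj_linear: "bounded_linear proj"
  unfolding proj_def by (intro bounded_linear_intros)

lemma proj_simps [simp]: "proj (v + w) = proj v + proj w" "proj (v - w) = proj v - proj w" "proj (c *\<^sub>R v) = c *\<^sub>R proj v"
  "proj e = 0" "proj 0 = 0" "proj (- v) = - proj v" "e \<bullet> proj v = 0" "proj (proj v) = proj v"
  by (simp_all add: proj_def inner_add_right inner_diff_right algebra_simps)

lemma proj_eq: "v = proj v + (e \<bullet> v) *\<^sub>R e"
  by (simp add: proj_def)

lemma proj_perp: "e \<bullet> v = 0 \<Longrightarrow> proj v = v"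
  by (simp add: proj_def)

lemma frame_e [simp]: "X e z = 0"
  by (simp add: X_eq a_e)

lemma proj_frame [simp]: "proj (X h z) = proj h"
  by (simp add: X_eq)

lemma frame_proj: "X (proj v) z = X v z"
  by (simp add: X_eq proj_def inner_diff_right a_e algebra_simps)

lemma flow_shift [simp]: "flow (h + t *\<^sub>R e) x = flow h x"
proof -
  have "X (h + t *\<^sub>R e) = X h" by (simp add: fun_eq_iff frame_simps)
  then show ?thesis by (simp add: flow_def)
qed

lemma flow_proj: "flow (proj h) x = flow h x"
  using flow_shift[of "proj h" "e \<bullet> h" x] by (simp flip: proj_eq)

lemma flow_cong_proj: "proj h = proj k \<Longrightarrow> flow h x = flow k x"
  by (metis flow_proj)

text \<open>The component orthogonal to \<open>e\<close> moves with constant velocity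
  \<open>proj h\<close>. Hence integral hypersurfaces are graphs, and the line through
  \<open>x0\<close> in direction \<open>e\<close> is reached in unit time.\<close>

lemma proj_flow [simp]: "proj (flow h x) = proj x + proj h"
proof -
  have d: "((\<lambda>t. proj (flow (t *\<^sub>R h) x) - t *\<^sub>R proj h) has_vector_derivative 0) (at t)" for t
  proof -
    have "((\<lambda>t. t *\<^sub>R proj h) has_vector_derivative proj h) (at t)"
      by (auto simp: has_vector_derivative_def intro!: derivative_eq_intros)
    from has_vector_derivative_diff[OF bounded_linear.has_vector_derivative[OF proj_linear flow_has_vector_derivative[of h x t]] this]
    show ?thesis by simp
  qed
  obtain c where c: "\<And>t. proj (flow (t *\<^sub>R h) x) - t *\<^sub>R proj h = c"
    by (rule has_vector_derivative_zero_constant[of UNIV "\<lambda>t. proj (flow (t *\<^sub>R h) x) - t *\<^sub>R proj h"]) (use d in auto)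
  show ?thesis using c[of 0] c[of 1] by (simp add: algebra_simps)
qed

text \<open>A start within \<open>\<rho>1\<close> of \<open>x0\<close> and a direction shorter than
  \<open>\<rho>1\<close> lead at most \<open>\<rho>1 + M * \<rho>1 = \<rho>\<close> away, still in
  the range of \<open>commute\<close>.\<close>

definition \<rho>1 :: real where "\<rho>1 = \<rho> / (1 + M)"

lemma \<rho>1: "\<rho>1 > 0" "\<rho>1 \<le> \<rho>" "\<rho>1 + M * \<rho>1 = \<rho>"
proof -
  have *: "\<rho>1 * (1 + M) = \<rho>" using M_pos by (simp add: \<rho>1_def)
  show "\<rho>1 > 0" using rho_pos M_pos by (simp add: \<rho>1_def)
  then have "M * \<rho>1 > 0" using M_pos by simp
  then show "\<rho>1 \<le> \<rho>" "\<rho>1 + M * \<rho>1 = \<rho>" using * by (auto simp: algebra_simps)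
qed

lemma flow_add:
  assumes x: "norm (x - x0) < \<rho>1" and h: "norm h < \<rho>1" and k: "norm k < \<rho>1"
  shows "flow (h + k) x = flow h (flow k x)"
proof (rule flow_add_if_commute)
  fix s t :: real assume st: "0 \<le> s" "s \<le> 1" "\<bar>t\<bar> \<le> 1"
  have small: "norm (s *\<^sub>R l) < \<rho>1" if "\<bar>s\<bar> \<le> 1" "norm l < \<rho>1" for s l
    using that by (simp add: le_less_trans[OF mult_left_le_one_le])
  have "norm (flow (s *\<^sub>R k) x - x) \<le> M * norm (s *\<^sub>R k)" by (rule flow_dist_le)
  also have "\<dots> < M * \<rho>1" using small[of s k] st k M_pos by (intro mult_strict_left_mono) auto
  finally have "norm (flow (s *\<^sub>R k) x - x0) < \<rho>"
    using x norm_triangle_ineq[of "flow (s *\<^sub>R k) x - x" "x - x0"] \<rho>1(3) by simp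
  moreover have "norm (s *\<^sub>R h) < \<rho>" "norm (t *\<^sub>R k) < \<rho>"
    using small[of s h] small[of t k] st h k \<rho>1(2) by auto
  ultimately show "flow (s *\<^sub>R h) (flow (t *\<^sub>R k) (flow (s *\<^sub>R k) x)) = flow (t *\<^sub>R k) (flow (s *\<^sub>R h) (flow (s *\<^sub>R k) x))"
    by (rule commute)
qed

text \<open>By additivity, a change of direction is a short flow started at \<open>flow h x\<close>,
  whose first-order expansion is known. The result contains \<open>X\<close> but no derivative of
  it.\<close>

lemma flow_has_derivative_left:
  assumes x: "norm (x - x0) < \<rho>1" and h: "norm h < \<rho>1"
  shows "((\<lambda>h. flow h x) has_derivative (\<lambda>k. X k (flow h x))) (at h)"
proof (rule has_derivative_if_quadratic[OF _ \<rho>1(1), where C="L * M"])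
  show "bounded_linear (\<lambda>k. X k (flow h x))"
    using linear_frame linear_conv_bounded_linear by blast
  fix k :: 'a assume "norm k < \<rho>1"
  then have "flow (h + k) x = flow k (flow h x)"
    using flow_add[OF x _ h, of k] by (simp add: add.commute)
  then show "norm (flow (h + k) x - flow h x - X k (flow h x)) \<le> L * M * (norm k)\<^sup>2"
    using flow_first_order by simp
qed

text \<open>The direction \<open>x0 - x\<close> cancels the offset of \<open>x\<close> orthogonal to
  \<open>e\<close>, so this flow ends on the axis through \<open>x0\<close>; the value is the
  coordinate there.\<close>

definition potential :: "'a \<Rightarrow> real" where
  "potential x = e \<bullet> (flow (x0 - x) x - x0)"

lemma flow_to_axis: "flow (x0 - x) x = x0 + potential x *\<^sub>R e"
proof -
  have "proj (flow (x0 - x) x - x0) = 0" by simp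
  then show ?thesis
    using proj_eq[of "flow (x0 - x) x - x0"] by (simp add: potential_def algebra_simps)
qed

lemma flow_from_axis: "flow (x - x0) (x0 + potential x *\<^sub>R e) = x"
  using flow_minus(2)[of "x - x0" x] by (simp add: flow_to_axis)

lemma flow_from_axis_proj [simp]: "flow (proj x - proj x0) (x0 + potential x *\<^sub>R e) = x"
  using flow_from_axis[of x] flow_proj[of "x - x0"] by simp

lemma potential_flow_axis: "potential (flow p (x0 + w *\<^sub>R e)) = w"
proof -
  have "flow (x0 - flow p (x0 + w *\<^sub>R e)) y = flow (- p) y" for y
    by (rule flow_cong_proj) simp
  then show ?thesis by (simp add: potential_def inner_diff_right)
qed

lemma potential_continuous: "continuous_on UNIV potential"
  unfolding potential_def by (intro continuous_intros)

lemma potential_lipschitz: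
  assumes "bounded S"
  shows "\<exists>C. C-lipschitz_on S potential"
proof -
  obtain b where b: "b > 0" "\<And>x. x \<in> S \<Longrightarrow> norm (x0 - x) \<le> b"
  proof -
    obtain b where "\<forall>x\<in>S. norm x \<le> b" using assms by (auto simp: bounded_iff)
    then have "norm (x0 - x) \<le> \<bar>b\<bar> + norm x0 + 1" if "x \<in> S" for x
      using that norm_triangle_ineq4[of x0 x] by fastforce
    moreover have "\<bar>b\<bar> + norm x0 + 1 > 0" by (simp add: add_nonneg_pos)
    ultimately show ?thesis using that by blast
  qed
  have "(exp (L * b + 1) * (1 + M))-lipschitz_on S potential"
  proof (rule lipschitz_onI)
    fix x y assume "x \<in> S" "y \<in> S"
    have "dist (potential x) (potential y) = \<bar>e \<bullet> (flow (x0 - x) x - flow (x0 - y) y)\<bar>"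
      by (simp add: potential_def dist_real_def inner_diff_right)
    also have "\<dots> \<le> norm e * norm (flow (x0 - x) x - flow (x0 - y) y)" by (rule Cauchy_Schwarz_ineq2)
    also have "\<dots> \<le> exp (L * b + 1) * (norm (x - y) + M * norm ((x0 - x) - (x0 - y)))"
      using flow_diff_le[OF b(2) b(1), of x x "x0 - y" y] \<open>x \<in> S\<close> by (simp add: norm_e)
    also have "\<dots> = exp (L * b + 1) * (1 + M) * dist x y"
      by (simp add: dist_norm norm_minus_commute algebra_simps)
    finally show "dist (potential x) (potential y) \<le> exp (L * b + 1) * (1 + M) * dist x y" .
  qed (use M_pos in auto)
  then show ?thesis by blast
qed

text \<open>The frame ignores \<open>e\<close>, so \<open>x\<close> and
  \<open>x + t *\<^sub>R e\<close> arise from their axis points by the same flow, of direction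
  \<open>x - x0\<close>; its Lipschitz constant is the factor.\<close>

lemma potential_expands_along_axis:
  "\<bar>t\<bar> \<le> exp (L * (norm (x - x0) + 1) + 1) * \<bar>potential (x + t *\<^sub>R e) - potential x\<bar>"
proof -
  have b: "norm (x - x0) \<le> norm (x - x0) + 1" "0 < norm (x - x0) + 1" by (simp_all add: add_nonneg_pos)
  have 1: "flow (x - x0) (x0 + potential (x + t *\<^sub>R e) *\<^sub>R e) = x + t *\<^sub>R e"
    using flow_from_axis[of "x + t *\<^sub>R e"] flow_cong_proj[of "x + t *\<^sub>R e - x0" "x - x0"] by simp
  have "\<bar>t\<bar> = norm (flow (x - x0) (x0 + potential (x + t *\<^sub>R e) *\<^sub>R e) - flow (x - x0) (x0 + potential x *\<^sub>R e))"
    unfolding 1 flow_from_axis using norm_e by simp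
  also have "\<dots> \<le> exp (L * (norm (x - x0) + 1) + 1) *
      (norm ((x0 + potential (x + t *\<^sub>R e) *\<^sub>R e) - (x0 + potential x *\<^sub>R e)) + M * norm ((x - x0) - (x - x0)))"
    by (rule flow_diff_le[OF b])
  also have "(x0 + potential (x + t *\<^sub>R e) *\<^sub>R e) - (x0 + potential x *\<^sub>R e) = (potential (x + t *\<^sub>R e) - potential x) *\<^sub>R e"
    by (simp add: scaleR_diff_left)
  finally show ?thesis using norm_e by simp
qed

text \<open>Injectivity and continuity along the line force strict monotonicity. Its sense is left
  open, as either one excludes an extremum.\<close>

lemma potential_monotone_along_axis:
  assumes "t > 0"
  shows "(potential (x - t *\<^sub>R e) < potential x \<and> potential x < potential (x + t *\<^sub>R e)) \<or>
    (potential (x + t *\<^sub>R e) < potential x \<and> potential x < potential (x - t *\<^sub>R e))"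
proof -
  let ?f = "\<lambda>t. potential (x + t *\<^sub>R e)"
  have "inj ?f"
  proof (rule injI)
    fix s t assume "?f s = ?f t"
    then have "\<bar>t - s\<bar> \<le> 0"
      using potential_expands_along_axis[of "t - s" "x + s *\<^sub>R e"] by (simp add: algebra_simps)
    then show "s = t" by simp
  qed
  moreover have "continuous_on UNIV ?f"
    by (rule continuous_on_compose2[OF potential_continuous]) (auto intro!: continuous_intros)
  ultimately have "(?f (- t) < ?f 0 \<and> ?f 0 < ?f t) \<or> (?f t < ?f 0 \<and> ?f 0 < ?f (- t))"
    using assms by (intro continuous_inj_imp_mono) (auto intro: continuous_on_subset inj_on_subset)
  then show ?thesis by simp
qed

lemma not_local_extremum:
  assumes "open V"
  shows "\<not> local_max_point V potential x" "\<not> local_min_point V potential x"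
proof -
  have ex: "\<exists>y z. y \<noteq> x \<and> z \<noteq> x \<and> y \<in> S \<and> z \<in> S \<and> potential y < potential x \<and> potential x < potential z"
    if S: "open S" "x \<in> S" for S
  proof -
    obtain d where d: "d > 0" "ball x d \<subseteq> S" using S open_contains_ball by blast
    let ?t = "d / 2"
    have "x + ?t *\<^sub>R e \<in> S" "x - ?t *\<^sub>R e \<in> S" "x + ?t *\<^sub>R e \<noteq> x" "x - ?t *\<^sub>R e \<noteq> x"
      using d norm_e by (auto simp: dist_norm intro!: subsetD[OF d(2)])
    then show ?thesis using potential_monotone_along_axis[of ?t x] d(1) by (meson half_gt_zero)
  qed
  have nb: "\<exists>S. open S \<and> x \<in> S \<and> (\<forall>y\<in>S. y \<noteq> x \<longrightarrow> P y)"
    if "\<forall>\<^sub>F y in at x within V. P y" "x \<in> V" for P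
  proof -
    obtain S where "open S" "x \<in> S" "\<forall>y\<in>S. y \<noteq> x \<longrightarrow> y \<in> V \<longrightarrow> P y"
      using \<open>\<forall>\<^sub>F y in at x within V. P y\<close> unfolding eventually_at_topological by blast
    then show ?thesis using \<open>open V\<close> \<open>x \<in> V\<close> by (intro exI[of _ "S \<inter> V"]) auto
  qed
  show "\<not> local_max_point V potential x"
    unfolding local_max_point_def using nb[of "\<lambda>y. potential y \<le> potential x"] ex by (meson not_le)
  show "\<not> local_min_point V potential x"
    unfolding local_min_point_def using nb[of "\<lambda>y. potential x \<le> potential y"] ex by (meson not_le)
qed

text \<open>A zero derivative would make the change along \<open>e\<close> smaller than the growth
  guaranteed by \<open>potential_expands_along_axis\<close>; half of the guaranteed rate is taken as
  the error.\<close>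

lemma potential_gradient_nonzero:
  assumes "GDERIV potential x :> D"
  shows "D \<noteq> 0"
proof
  assume "D = 0"
  then have d: "(potential has_derivative (\<lambda>h. 0)) (at x)" using assms by (simp add: gderiv_def)
  define C where "C = exp (L * (norm (x - x0) + 1) + 1)"
  have C: "C > 0" by (simp add: C_def)
  then have "1 / (2 * C) > 0" by simp
  then obtain d where d: "d > 0" "\<And>y. norm (y - x) < d \<Longrightarrow> norm (potential y - potential x - 0) \<le> 1 / (2 * C) * norm (y - x)"
    using d[unfolded has_derivative_at_alt, THEN conjunct2] by blast
  have "\<bar>potential (x + (d / 2) *\<^sub>R e) - potential x\<bar> \<le> 1 / (2 * C) * (d / 2)"
    using d(2)[of "x + (d / 2) *\<^sub>R e"] d(1) norm_e by simp
  then have "C * \<bar>potential (x + (d / 2) *\<^sub>R e) - potential x\<bar> \<le> C * (1 / (2 * C) * (d / 2))"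
    using C by (intro mult_left_mono) auto
  then have "\<bar>d / 2\<bar> \<le> C * (1 / (2 * C) * (d / 2))"
    using potential_expands_along_axis[of "d / 2" x] by (simp add: C_def)
  then show False using C d(1) by simp
qed

section \<open>Level sets as hypersurfaces\<close>

text \<open>A cylinder in the coordinates given by projection and potential, so that each level set
  is a graph over a full disc and one chart covers it.\<close>

definition tube :: "real \<Rightarrow> 'a set" where
  "tube \<sigma> = {x. norm (proj (x - x0)) < \<sigma> \<and> \<bar>potential x\<bar> < \<sigma>}"

lemma open_tube: "open (tube \<sigma>)"
  unfolding tube_def
  by (intro open_Collect_conj open_Collect_less continuous_intros potential_continuous bounded_linear.continuous_on[OF proj_linear])

lemma x0_in_tube: "\<sigma> > 0 \<Longrightarrow> x0 \<in> tube \<sigma>"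
  by (simp add: tube_def potential_def)

lemma tube_close: "x \<in> tube \<sigma> \<Longrightarrow> norm (x - x0) < (1 + M) * \<sigma>"
proof -
  assume x: "x \<in> tube \<sigma>"
  let ?z = "x0 + potential x *\<^sub>R e"
  have "norm (flow (proj (x - x0)) ?z - ?z) \<le> M * norm (proj (x - x0))" by (rule flow_dist_le)
  also have "\<dots> < M * \<sigma>" using x M_pos by (simp add: tube_def)
  finally have "norm (x - ?z) < M * \<sigma>" unfolding flow_proj flow_from_axis .
  moreover have "norm (?z - x0) < \<sigma>" using x norm_e by (simp add: tube_def)
  ultimately show ?thesis using norm_triangle_ineq[of "x - ?z" "?z - x0"] by (simp add: algebra_simps)
qed

lemma level_set_is_graph:
  assumes "\<bar>w\<bar> < \<sigma>"
  shows "{y \<in> tube \<sigma>. potential y = w} = (\<lambda>p. flow p (x0 + w *\<^sub>R e)) ` {p. e \<bullet> p = 0 \<and> norm p < \<sigma>}"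
proof (intro equalityI subsetI)
  fix y assume y: "y \<in> {y \<in> tube \<sigma>. potential y = w}"
  then have "y = flow (proj (y - x0)) (x0 + w *\<^sub>R e)" by auto
  then show "y \<in> (\<lambda>p. flow p (x0 + w *\<^sub>R e)) ` {p. e \<bullet> p = 0 \<and> norm p < \<sigma>}"
    using y by (intro image_eqI[of _ _ "proj (y - x0)"]) (auto simp: tube_def inner_diff_right)
next
  fix y assume "y \<in> (\<lambda>p. flow p (x0 + w *\<^sub>R e)) ` {p. e \<bullet> p = 0 \<and> norm p < \<sigma>}"
  then obtain p where "y = flow p (x0 + w *\<^sub>R e)" "e \<bullet> p = 0" "norm p < \<sigma>" by blast
  then show "y \<in> {y \<in> tube \<sigma>. potential y = w}"
    using assms by (simp add: tube_def potential_flow_axis proj_perp)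
qed

text \<open>The chart is the projection, with inverse
  \<open>\<lambda>p. flow p (x0 + w *\<^sub>R e)\<close>; both are restrictions of
  \<open>C\<^sup>k\<close> maps on open sets, as \<open>Ck_map\<close> asks.\<close>

lemma level_set_manifold:
  assumes w: "\<bar>w\<bar> < \<sigma>"
    and Ck: "Ck_on k (ball 0 \<sigma>) (\<lambda>p. flow p (x0 + w *\<^sub>R e))" and Ck_proj: "Ck_on k UNIV (\<lambda>y. proj (y - x0))"
  shows "Ck_manifold k (DIM('a) - 1) {y \<in> tube \<sigma>. potential y = w}"
proof -
  define S where "S = {y \<in> tube \<sigma>. potential y = w}"
  define W where "W = {p. e \<bullet> p = 0 \<and> norm p < \<sigma>}"
  define F where "F p = flow p (x0 + w *\<^sub>R e)" for p
  have S: "S = F ` W" unfolding S_def W_def F_def by (rule level_set_is_graph[OF w])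
  have "Ck_diffeomorphic k S W"
    unfolding Ck_diffeomorphic_def
  proof (intro exI conjI)
    show "homeomorphism S W (\<lambda>y. proj (y - x0)) F"
    proof (rule homeomorphismI)
      show "continuous_on S (\<lambda>y. proj (y - x0))"
        by (intro continuous_intros bounded_linear.continuous_on[OF proj_linear])
      show "continuous_on W F" unfolding F_def by (intro continuous_intros)
      show "(\<lambda>y. proj (y - x0)) ` S \<subseteq> W" by (auto simp: S_def tube_def W_def inner_diff_right)
      show "F ` W \<subseteq> S" by (simp add: S)
      show "F (proj (y - x0)) = y" if "y \<in> S" for y
        using that by (auto simp: F_def S_def)
      show "proj (F p - x0) = p" if "p \<in> W" for p
        using that by (simp add: F_def W_def proj_perp)
    qed
    show "Ck_map k S (\<lambda>y. proj (y - x0))"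
      unfolding Ck_map_def using Ck_proj by (intro ballI exI[of _ UNIV] exI[of _ "\<lambda>y. proj (y - x0)"]) auto
    show "Ck_map k W F"
      unfolding Ck_map_def using Ck by (intro ballI exI[of _ "ball 0 \<sigma>"] exI[of _ F]) (auto simp: F_def[abs_def] W_def)
  qed
  moreover have "subspace {p. e \<bullet> p = 0}" by (rule subspace_hyperplane)
  moreover have "dim {p. e \<bullet> p = 0} = DIM('a) - 1" using norm_e by (intro dim_hyperplane) auto
  moreover have "openin (top_of_set {p. e \<bullet> p = 0}) W"
    unfolding openin_open by (intro exI[of _ "ball 0 \<sigma>"]) (auto simp: W_def)
  ultimately have chart: "\<exists>E W. subspace E \<and> dim E = DIM('a) - 1 \<and> openin (top_of_set E) W \<and> Ck_diffeomorphic k S (W :: 'a set)"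
    by (intro exI conjI)
  have "openin (top_of_set S) S" by simp
  then show ?thesis
    unfolding Ck_manifold_def S_def[symmetric] by (intro ballI exI[of _ S] conjI chart)
qed

text \<open>A curve in the level set is the lift of its projection by
  \<open>\<lambda>p. flow p (x0 + w *\<^sub>R e)\<close>. Differentiating this at \<open>0\<close>
  gives \<open>v = X v x\<close>, and a vector fixed by the projection is orthogonal to
  \<open>a x\<close>.\<close>

lemma tangent_space_level_set:
  assumes \<sigma>: "\<sigma> \<le> \<rho>1" and w: "\<bar>w\<bar> < \<sigma>" and x: "x \<in> {y \<in> tube \<sigma>. potential y = w}"
    and v: "v \<in> tangent_space {y \<in> tube \<sigma>. potential y = w} x"
  shows "a x \<bullet> v = 0"
proof -
  obtain \<gamma> \<epsilon> where \<gamma>: "\<epsilon> > 0" "\<gamma> ` {-\<epsilon><..<\<epsilon>} \<subseteq> {y \<in> tube \<sigma>. potential y = w}" "\<gamma> 0 = x"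
    "(\<gamma> has_vector_derivative v) (at 0)"
    using v unfolding tangent_space_def by blast
  let ?F = "\<lambda>p. flow p (x0 + w *\<^sub>R e)"
  have F: "?F (proj (y - x0)) = y" if "y \<in> {y \<in> tube \<sigma>. potential y = w}" for y
    using that by auto
  have "(?F has_derivative (\<lambda>k. X k (?F (proj (x - x0))))) (at (proj (\<gamma> 0 - x0)))"
    unfolding \<gamma>(3) using x w \<sigma> norm_e by (intro flow_has_derivative_left) (auto simp: tube_def)
  moreover have "((\<lambda>s. proj (\<gamma> s - x0)) has_vector_derivative proj (v - 0)) (at 0)"
    by (intro bounded_linear.has_vector_derivative[OF proj_linear] has_vector_derivative_diff \<gamma>(4) has_vector_derivative_const)
  ultimately have "((\<lambda>s. ?F (proj (\<gamma> s - x0))) has_derivative (\<lambda>s. X (s *\<^sub>R proj (v - 0)) (?F (proj (x - x0))))) (at 0)"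
    unfolding has_vector_derivative_def by (rule has_derivative_compose[rotated])
  then have "((\<lambda>s. ?F (proj (\<gamma> s - x0))) has_derivative (\<lambda>s. s *\<^sub>R X (proj v) x)) (at 0)"
    using F[OF x] by (simp add: frame_simps)
  then have "(\<gamma> has_derivative (\<lambda>s. s *\<^sub>R X (proj v) x)) (at 0)"
    by (rule has_derivative_transform_within_open[where s="{-\<epsilon><..<\<epsilon>}"]) (use \<gamma>(1) F[OF subsetD[OF \<gamma>(2) imageI]] in simp_all)
  then have "(\<gamma> has_vector_derivative X (proj v) x) (at 0)" by (simp add: has_vector_derivative_def)
  then have "v = X (proj v) x" by (rule vector_derivative_unique_at[OF \<gamma>(4)])
  also have "\<dots> = X v x" by (rule frame_proj)
  finally have "X v x = v" by (rule sym)
  then have "v - X v x = 0" by (simp only: diff_self)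
  moreover have "v - X v x = (a x \<bullet> v) *\<^sub>R e" by (simp only: X_eq diff_diff_eq2 add_diff_cancel_left')
  ultimately have "(a x \<bullet> v) *\<^sub>R e = 0" by (rule trans[OF sym, rotated])
  then show ?thesis using norm_e by auto
qed

end

section \<open>Functions of class \<open>C\<^sup>k\<close>\<close>

lemma Ck_on_cong:
  assumes "open S" "\<And>x. x \<in> S \<Longrightarrow> f x = g x" "Ck_on k S f"
  shows "Ck_on k S g"
  using assms(2,3)
proof (induction k arbitrary: f g)
  case 0
  then show ?case by (simp cong: continuous_on_cong)
next
  case (Suc k)
  have g': "(g has_derivative frechet_derivative f (at x)) (at x)" if "x \<in> S" for x
    using Suc.prems that frechet_derivative_works[of f "at x"] has_derivative_transform_within_open[of f _ x UNIV S g] \<open>open S\<close>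
    by simp
  then have eq: "frechet_derivative f (at x) v = frechet_derivative g (at x) v" if "x \<in> S" for x v
    using that frechet_derivative_at by metis
  have "Ck_on k S (\<lambda>x. frechet_derivative g (at x) v)" for v
    by (rule Suc.IH[of "\<lambda>x. frechet_derivative f (at x) v"]) (use eq Suc.prems in auto)
  then show ?case using g' by (auto simp: differentiable_def)
qed

lemma Ck_on_SucI:
  assumes "open S" "\<And>x. x \<in> S \<Longrightarrow> (f has_derivative f' x) (at x)" "\<And>v. Ck_on k S (\<lambda>x. f' x v)"
  shows "Ck_on (Suc k) S f"
proof -
  have "f' x v = frechet_derivative f (at x) v" if "x \<in> S" for x v
    using frechet_derivative_at[OF assms(2)[OF that]] by simp
  then have "Ck_on k S (\<lambda>x. frechet_derivative f (at x) v)" for v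
    by (rule Ck_on_cong[OF \<open>open S\<close> _ assms(3)])
  then show ?thesis using assms(2) by (auto simp: differentiable_def)
qed

lemma Ck_on_SucE:
  assumes "Ck_on (Suc k) S f"
  obtains f' where "\<And>x. x \<in> S \<Longrightarrow> (f has_derivative f' x) (at x)" "\<And>v. Ck_on k S (\<lambda>x. f' x v)"
  using assms that[of "\<lambda>x. frechet_derivative f (at x)"] by (auto simp: frechet_derivative_works)

lemma Ck_on_imp_continuous_on: "Ck_on k S f \<Longrightarrow> continuous_on S f"
  by (cases k) (auto intro!: continuous_at_imp_continuous_on differentiable_imp_continuous_within)

lemma Ck_on_SucD: "Ck_on (Suc k) S f \<Longrightarrow> Ck_on k S f"
proof (induction k arbitrary: f)
  case 0
  then show ?case using Ck_on_imp_continuous_on[OF 0] by simp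
next
  case (Suc k)
  then show ?case by (simp only: Ck_on.simps(2)) blast
qed

lemma Ck_on_mono: "Ck_on k S f \<Longrightarrow> j \<le> k \<Longrightarrow> Ck_on j S f"
proof (induction k)
  case (Suc k)
  then show ?case using Ck_on_SucD by (metis le_Suc_eq)
qed simp

lemma Ck_on_subset: "Ck_on k T f \<Longrightarrow> S \<subseteq> T \<Longrightarrow> Ck_on k S f"
  by (induction k arbitrary: f) (auto intro: continuous_on_subset)

lemma Ck_on_const: "open S \<Longrightarrow> Ck_on k S (\<lambda>x. c)"
proof (induction k arbitrary: c)
  case (Suc k)
  show ?case by (rule Ck_on_SucI[where f'="\<lambda>x v. 0"]) (use Suc in auto)
qed simp

lemma Ck_on_bounded_linear: "open S \<Longrightarrow> bounded_linear l \<Longrightarrow> Ck_on k S l"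
proof (cases k)
  case (Suc j)
  assume "open S" "bounded_linear l"
  then show ?thesis
    unfolding Suc by (intro Ck_on_SucI[where f'="\<lambda>x. l"] bounded_linear_imp_has_derivative Ck_on_const)
qed (simp add: linear_continuous_on)

lemma Ck_on_add:
  assumes "open S" "Ck_on k S f" "Ck_on k S g"
  shows "Ck_on k S (\<lambda>x. f x + g x)"
  using assms(2,3)
proof (induction k arbitrary: f g)
  case (Suc k)
  from Suc.prems(1) obtain f' where f': "\<And>x. x \<in> S \<Longrightarrow> (f has_derivative f' x) (at x)" "\<And>v. Ck_on k S (\<lambda>x. f' x v)"
    by (rule Ck_on_SucE) blast
  from Suc.prems(2) obtain g' where g': "\<And>x. x \<in> S \<Longrightarrow> (g has_derivative g' x) (at x)" "\<And>v. Ck_on k S (\<lambda>x. g' x v)"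
    by (rule Ck_on_SucE) blast
  show ?case
    by (rule Ck_on_SucI[OF \<open>open S\<close> has_derivative_add[OF f'(1) g'(1)]]) (auto intro: Suc.IH f' g')
qed (auto intro: continuous_intros)

lemma Ck_on_sum:
  assumes "open S" "\<And>i. i \<in> I \<Longrightarrow> Ck_on k S (f i)"
  shows "Ck_on k S (\<lambda>x. \<Sum>i\<in>I. f i x)"
  using assms(2)
  by (induction I rule: infinite_finite_induct) (auto intro: Ck_on_const Ck_on_add \<open>open S\<close>)

lemma Ck_on_bilinear:
  fixes prod :: "'b::euclidean_space \<Rightarrow> 'c::euclidean_space \<Rightarrow> 'd::euclidean_space"
  assumes "bounded_bilinear prod" "open S" "Ck_on k S f" "Ck_on k S g"
  shows "Ck_on k S (\<lambda>x. prod (f x) (g x))"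
  using assms(3,4)
proof (induction k arbitrary: f g)
  case 0
  then show ?case using bounded_bilinear.continuous_on[OF assms(1)] by simp
next
  case (Suc k)
  from Suc.prems(1) obtain f' where f': "\<And>x. x \<in> S \<Longrightarrow> (f has_derivative f' x) (at x)" "\<And>v. Ck_on k S (\<lambda>x. f' x v)"
    by (rule Ck_on_SucE) blast
  from Suc.prems(2) obtain g' where g': "\<And>x. x \<in> S \<Longrightarrow> (g has_derivative g' x) (at x)" "\<And>v. Ck_on k S (\<lambda>x. g' x v)"
    by (rule Ck_on_SucE) blast
  show ?case
    by (rule Ck_on_SucI[OF \<open>open S\<close> bounded_bilinear.FDERIV[OF assms(1) f'(1) g'(1)]])
       (auto intro!: Ck_on_add Suc.IH f' g' \<open>open S\<close> Ck_on_SucD[OF Suc.prems(1)] Ck_on_SucD[OF Suc.prems(2)])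
qed

lemmas Ck_on_inner = Ck_on_bilinear[OF bounded_bilinear_inner]
  and Ck_on_scaleR = Ck_on_bilinear[OF bounded_bilinear_scaleR]
  and Ck_on_mult = Ck_on_bilinear[OF bounded_bilinear_mult[where 'a=real]]

lemma Ck_on_diff:
  assumes "open S" "Ck_on k S f" "Ck_on k S g"
  shows "Ck_on k S (\<lambda>x. f x - g x)"
  using Ck_on_add[OF assms(1,2) Ck_on_scaleR[OF assms(1) Ck_on_const[OF assms(1), of k "-1"] assms(3)]] by simp

text \<open>\<open>Ck_on\<close> speaks of derivatives in fixed directions, but the chain rule
  applies \<open>g' (f x)\<close> to the moving direction \<open>f' x v\<close>. Expanding the
  latter in \<open>Basis\<close> restores fixed directions.\<close>

lemma Ck_on_compose:
  fixes f :: "'a::euclidean_space \<Rightarrow> 'b::euclidean_space" and g :: "'b \<Rightarrow> 'c::euclidean_space"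
  assumes "open S" "open T" "Ck_on k T g" "Ck_on k S f" "f ` S \<subseteq> T"
  shows "Ck_on k S (\<lambda>x. g (f x))"
  using assms(3,4)
proof (induction k arbitrary: g)
  case 0
  then show ?case using assms(5) by (auto intro: continuous_on_compose2)
next
  case (Suc k)
  from Suc.prems(2) obtain f' where f': "\<And>x. x \<in> S \<Longrightarrow> (f has_derivative f' x) (at x)" "\<And>v. Ck_on k S (\<lambda>x. f' x v)"
    by (rule Ck_on_SucE) blast
  from Suc.prems(1) obtain g' where g': "\<And>x. x \<in> T \<Longrightarrow> (g has_derivative g' x) (at x)" "\<And>v. Ck_on k T (\<lambda>x. g' x v)"
    by (rule Ck_on_SucE) blast
  have fk: "Ck_on k S f" using Suc.prems(2) by (rule Ck_on_SucD)
  show ?case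
  proof (rule Ck_on_SucI[OF \<open>open S\<close>])
    show "((\<lambda>x. g (f x)) has_derivative (\<lambda>v. \<Sum>b\<in>Basis. (f' x v \<bullet> b) *\<^sub>R g' (f x) b)) (at x)" if "x \<in> S" for x
    proof -
      have fx: "f x \<in> T" using that assms(5) by blast
      have "g' (f x) w = (\<Sum>b\<in>Basis. (w \<bullet> b) *\<^sub>R g' (f x) b)" for w
      proof -
        have lin: "linear (g' (f x))" using g'(1)[OF fx] by (rule has_derivative_linear)
        have "g' (f x) w = g' (f x) (\<Sum>b\<in>Basis. (w \<bullet> b) *\<^sub>R b)" by (simp only: euclidean_representation)
        also have "\<dots> = (\<Sum>b\<in>Basis. (w \<bullet> b) *\<^sub>R g' (f x) b)" by (simp add: linear_sum[OF lin] linear_scale[OF lin])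
        finally show ?thesis .
      qed
      then have "g' (f x) = (\<lambda>w. \<Sum>b\<in>Basis. (w \<bullet> b) *\<^sub>R g' (f x) b)" by (rule ext)
      from has_derivative_compose[OF f'(1)[OF that] has_derivative_eq_rhs[OF g'(1)[OF fx] this]] show ?thesis .
    qed
    show "Ck_on k S (\<lambda>x. \<Sum>b\<in>Basis. (f' x v \<bullet> b) *\<^sub>R g' (f x) b)" for v
      by (rule Ck_on_sum[OF \<open>open S\<close>], rule Ck_on_scaleR[OF \<open>open S\<close>],
          rule Ck_on_inner[OF \<open>open S\<close> f'(2) Ck_on_const[OF \<open>open S\<close>]], rule Suc.IH[OF g'(2) fk])
  qed
qed

lemma Ck_on_inverse:
  fixes f :: "'a::euclidean_space \<Rightarrow> real"
  assumes "open S" "Ck_on k S f" "\<And>x. x \<in> S \<Longrightarrow> f x \<noteq> 0"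
  shows "Ck_on k S (\<lambda>x. inverse (f x))"
  using assms(2)
proof (induction k)
  case 0
  then show ?case using assms(3) by (auto intro: continuous_intros)
next
  case (Suc k)
  from Suc.prems obtain f' where f': "\<And>x. x \<in> S \<Longrightarrow> (f has_derivative f' x) (at x)" "\<And>v. Ck_on k S (\<lambda>x. f' x v)"
    by (rule Ck_on_SucE) blast
  have i: "Ck_on k S (\<lambda>x. inverse (f x))" by (rule Suc.IH[OF Ck_on_SucD[OF Suc.prems]])
  show ?case
  proof (rule Ck_on_SucI[OF \<open>open S\<close>])
    show "((\<lambda>x. inverse (f x)) has_derivative (\<lambda>v. (-1) * (inverse (f x) * f' x v * inverse (f x)))) (at x)" if "x \<in> S" for x
      using Deriv.has_derivative_inverse[OF assms(3)[OF that] f'(1)[OF that]] by simp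
    show "Ck_on k S (\<lambda>x. (-1) * (inverse (f x) * f' x v * inverse (f x)))" for v
      by (intro Ck_on_mult Ck_on_const f'(2) i \<open>open S\<close>)
  qed
qed

lemma Ck_on_exp:
  fixes f :: "'a::euclidean_space \<Rightarrow> real"
  assumes "open S" "Ck_on k S f"
  shows "Ck_on k S (\<lambda>x. exp (f x))"
  using assms(2)
proof (induction k)
  case 0
  then show ?case by (auto intro: continuous_intros)
next
  case (Suc k)
  from Suc.prems obtain f' where f': "\<And>x. x \<in> S \<Longrightarrow> (f has_derivative f' x) (at x)" "\<And>v. Ck_on k S (\<lambda>x. f' x v)"
    by (rule Ck_on_SucE) blast
  have i: "Ck_on k S (\<lambda>x. exp (f x))" by (rule Suc.IH[OF Ck_on_SucD[OF Suc.prems]])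
  show ?case
  proof (rule Ck_on_SucI[OF \<open>open S\<close>])
    show "((\<lambda>x. exp (f x)) has_derivative (\<lambda>v. f' x v * exp (f x))) (at x)" if "x \<in> S" for x
      using has_derivative_exp[OF f'(1)[OF that]] by simp
    show "Ck_on k S (\<lambda>x. f' x v * exp (f x))" for v
      by (intro Ck_on_mult f'(2) i \<open>open S\<close>)
  qed
qed

text \<open>For \<open>z = (h, x)\<close> this is the argument at which \<open>flow\<close> gives
  the position at time \<open>s\<close> on the curve from \<open>x\<close> in direction
  \<open>h\<close>.\<close>

definition contract_fst :: "real \<Rightarrow> 'a::euclidean_space \<times> 'b::euclidean_space \<Rightarrow> 'a \<times> 'b" where
  "contract_fst s z = (s *\<^sub>R fst z, snd z)"

text \<open>The powers of \<open>s\<close> make the statement stable under differentiation.\<close>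

lemma Ck_on_integral_contract:
  fixes \<beta> :: "'a::euclidean_space \<times> 'b::euclidean_space \<Rightarrow> real"
  assumes "open S" and star: "\<And>s z. z \<in> S \<Longrightarrow> 0 \<le> s \<Longrightarrow> s \<le> 1 \<Longrightarrow> contract_fst s z \<in> S"
    and "Ck_on k S \<beta>"
  shows "Ck_on k S (\<lambda>z. integral {0..1} (\<lambda>s. s ^ i * \<beta> (contract_fst s z)))"
  using assms(3)
proof (induction k arbitrary: \<beta> i)
  have cont: "continuous_on (S \<times> {0..1}) (\<lambda>(z, s). s ^ i * \<beta> (contract_fst s z))" if "continuous_on S \<beta>" for \<beta> :: "'a \<times> 'b \<Rightarrow> real" and i
  proof -
    have "continuous_on (S \<times> {0..1}) (\<lambda>p. contract_fst (snd p) (fst p))"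
      unfolding contract_fst_def by (intro continuous_intros)
    moreover have "(\<lambda>p. contract_fst (snd p) (fst p)) ` (S \<times> {0..1}) \<subseteq> S"
      by (rule image_subsetI) (simp add: mem_Times_iff star)
    ultimately have "continuous_on (S \<times> {0..1}) (\<lambda>p. \<beta> (contract_fst (snd p) (fst p)))"
      by (rule continuous_on_compose2[OF that])
    then show ?thesis unfolding split_beta by (intro continuous_intros)
  qed
  note cont_pow = this
  have slice: "continuous_on {0..1} (\<lambda>s. s ^ i * \<beta> (contract_fst s z))" if "continuous_on S \<beta>" "z \<in> S" for \<beta> :: "'a \<times> 'b \<Rightarrow> real" and i z
  proof -
    have p: "continuous_on {0..1} (\<lambda>s::real. (z, s))" by (intro continuous_on_Pair continuous_on_const continuous_on_id)
    have "(\<lambda>s. (z, s)) ` {0..1} \<subseteq> S \<times> {0..1::real}" using that(2) by auto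
    from continuous_on_compose2[OF cont_pow[OF that(1), of i] p this] show ?thesis by (simp only: prod.case)
  qed
  {
    case 0
    then show ?case
      using integral_continuous_on_param[of S 0 1 "\<lambda>z s. s ^ i * \<beta> (contract_fst s z)"] cont[of \<beta> i]
      by simp
  next
    case (Suc k)
    from Suc.prems obtain \<beta>' where \<beta>': "\<And>x. x \<in> S \<Longrightarrow> (\<beta> has_derivative \<beta>' x) (at x)" "\<And>v. Ck_on k S (\<lambda>x. \<beta>' x v)"
      by (rule Ck_on_SucE) blast
    have c\<beta>: "continuous_on S \<beta>" using Suc.prems by (rule Ck_on_imp_continuous_on)
    have c\<beta>': "continuous_on S (\<lambda>x. \<beta>' x v)" for v using \<beta>'(2) by (rule Ck_on_imp_continuous_on)
    define D where "D z s v = s ^ i * \<beta>' (contract_fst s z) (contract_fst s v)" for z s v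
    have blD: "bounded_linear (D z s)" if "z \<in> S" "0 \<le> s" "s \<le> 1" for z s
    proof -
      have "bounded_linear (contract_fst s :: 'a \<times> 'b \<Rightarrow> 'a \<times> 'b)"
        unfolding contract_fst_def by (intro bounded_linear_intros)
      then show ?thesis
        unfolding D_def
        by (rule bounded_linear_const_mult[OF bounded_linear_compose[OF has_derivative_bounded_linear[OF \<beta>'(1)[OF star[OF that]]]]])
    qed
    \<comment> \<open>The direction \<open>contract_fst s v\<close> still depends on
      \<open>s\<close>; the split leaves the fixed directions \<open>(fst v, 0)\<close> and
      \<open>(0, snd v)\<close>, to which the induction hypothesis applies.\<close>
    have D_split: "D z s v = s ^ Suc i * \<beta>' (contract_fst s z) (fst v, 0) + s ^ i * \<beta>' (contract_fst s z) (0, snd v)"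
      if "z \<in> S" "0 \<le> s" "s \<le> 1" for z s v
    proof -
      have lin: "linear (\<beta>' (contract_fst s z))" using has_derivative_linear[OF \<beta>'(1)[OF star[OF that]]] .
      have "contract_fst s v = s *\<^sub>R (fst v, 0) + (0, snd v)" by (simp add: contract_fst_def)
      then show ?thesis by (simp add: D_def linear_add[OF lin] linear_scale[OF lin] algebra_simps del: scaleR_Pair)
    qed
    have contD: "continuous_on (S \<times> {0..1}) (\<lambda>(z, s). D z s v)" for v
    proof -
      have "continuous_on (S \<times> {0..1}) (\<lambda>p. (case p of (z, s) \<Rightarrow> s ^ Suc i * \<beta>' (contract_fst s z) (fst v, 0)) +
          (case p of (z, s) \<Rightarrow> s ^ i * \<beta>' (contract_fst s z) (0, snd v)))"
        by (intro continuous_on_add cont_pow c\<beta>')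
      then show ?thesis by (rule continuous_on_eq) (auto simp: D_split)
    qed
    show ?case
    proof (rule Ck_on_SucI[OF \<open>open S\<close>])
      fix z0 assume z0: "z0 \<in> S"
      \<comment> \<open>Differentiation under the integral is carried out on a convex neighbourhood
        of \<open>z0\<close> inside \<open>S\<close>.\<close>
      obtain r where r: "r > 0" "ball z0 r \<subseteq> S" using \<open>open S\<close> z0 open_contains_ball by blast
      define U where "U = ball z0 r"
      have U: "z0 \<in> U" "convex U" "open U" "U \<subseteq> S" using r by (auto simp: U_def)
      define fx where "fx z s = Blinfun (D z s)" for z s
      have fx: "blinfun_apply (fx z s) v = D z s v" if "z \<in> S" "0 \<le> s" "s \<le> 1" for z s v
        unfolding fx_def using blD[OF that] by (simp add: bounded_linear_Blinfun_apply)
      have int: "(\<lambda>s. s ^ i * \<beta> (contract_fst s z)) integrable_on cbox 0 1" if "z \<in> S" for z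
        unfolding box_real by (rule integrable_continuous_real[OF slice[OF c\<beta> that]])
      have cfx: "continuous_on (U \<times> cbox 0 1) (\<lambda>(z, s). fx z s)"
      proof (rule continuous_on_blinfun_componentwise)
        fix v :: "'a \<times> 'b" assume "v \<in> Basis"
        have "continuous_on (U \<times> cbox 0 1) (\<lambda>(z, s). D z s v)"
          unfolding box_real using contD by (rule continuous_on_subset) (intro Sigma_mono U(4) order_refl)
        then show "continuous_on (U \<times> cbox 0 1) (\<lambda>x. blinfun_apply (case x of (z, s) \<Rightarrow> fx z s) v)"
        proof (rule continuous_on_eq)
          fix p :: "('a \<times> 'b) \<times> real" assume p: "p \<in> U \<times> cbox 0 1"
          obtain z s where "p = (z, s)" by (rule prod.exhaust)
          with p have "z \<in> S" "0 \<le> s" "s \<le> 1" using U(4) by auto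
          then show "(case p of (z, s) \<Rightarrow> D z s v) = blinfun_apply (case p of (z, s) \<Rightarrow> fx z s) v"
            using fx \<open>p = (z, s)\<close> by (simp only: prod.case)
        qed
      qed
      have d: "((\<lambda>z. integral (cbox 0 1) (\<lambda>s. s ^ i * \<beta> (contract_fst s z))) has_derivative blinfun_apply (integral (cbox 0 1) (fx z0))) (at z0 within U)"
      proof (rule leibniz_rule[where f="\<lambda>z s. s ^ i * \<beta> (contract_fst s z)" and fx=fx and U=U and a=0 and b=1, OF _ _ cfx U(1,2)])
        fix z s assume z: "z \<in> U" and "s \<in> cbox (0::real) 1"
        then have s: "0 \<le> s" "s \<le> 1" by auto
        have zS: "z \<in> S" using z U by blast
        have c: "(contract_fst s has_derivative contract_fst s) (at z)"
          unfolding contract_fst_def by (auto intro!: derivative_eq_intros)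
        have "((\<lambda>z. s ^ i * \<beta> (contract_fst s z)) has_derivative (\<lambda>v. s ^ i * \<beta>' (contract_fst s z) (contract_fst s v))) (at z)"
          by (intro has_derivative_mult_right has_derivative_compose[OF c \<beta>'(1)[OF star[OF zS s]]])
        moreover have "blinfun_apply (fx z s) = (\<lambda>v. s ^ i * \<beta>' (contract_fst s z) (contract_fst s v))"
          by (rule ext) (simp only: fx[OF zS s] D_def)
        ultimately have "((\<lambda>z. s ^ i * \<beta> (contract_fst s z)) has_derivative blinfun_apply (fx z s)) (at z)"
          by (simp only:)
        then show "((\<lambda>z. s ^ i * \<beta> (contract_fst s z)) has_derivative blinfun_apply (fx z s)) (at z within U)"
          by (rule has_derivative_at_withinI)
      next
        fix z assume "z \<in> U"
        then show "(\<lambda>s. s ^ i * \<beta> (contract_fst s z)) integrable_on cbox 0 1"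
          by (intro int subsetD[OF U(4)])
      qed
      have w: "at z0 within U = at z0" using U(1,3) by (rule at_within_open)
      have Jp: "blinfun_apply (integral (cbox 0 1) (fx z0)) v =
          integral {0..1} (\<lambda>s. s ^ Suc i * \<beta>' (contract_fst s z0) (fst v, 0)) + integral {0..1} (\<lambda>s. s ^ i * \<beta>' (contract_fst s z0) (0, snd v))" for v
      proof -
        have p: "continuous_on (cbox 0 1) (\<lambda>s::real. (z0, s))" by (intro continuous_on_Pair continuous_on_const continuous_on_id)
        have "(\<lambda>s. (z0, s)) ` cbox 0 1 \<subseteq> U \<times> cbox 0 (1::real)" using U(1) by auto
        from continuous_on_compose2[OF cfx p this] have "continuous_on (cbox 0 1) (fx z0)" by (simp only: prod.case)
        then have "fx z0 integrable_on cbox 0 1" by (rule integrable_continuous)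
        then have "blinfun_apply (integral (cbox 0 1) (fx z0)) v = integral (cbox 0 1) (\<lambda>s. blinfun_apply (fx z0 s) v)"
          by (rule blinfun_apply_integral)
        also have "\<dots> = integral {0..1} (\<lambda>s. s ^ Suc i * \<beta>' (contract_fst s z0) (fst v, 0) + s ^ i * \<beta>' (contract_fst s z0) (0, snd v))"
          unfolding box_real by (rule integral_cong) (simp only: fx[OF z0] D_split[OF z0] atLeastAtMost_iff)
        also have "\<dots> = integral {0..1} (\<lambda>s. s ^ Suc i * \<beta>' (contract_fst s z0) (fst v, 0)) + integral {0..1} (\<lambda>s. s ^ i * \<beta>' (contract_fst s z0) (0, snd v))"
        proof (rule integral_add)
          note slice[OF c\<beta>' z0]
          then show "(\<lambda>s. s ^ Suc i * \<beta>' (contract_fst s z0) (fst v, 0)) integrable_on {0..1}"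
            "(\<lambda>s. s ^ i * \<beta>' (contract_fst s z0) (0, snd v)) integrable_on {0..1}"
            by (intro integrable_continuous_real slice[OF c\<beta>' z0])+
        qed
        finally show ?thesis .
      qed
      have J: "blinfun_apply (integral (cbox 0 1) (fx z0)) = (\<lambda>v. integral {0..1} (\<lambda>s. s ^ Suc i * \<beta>' (contract_fst s z0) (fst v, 0)) + integral {0..1} (\<lambda>s. s ^ i * \<beta>' (contract_fst s z0) (0, snd v)))"
        by (rule ext) (rule Jp)
      with d w show "((\<lambda>z. integral {0..1} (\<lambda>s. s ^ i * \<beta> (contract_fst s z))) has_derivative
          (\<lambda>v. integral {0..1} (\<lambda>s. s ^ Suc i * \<beta>' (contract_fst s z0) (fst v, 0)) + integral {0..1} (\<lambda>s. s ^ i * \<beta>' (contract_fst s z0) (0, snd v)))) (at z0)"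
        by (simp only: box_real)
    next
      show "Ck_on k S (\<lambda>z0. integral {0..1} (\<lambda>s. s ^ Suc i * \<beta>' (contract_fst s z0) (fst v, 0)) + integral {0..1} (\<lambda>s. s ^ i * \<beta>' (contract_fst s z0) (0, snd v)))" for v
        by (rule Ck_on_add[OF \<open>open S\<close> Suc.IH[OF \<beta>'(2)] Suc.IH[OF \<beta>'(2)]])
    qed
  }
qed

section \<open>Smoothness of the flow\<close>

context graph_frame
begin

lemma flow_axis_shift: "flow h (x + t *\<^sub>R e) = flow h x + (e \<bullet> (flow h (x + t *\<^sub>R e) - flow h x)) *\<^sub>R e"
proof -
  have "proj (flow h (x + t *\<^sub>R e) - flow h x) = 0" by simp
  then show ?thesis using proj_eq[of "flow h (x + t *\<^sub>R e) - flow h x"] by simp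
qed

text \<open>Mean value theorem along \<open>e\<close>; the modulus of continuity of
  \<open>\<lambda>z. a' z e\<close> is uniform on a compact ball of radius strictly between
  \<open>R'\<close> and \<open>R\<close>.\<close>

lemma uniform_axis_derivative:
  assumes a': "\<And>z. z \<in> ball x0 R \<Longrightarrow> (a has_derivative a' z) (at z)"
    and ca': "continuous_on (ball x0 R) (\<lambda>z. a' z e)" and "R' < R" and "\<epsilon> > 0"
  shows "\<exists>\<delta>>0. \<forall>z r. norm (z - x0) \<le> R' \<longrightarrow> \<bar>r\<bar> < \<delta> \<longrightarrow> norm (a (z + r *\<^sub>R e) - a z - r *\<^sub>R a' z e) \<le> \<epsilon> * \<bar>r\<bar>"
proof -
  define R2 where "R2 = (R + R') / 2"
  have R2: "R' < R2" "R2 < R" using \<open>R' < R\<close> by (auto simp: R2_def)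
  have "uniformly_continuous_on (cball x0 R2) (\<lambda>z. a' z e)"
    using ca' R2 by (intro compact_uniformly_continuous) (auto intro: continuous_on_subset)
  then obtain d where d: "d > 0" "\<And>y z. y \<in> cball x0 R2 \<Longrightarrow> z \<in> cball x0 R2 \<Longrightarrow> dist z y < d \<Longrightarrow> dist (a' z e) (a' y e) < \<epsilon>"
    using \<open>\<epsilon> > 0\<close> unfolding uniformly_continuous_on_def by metis
  define \<delta> where "\<delta> = min d (R2 - R')"
  have "\<delta> > 0" using d R2 by (simp add: \<delta>_def)
  moreover have "norm (a (z + r *\<^sub>R e) - a z - r *\<^sub>R a' z e) \<le> \<epsilon> * \<bar>r\<bar>" if z: "norm (z - x0) \<le> R'" and r: "\<bar>r\<bar> < \<delta>" for z r
  proof -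
    have near: "z + t *\<^sub>R e \<in> cball x0 R2" "dist (z + t *\<^sub>R e) z < d" if "\<bar>t\<bar> \<le> \<bar>r\<bar>" for t
    proof -
      show "dist (z + t *\<^sub>R e) z < d" using that r norm_e by (simp add: dist_norm \<delta>_def)
      have "norm (z + t *\<^sub>R e - x0) \<le> norm (z - x0) + \<bar>t\<bar>"
        using norm_triangle_ineq[of "z - x0" "t *\<^sub>R e"] norm_e by (simp add: algebra_simps)
      then show "z + t *\<^sub>R e \<in> cball x0 R2" using z r that by (simp add: dist_norm norm_minus_commute \<delta>_def)
    qed
    have zin: "z \<in> cball x0 R2" using near(1)[of 0] by simp
    have lin: "linear (a' y)" if "y \<in> cball x0 R2" for y
      using a'[of y] that R2 has_derivative_linear by fastforce
    have "norm ((\<lambda>t. a (z + t *\<^sub>R e) - t *\<^sub>R a' z e) r - (\<lambda>t. a (z + t *\<^sub>R e) - t *\<^sub>R a' z e) 0) \<le> \<epsilon> * norm (r - 0)"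
    proof (rule differentiable_bound[of "cball 0 \<bar>r\<bar>" _ "\<lambda>t s. s *\<^sub>R (a' (z + t *\<^sub>R e) e - a' z e)"])
      fix t :: real assume "t \<in> cball 0 \<bar>r\<bar>"
      then have t: "\<bar>t\<bar> \<le> \<bar>r\<bar>" by simp
      have in_ball: "z + t *\<^sub>R e \<in> ball x0 R" using near(1)[OF t] R2 by auto
      have "((\<lambda>t. z + t *\<^sub>R e) has_derivative (\<lambda>s. s *\<^sub>R e)) (at t)" by (auto intro!: derivative_eq_intros)
      from has_derivative_compose[OF this a'[OF in_ball]]
      have "((\<lambda>t. a (z + t *\<^sub>R e)) has_derivative (\<lambda>s. s *\<^sub>R a' (z + t *\<^sub>R e) e)) (at t)"
        by (simp add: linear_scale[OF lin[OF near(1)[OF t]]])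
      moreover have "((\<lambda>t. t *\<^sub>R a' z e) has_derivative (\<lambda>s. s *\<^sub>R a' z e)) (at t)" by (auto intro!: derivative_eq_intros)
      ultimately have "((\<lambda>t. a (z + t *\<^sub>R e) - t *\<^sub>R a' z e) has_derivative (\<lambda>s. s *\<^sub>R a' (z + t *\<^sub>R e) e - s *\<^sub>R a' z e)) (at t)"
        by (rule has_derivative_diff)
      then show "((\<lambda>t. a (z + t *\<^sub>R e) - t *\<^sub>R a' z e) has_derivative (\<lambda>s. s *\<^sub>R (a' (z + t *\<^sub>R e) e - a' z e))) (at t within cball 0 \<bar>r\<bar>)"
        by (simp add: scaleR_diff_right has_derivative_at_withinI)
      have "norm (a' (z + t *\<^sub>R e) e - a' z e) \<le> \<epsilon>"
        using d(2)[OF zin near(1)[OF t] near(2)[OF t]] by (simp add: dist_norm)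
      then show "onorm (\<lambda>s. s *\<^sub>R (a' (z + t *\<^sub>R e) e - a' z e)) \<le> \<epsilon>"
        using \<open>\<epsilon> > 0\<close> by (intro onorm_bound) (auto simp: mult.commute[of \<epsilon>] intro: mult_left_mono)
    qed auto
    then show ?thesis by (simp add: algebra_simps)
  qed
  ultimately show ?thesis by blast
qed

text \<open>A perturbation along \<open>e\<close> leaves the projection of the curve unchanged, so
  the perturbed curve differs by a scalar multiple \<open>\<delta>\<close> of \<open>e\<close>,
  which to first order decays at the rate \<open>b\<close>. Multiplication by
  \<open>exp (B s)\<close> makes it constant up to an error small relative to
  \<open>t\<close>.\<close>

lemma flow_has_derivative_axis:
  assumes a': "\<And>z. z \<in> ball x0 R \<Longrightarrow> (a has_derivative a' z) (at z)"
    and ca': "continuous_on (ball x0 R) (\<lambda>z. a' z e)" and "R' < R"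
    and stay: "\<And>s. 0 \<le> s \<Longrightarrow> s \<le> 1 \<Longrightarrow> norm (flow (s *\<^sub>R h) x - x0) \<le> R'"
  shows "((\<lambda>t. flow h (x + t *\<^sub>R e)) has_derivative
    (\<lambda>t. (t * exp (- integral {0..1} (\<lambda>s. a' (flow (s *\<^sub>R h) x) e \<bullet> h))) *\<^sub>R e)) (at 0)"
proof -
  define y where "y s = flow (s *\<^sub>R h) x" for s
  define \<delta> where "\<delta> t s = e \<bullet> (flow (s *\<^sub>R h) (x + t *\<^sub>R e) - y s)" for t s
  have \<delta>: "flow (s *\<^sub>R h) (x + t *\<^sub>R e) = y s + \<delta> t s *\<^sub>R e" for s t
    unfolding y_def \<delta>_def by (rule flow_axis_shift)
  define b where "b s = a' (y s) e \<bullet> h" for s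
  have y_in: "y s \<in> ball x0 R" if "s \<in> {0..1}" for s
    using stay[of s] that \<open>R' < R\<close> by (simp add: y_def dist_norm norm_minus_commute)
  have cy: "continuous_on {0..1} y" unfolding y_def by (intro continuous_intros)
  have cb: "continuous_on {0..1} b"
    unfolding b_def by (intro continuous_intros continuous_on_compose2[OF ca' cy]) (use y_in in auto)
  define B where "B s = integral {0..s} b" for s
  have B': "(B has_real_derivative b s) (at s within {0..1})" if "s \<in> {0..1}" for s
    unfolding B_def by (rule integral_has_real_derivative[OF cb that])
  have cB: "continuous_on {0..1} (\<lambda>s. exp (B s))"
    using B' by (intro continuous_intros) (meson DERIV_continuous continuous_on_eq_continuous_within)
  obtain E where E: "E > 0" "\<And>s. s \<in> {0..1} \<Longrightarrow> exp (B s) \<le> E"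
  proof -
    obtain s0 where "s0 \<in> {0..1}" "\<And>s. s \<in> {0..1} \<Longrightarrow> exp (B s) \<le> exp (B s0)"
      using continuous_attains_sup[OF _ _ cB] by auto
    then show ?thesis using that[of "exp (B s0)"] by simp
  qed
  define \<Lambda> where "\<Lambda> = exp (L * (norm h + 1) + 1)"
  have \<Lambda>: "\<Lambda> > 0" by (simp add: \<Lambda>_def)
  have \<delta>_le: "\<bar>\<delta> t s\<bar> \<le> \<Lambda> * \<bar>t\<bar>" if "s \<in> {0..1}" for s t
  proof -
    have "norm (s *\<^sub>R h) \<le> norm h" using that by (simp add: mult_left_le_one_le)
    then have "norm (flow (s *\<^sub>R h) (x + t *\<^sub>R e) - flow (s *\<^sub>R h) x) \<le> \<Lambda> * (norm (x + t *\<^sub>R e - x) + M * norm (s *\<^sub>R h - s *\<^sub>R h))"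
      unfolding \<Lambda>_def by (intro flow_diff_le) (auto simp: add_nonneg_pos)
    then show ?thesis unfolding \<delta> y_def[symmetric] using norm_e by simp
  qed
  have \<delta>': "((\<lambda>s. \<delta> t s) has_real_derivative - ((a (y s + \<delta> t s *\<^sub>R e) - a (y s)) \<bullet> h)) (at s)" for t s
  proof -
    have "((\<lambda>s. flow (s *\<^sub>R h) (x + t *\<^sub>R e) - y s) has_vector_derivative X h (flow (s *\<^sub>R h) (x + t *\<^sub>R e)) - X h (y s)) (at s)"
      unfolding y_def by (intro has_vector_derivative_diff flow_has_vector_derivative)
    then have "((\<lambda>s. \<delta> t s) has_vector_derivative e \<bullet> (X h (flow (s *\<^sub>R h) (x + t *\<^sub>R e)) - X h (y s))) (at s)"
      unfolding \<delta>_def by (rule bounded_linear.has_vector_derivative[OF bounded_linear_inner_right])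
    moreover have "e \<bullet> (X h (flow (s *\<^sub>R h) (x + t *\<^sub>R e)) - X h (y s)) = - ((a (y s + \<delta> t s *\<^sub>R e) - a (y s)) \<bullet> h)"
      unfolding \<delta> X_eq by (simp add: inner_diff_right inner_diff_left)
    ultimately show ?thesis by (simp add: has_real_derivative_iff_has_vector_derivative)
  qed
  have \<delta>0: "\<delta> t 0 = t" for t by (simp add: \<delta>_def y_def)
  have B0: "B 0 = 0" by (simp add: B_def)
  define m where "m = exp (- B 1)"
  have main: "\<exists>d>0. \<forall>t. \<bar>t\<bar> < d \<longrightarrow> \<bar>\<delta> t 1 - t * m\<bar> \<le> \<epsilon> * \<bar>t\<bar>" if "\<epsilon> > 0" for \<epsilon>
  proof -
    \<comment> \<open>The denominator collects the later factors: \<open>m\<close> from undoing the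
      weight, \<open>\<Lambda>\<close> from the bound on \<open>\<delta>\<close>, \<open>E\<close>
      from the bound on \<open>exp (B s)\<close>, and \<open>norm h\<close>, with \<open>+ 1\<close>
      against division by zero.\<close>
    define \<epsilon>' where "\<epsilon>' = \<epsilon> / (m * \<Lambda> * E * (norm h + 1))"
    have pos: "m * \<Lambda> * E * (norm h + 1) > 0"
      using \<Lambda> E by (intro mult_pos_pos) (auto simp: m_def add_nonneg_pos)
    have "\<epsilon>' > 0" using that pos by (simp add: \<epsilon>'_def)
    then obtain r where r: "r > 0" "\<And>z q. norm (z - x0) \<le> R' \<Longrightarrow> \<bar>q\<bar> < r \<Longrightarrow> norm (a (z + q *\<^sub>R e) - a z - q *\<^sub>R a' z e) \<le> \<epsilon>' * \<bar>q\<bar>"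
      using uniform_axis_derivative[OF a' ca' \<open>R' < R\<close>, of \<epsilon>'] by blast
    have "\<bar>\<delta> t 1 - t * m\<bar> \<le> \<epsilon> * \<bar>t\<bar>" if t: "\<bar>t\<bar> < r / \<Lambda>" for t
    proof -
      have "norm ((\<lambda>s. \<delta> t s * exp (B s)) 1 - (\<lambda>s. \<delta> t s * exp (B s)) 0) \<le> (\<epsilon>' * (\<Lambda> * \<bar>t\<bar>) * norm h * E) * norm (1 - 0 :: real)"
      proof (rule field_differentiable_bound[of "{0..1}" _ "\<lambda>s. (- ((a (y s + \<delta> t s *\<^sub>R e) - a (y s) - \<delta> t s *\<^sub>R a' (y s) e) \<bullet> h)) * exp (B s)"])
        fix s :: real assume s: "s \<in> {0..1}"
        show "((\<lambda>s. \<delta> t s * exp (B s)) has_real_derivative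
            (- ((a (y s + \<delta> t s *\<^sub>R e) - a (y s) - \<delta> t s *\<^sub>R a' (y s) e) \<bullet> h)) * exp (B s)) (at s within {0..1})"
          by (rule derivative_eq_intros has_field_derivative_at_within[OF \<delta>'] B'[OF s] refl)+
             (simp add: b_def inner_diff_left algebra_simps)
        have "\<Lambda> * \<bar>t\<bar> < r" using t \<Lambda> by (simp add: pos_less_divide_eq mult.commute)
        then have "\<bar>\<delta> t s\<bar> < r" using \<delta>_le[OF s, of t] by simp
        then have "norm (a (y s + \<delta> t s *\<^sub>R e) - a (y s) - \<delta> t s *\<^sub>R a' (y s) e) \<le> \<epsilon>' * \<bar>\<delta> t s\<bar>"
          using stay[of s] s by (intro r(2)) (auto simp: y_def)
        also have "\<dots> \<le> \<epsilon>' * (\<Lambda> * \<bar>t\<bar>)" using \<delta>_le[OF s] \<open>\<epsilon>' > 0\<close> by (intro mult_left_mono) auto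
        finally have n: "norm (a (y s + \<delta> t s *\<^sub>R e) - a (y s) - \<delta> t s *\<^sub>R a' (y s) e) \<le> \<epsilon>' * (\<Lambda> * \<bar>t\<bar>)" .
        have "\<bar>(a (y s + \<delta> t s *\<^sub>R e) - a (y s) - \<delta> t s *\<^sub>R a' (y s) e) \<bullet> h\<bar> \<le> \<epsilon>' * (\<Lambda> * \<bar>t\<bar>) * norm h"
          using Cauchy_Schwarz_ineq2[of "a (y s + \<delta> t s *\<^sub>R e) - a (y s) - \<delta> t s *\<^sub>R a' (y s) e" h]
            mult_right_mono[OF n norm_ge_zero[of h]] by linarith
        then have "\<bar>(a (y s + \<delta> t s *\<^sub>R e) - a (y s) - \<delta> t s *\<^sub>R a' (y s) e) \<bullet> h\<bar> * exp (B s) \<le> \<epsilon>' * (\<Lambda> * \<bar>t\<bar>) * norm h * E"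
          using E(2)[OF s] \<open>\<epsilon>' > 0\<close> \<Lambda> by (intro mult_mono) auto
        then show "norm (- ((a (y s + \<delta> t s *\<^sub>R e) - a (y s) - \<delta> t s *\<^sub>R a' (y s) e) \<bullet> h) * exp (B s)) \<le> \<epsilon>' * (\<Lambda> * \<bar>t\<bar>) * norm h * E"
          by (simp add: abs_mult)
      qed auto
      then have "\<bar>\<delta> t 1 * exp (B 1) - t\<bar> \<le> \<epsilon>' * (\<Lambda> * \<bar>t\<bar>) * norm h * E" by (simp add: \<delta>0 B0)
      then have "m * \<bar>\<delta> t 1 * exp (B 1) - t\<bar> \<le> m * (\<epsilon>' * (\<Lambda> * \<bar>t\<bar>) * norm h * E)"
        by (intro mult_left_mono) (auto simp: m_def)
      also have "m * \<bar>\<delta> t 1 * exp (B 1) - t\<bar> = \<bar>m * (\<delta> t 1 * exp (B 1) - t)\<bar>"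
        by (simp add: abs_mult m_def)
      also have "m * (\<delta> t 1 * exp (B 1) - t) = \<delta> t 1 - t * m"
        by (simp add: m_def exp_minus field_simps)
      also have "m * (\<epsilon>' * (\<Lambda> * \<bar>t\<bar>) * norm h * E) = \<epsilon>' * (m * \<Lambda> * E * norm h) * \<bar>t\<bar>" by (simp add: mult_ac)
      also have "\<dots> \<le> \<epsilon>' * (m * \<Lambda> * E * (norm h + 1)) * \<bar>t\<bar>"
        using \<open>\<epsilon>' > 0\<close> \<Lambda> E by (intro mult_right_mono mult_left_mono) (auto simp: m_def)
      also have "\<epsilon>' * (m * \<Lambda> * E * (norm h + 1)) = \<epsilon>"
        by (rule nonzero_eq_divide_eq[THEN iffD1, OF _ \<epsilon>'_def]) (use pos in linarith)
      finally show ?thesis .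
    qed
    then show ?thesis using r(1) \<Lambda> by (intro exI[of _ "r / \<Lambda>"]) auto
  qed
  have diff: "flow h (x + t *\<^sub>R e) - flow h x = \<delta> t 1 *\<^sub>R e" for t
    using \<delta>[of 1 t] by (simp add: y_def)
  have m_eq: "m = exp (- integral {0..1} (\<lambda>s. a' (flow (s *\<^sub>R h) x) e \<bullet> h))"
    by (simp add: m_def B_def b_def[abs_def] y_def)
  show ?thesis
    unfolding m_eq[symmetric] has_derivative_at_alt
  proof (intro conjI allI impI)
    show "bounded_linear (\<lambda>t. (t * m) *\<^sub>R e)" by (intro bounded_linear_intros)
    fix \<epsilon> :: real assume "\<epsilon> > 0"
    then obtain d where d: "d > 0" "\<And>t. \<bar>t\<bar> < d \<Longrightarrow> \<bar>\<delta> t 1 - t * m\<bar> \<le> \<epsilon> * \<bar>t\<bar>" using main by blast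
    have "norm (flow h (x + t *\<^sub>R e) - flow h (x + 0 *\<^sub>R e) - ((t - 0) * m) *\<^sub>R e) \<le> \<epsilon> * norm (t - 0)" if "norm (t - 0) < d" for t
    proof -
      have "flow h (x + t *\<^sub>R e) - flow h (x + 0 *\<^sub>R e) - ((t - 0) * m) *\<^sub>R e = (\<delta> t 1 - t * m) *\<^sub>R e"
        using diff[of t] by (simp add: scaleR_diff_left)
      then show ?thesis using d(2)[of t] that norm_e by simp
    qed
    then show "\<exists>d>0. \<forall>t. norm (t - 0) < d \<longrightarrow> norm (flow h (x + t *\<^sub>R e) - flow h (x + 0 *\<^sub>R e) - ((t - 0) * m) *\<^sub>R e) \<le> \<epsilon> * norm (t - 0)"
      using d(1) by blast
  qed
qed

text \<open>The remainder \<open>r\<close> is quadratic, by the first-order estimate and the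
  Lipschitz bound on \<open>X\<close>; what is left is a sum of functions of one variable with known
  derivatives.\<close>

lemma flow_of_axis_point_has_derivative:
  assumes c: "((\<lambda>t. flow h (x + t *\<^sub>R e)) has_derivative c') (at 0)"
  shows "((\<lambda>p. flow (fst p) (flow h (x + snd p *\<^sub>R e))) has_derivative (\<lambda>q. X (fst q) (flow h x) + c' (snd q))) (at (0, 0))"
proof -
  let ?c = "\<lambda>t. flow h (x + t *\<^sub>R e)"
  define r where "r p = flow (fst p) (?c (snd p)) - ?c (snd p) - X (fst p) (?c 0)" for p
  define \<Lambda> where "\<Lambda> = exp (L * (norm h + 1) + 1)"
  have "(r has_derivative (\<lambda>q. 0)) (at (0, 0))"
  proof (rule has_derivative_if_quadratic[where d=1 and C="L * M + L * \<Lambda>"])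
    fix p :: "'a \<times> real"
    have n: "norm (fst p) \<le> norm p" "\<bar>snd p\<bar> \<le> norm p"
      using norm_fst_le[of "fst p" "snd p"] norm_snd_le[of "snd p" "fst p"] by simp_all
    have "norm (?c (snd p) - ?c 0) \<le> \<Lambda> * (norm (x + snd p *\<^sub>R e - (x + 0 *\<^sub>R e)) + M * norm (h - h))"
      unfolding \<Lambda>_def by (rule flow_diff_le) (auto simp: add_nonneg_pos)
    then have cc: "norm (?c (snd p) - ?c 0) \<le> \<Lambda> * \<bar>snd p\<bar>" using norm_e by simp
    have "r p = (flow (fst p) (?c (snd p)) - ?c (snd p) - X (fst p) (?c (snd p))) + (X (fst p) (?c (snd p)) - X (fst p) (?c 0))"
      by (simp add: r_def)
    also have "norm \<dots> \<le> L * M * (norm (fst p))\<^sup>2 + L * norm (fst p) * (\<Lambda> * \<bar>snd p\<bar>)"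
    proof (intro norm_triangle_le add_mono flow_first_order)
      have "norm (X (fst p) (?c (snd p)) - X (fst p) (?c 0)) \<le> L * norm (fst p) * norm (?c (snd p) - ?c 0)"
        by (rule frame_lipschitz)
      also have "\<dots> \<le> L * norm (fst p) * (\<Lambda> * \<bar>snd p\<bar>)"
        using cc L_pos by (intro mult_left_mono) auto
      finally show "norm (X (fst p) (?c (snd p)) - X (fst p) (?c 0)) \<le> L * norm (fst p) * (\<Lambda> * \<bar>snd p\<bar>)" .
    qed
    also have "\<dots> \<le> L * M * (norm p)\<^sup>2 + L * norm p * (\<Lambda> * norm p)"
      using n L_pos M_pos by (intro add_mono mult_left_mono mult_mono power_mono) (auto simp: \<Lambda>_def)
    finally show "norm (r ((0, 0) + p) - r (0, 0) - 0) \<le> (L * M + L * \<Lambda>) * (norm p)\<^sup>2"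
      by (simp add: r_def frame_simps power2_eq_square algebra_simps zero_prod_def[symmetric])
  qed auto
  moreover have "((\<lambda>p. ?c (snd p)) has_derivative (\<lambda>q. c' (snd q))) (at (0, 0))"
    by (rule has_derivative_compose[where f=snd and g="?c"]) (use c in \<open>auto intro: derivative_eq_intros\<close>)
  moreover have "((\<lambda>p. X (fst p) (?c 0)) has_derivative (\<lambda>q. X (fst q) (?c 0))) (at (0::'a, 0::real))"
  proof (rule bounded_linear_imp_has_derivative)
    have "bounded_linear (\<lambda>q. X q (?c 0))" using linear_frame linear_conv_bounded_linear by blast
    then show "bounded_linear (\<lambda>q::'a \<times> real. X (fst q) (?c 0))"
      by (rule bounded_linear_compose[OF _ bounded_linear_fst])
  qed
  ultimately have "((\<lambda>p. r p + ?c (snd p) + X (fst p) (?c 0)) has_derivative (\<lambda>q. 0 + c' (snd q) + X (fst q) (?c 0))) (at (0, 0))"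
    by (intro has_derivative_add)
  then show ?thesis by (simp add: r_def add.commute)
qed

text \<open>Flowing back from \<open>x + v\<close> by \<open>- v\<close> returns to the line through
  \<open>x\<close> in direction \<open>e\<close>. To first order the displacement from
  \<open>x\<close> is \<open>v - X v x\<close>, which is \<open>a x \<bullet> v\<close> times
  \<open>e\<close>.\<close>

lemma axis_coordinate_has_derivative:
  "((\<lambda>v. e \<bullet> (flow (- v) (x + v) - x)) has_derivative (\<lambda>v. a x \<bullet> v)) (at 0)"
proof (rule has_derivative_if_quadratic[where d=1 and C="L * M + L"])
  show "bounded_linear (\<lambda>v. a x \<bullet> v)" by (rule bounded_linear_inner_right)
  fix v :: 'a
  have "e \<bullet> X v x = e \<bullet> v - a x \<bullet> v" by (simp add: X_eq inner_diff_right)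
  then have "e \<bullet> (flow (- v) (x + v) - x) - a x \<bullet> v =
      e \<bullet> ((flow (- v) (x + v) - (x + v) - X (- v) (x + v)) + (X v x - X v (x + v)))"
    by (simp add: inner_add_right inner_diff_right frame_simps)
  also have "\<bar>\<dots>\<bar> \<le> norm ((flow (- v) (x + v) - (x + v) - X (- v) (x + v)) + (X v x - X v (x + v)))"
    using Cauchy_Schwarz_ineq2[of e] norm_e by (metis mult_1)
  also have "\<dots> \<le> L * M * (norm (- v))\<^sup>2 + L * norm v * norm (x - (x + v))"
    by (intro norm_triangle_le add_mono flow_first_order frame_lipschitz)
  finally show "norm (e \<bullet> (flow (- (0 + v)) (x + (0 + v)) - x) - e \<bullet> (flow (- 0) (x + 0) - x) - a x \<bullet> v) \<le> (L * M + L) * (norm v)\<^sup>2"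
    by (simp add: power2_eq_square algebra_simps)
qed simp

text \<open>Write \<open>x + v = flow v (x + \<tau> v *\<^sub>R e)\<close>. Additivity gives
  \<open>flow (h + k) (x + v) = flow (k + v) (flow h (x + \<tau> v *\<^sub>R e))\<close>, so only
  \<open>e\<close> remains as a direction in which \<open>flow h\<close> is differentiated, and
  there the variational equation is scalar.\<close>

lemma flow_has_derivative:
  assumes a': "\<And>z. z \<in> ball x0 R \<Longrightarrow> (a has_derivative a' z) (at z)"
    and ca': "continuous_on (ball x0 R) (\<lambda>z. a' z e)"
    and \<eta>: "\<eta> \<le> \<rho>1" "(1 + M) * \<eta> < R"
    and h: "norm h < \<eta>" and x: "norm (x - x0) < \<eta>"
  shows "((\<lambda>p. flow (fst p) (snd p)) has_derivative
    (\<lambda>q. X (fst q + snd q) (flow h x) +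
      ((a x \<bullet> snd q) * exp (- integral {0..1} (\<lambda>s. a' (flow (s *\<^sub>R h) x) e \<bullet> h))) *\<^sub>R e)) (at (h, x))"
proof -
  define c' where "c' t = (t * exp (- integral {0..1} (\<lambda>s. a' (flow (s *\<^sub>R h) x) e \<bullet> h))) *\<^sub>R e" for t
  have stay: "norm (flow (s *\<^sub>R h) x - x0) \<le> (1 + M) * \<eta>" if "0 \<le> s" "s \<le> 1" for s
  proof -
    have "norm (flow (s *\<^sub>R h) x - x) \<le> M * norm (s *\<^sub>R h)" by (rule flow_dist_le)
    also have "\<dots> \<le> M * \<eta>"
      using that h M_pos mult_left_le_one_le[of "norm h" s] by (intro mult_left_mono) auto
    finally show ?thesis
      using x norm_triangle_ineq[of "flow (s *\<^sub>R h) x - x" "x - x0"] by (simp add: algebra_simps)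
  qed
  have c: "((\<lambda>t. flow h (x + t *\<^sub>R e)) has_derivative c') (at 0)"
    unfolding c'_def by (rule flow_has_derivative_axis[OF a' ca' \<eta>(2) stay])
  define \<tau> where "\<tau> v = e \<bullet> (flow (- v) (x + v) - x)" for v
  have \<tau>: "flow (- v) (x + v) = x + \<tau> v *\<^sub>R e" for v
  proof -
    have "proj (flow (- v) (x + v) - x) = 0" by simp
    then show ?thesis using proj_eq[of "flow (- v) (x + v) - x"] by (simp add: \<tau>_def)
  qed
  have \<tau>': "(\<tau> has_derivative (\<lambda>v. a x \<bullet> v)) (at 0)"
    unfolding \<tau>_def by (rule axis_coordinate_has_derivative)
  have h1: "((\<lambda>w. (fst w + snd w, \<tau> (snd w))) has_derivative (\<lambda>q. (fst q + snd q, a x \<bullet> snd q))) (at (0, 0))"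
  proof (intro has_derivative_Pair)
    show "((\<lambda>w. fst w + snd w) has_derivative (\<lambda>q. fst q + snd q)) (at (0::'a, 0::'a))"
      by (auto intro!: derivative_eq_intros)
    show "((\<lambda>w. \<tau> (snd w)) has_derivative (\<lambda>q. a x \<bullet> snd q)) (at (0::'a, 0::'a))"
      by (rule has_derivative_compose[where f=snd and g=\<tau>]) (use \<tau>' in \<open>auto intro: derivative_eq_intros\<close>)
  qed
  have "\<tau> 0 = 0" by (simp add: \<tau>_def)
  then have h2: "((\<lambda>p. flow (fst p) (flow h (x + snd p *\<^sub>R e))) has_derivative (\<lambda>q. X (fst q) (flow h x) + c' (snd q)))
      (at (fst (0, 0) + snd (0, 0), \<tau> (snd (0, 0))))"
    using flow_of_axis_point_has_derivative[OF c] by simp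
  have "((\<lambda>w. flow (fst w + snd w) (flow h (x + \<tau> (snd w) *\<^sub>R e))) has_derivative
      (\<lambda>q. X (fst q + snd q) (flow h x) + c' (a x \<bullet> snd q))) (at (0, 0))"
    using has_derivative_compose[OF h1 h2] by simp
  then have d0: "((\<lambda>w. flow (h + fst w) (x + snd w)) has_derivative
      (\<lambda>q. X (fst q + snd q) (flow h x) + c' (a x \<bullet> snd q))) (at (0, 0))"
  proof (rule has_derivative_transform_within_open)
    \<comment> \<open>Here all arguments are in the range of \<open>flow_add\<close>, which is used
      once to merge \<open>h + fst w\<close> with \<open>snd w\<close> and once to split off
      \<open>h\<close>.\<close>
    let ?N = "{w. norm (flow (- snd w) (x + snd w) - x0) < \<rho>1} \<inter> {w. norm (h + fst w) < \<rho>1} \<inter> {w. norm (snd w) < \<rho>1} \<inter>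
        {w. norm (fst w + snd w) < \<rho>1}"
    show "open ?N" by (intro open_Int open_Collect_less continuous_intros)
    show "(0, 0) \<in> ?N" using x h \<eta>(1) \<rho>1(1) by simp
    fix w assume w: "w \<in> ?N"
    let ?z = "flow (- snd w) (x + snd w)"
    have "flow (h + fst w) (x + snd w) = flow (h + fst w) (flow (snd w) ?z)" by simp
    also have "\<dots> = flow ((h + fst w) + snd w) ?z" using w by (intro flow_add[symmetric]) auto
    also have "(h + fst w) + snd w = (fst w + snd w) + h" by simp
    also have "flow ((fst w + snd w) + h) ?z = flow (fst w + snd w) (flow h ?z)"
      using w h \<eta>(1) by (intro flow_add) auto
    finally show "flow (fst w + snd w) (flow h (x + \<tau> (snd w) *\<^sub>R e)) = flow (h + fst w) (x + snd w)"
      by (simp add: \<tau>)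
  qed
  have "((\<lambda>p. p - (h, x)) has_derivative (\<lambda>q. q)) (at (h, x))"
    by (auto intro!: derivative_eq_intros)
  from has_derivative_compose[OF this, of "\<lambda>w. flow (h + fst w) (x + snd w)"] d0
  have "((\<lambda>p. flow (h + fst (p - (h, x))) (x + snd (p - (h, x)))) has_derivative
      (\<lambda>q. X (fst q + snd q) (flow h x) + c' (a x \<bullet> snd q))) (at (h, x))"
    by (simp add: zero_prod_def)
  then show ?thesis by (simp add: c'_def)
qed

lemma Ck_on_frame:
  assumes "open S" "open T" "Ck_on k T a" "Ck_on k S f" "f ` S \<subseteq> T"
  shows "Ck_on k S (\<lambda>z. X h (f z))"
  unfolding X_eq
  by (rule Ck_on_diff[OF \<open>open S\<close> Ck_on_const[OF \<open>open S\<close>] Ck_on_scaleR[OF \<open>open S\<close>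
        Ck_on_inner[OF \<open>open S\<close> Ck_on_compose[OF assms] Ck_on_const[OF \<open>open S\<close>]] Ck_on_const[OF \<open>open S\<close>]]])

text \<open>The derivative in the direction is \<open>X q (flow h x)\<close>, as regular as
  \<open>a\<close> and the flow together, so the flow gains one derivative over \<open>a\<close>.
  This is the source of the class \<open>k + 1\<close> of the level sets.\<close>

lemma Ck_on_flow_left:
  assumes Ck: "Ck_on k (ball x0 R) a" and \<eta>: "\<eta> \<le> \<rho>1" "(1 + M) * \<eta> \<le> R" and x: "norm (x - x0) < \<eta>"
  shows "Ck_on (Suc k) (ball 0 \<eta>) (\<lambda>h. flow h x)"
proof -
  have stay: "(\<lambda>h. flow h x) ` ball 0 \<eta> \<subseteq> ball x0 R"
  proof
    fix y assume "y \<in> (\<lambda>h. flow h x) ` ball 0 \<eta>"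
    then obtain h where h: "norm h < \<eta>" "y = flow h x" by auto
    have "norm (flow h x - x) \<le> M * norm h" by (rule flow_dist_le)
    also have "\<dots> < M * \<eta>" using h M_pos by simp
    finally have "norm (flow h x - x0) < R"
      using x \<eta> norm_triangle_ineq[of "flow h x - x" "x - x0"] by (simp add: algebra_simps)
    then show "y \<in> ball x0 R" using h by (simp add: dist_norm norm_minus_commute)
  qed
  have step: "Ck_on (Suc j) (ball 0 \<eta>) (\<lambda>h. flow h x)" if "Ck_on j (ball 0 \<eta>) (\<lambda>h. flow h x)" "j \<le> k" for j
  proof (rule Ck_on_SucI[where f'="\<lambda>h q. X q (flow h x)"])
    show "((\<lambda>h. flow h x) has_derivative (\<lambda>q. X q (flow h x))) (at h)" if "h \<in> ball 0 \<eta>" for h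
      using that x \<eta> by (intro flow_has_derivative_left) auto
    show "Ck_on j (ball 0 \<eta>) (\<lambda>h. X v (flow h x))" for v
      by (rule Ck_on_frame[OF open_ball open_ball Ck_on_mono[OF Ck \<open>j \<le> k\<close>] that(1) stay])
  qed simp
  have "Ck_on j (ball 0 \<eta>) (\<lambda>h. flow h x)" if "j \<le> Suc k" for j
    using that
  proof (induction j)
    case 0
    show ?case by (simp only: Ck_on.simps) (intro continuous_intros)
  next
    case (Suc j)
    then show ?case by (intro step) auto
  qed
  from this[OF order_refl] show ?thesis .
qed

text \<open>The derivative in the starting point contains the derivative of \<open>a\<close> under
  an integral, so the bootstrapping stops at the class of \<open>a\<close>, one below that of
  \<open>Ck_on_flow_left\<close>.\<close>

lemma Ck_on_flow:
  assumes Ck: "Ck_on (Suc k) (ball x0 R) a" and \<eta>: "\<eta> > 0" "\<eta> \<le> \<rho>1" "(1 + M) * \<eta> < R"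
  shows "Ck_on (Suc k) (ball 0 \<eta> \<times> ball x0 \<eta>) (\<lambda>p. flow (fst p) (snd p))"
proof -
  let ?S = "ball (0::'a) \<eta> \<times> ball x0 \<eta>"
  have op: "open ?S" by (intro open_Times open_ball)
  obtain a' where a': "\<And>z. z \<in> ball x0 R \<Longrightarrow> (a has_derivative a' z) (at z)" "\<And>v. Ck_on k (ball x0 R) (\<lambda>z. a' z v)"
    using Ck by (rule Ck_on_SucE) blast
  have ca': "continuous_on (ball x0 R) (\<lambda>z. a' z e)" by (rule Ck_on_imp_continuous_on[OF a'(2)])
  have star: "contract_fst s z \<in> ?S" if "z \<in> ?S" "0 \<le> s" "s \<le> 1" for s z
    using that mult_left_le_one_le[of "norm (fst z)" s] by (auto simp: contract_fst_def mem_Times_iff)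
  have stay: "(\<lambda>p. flow (fst p) (snd p)) ` ?S \<subseteq> ball x0 R"
  proof
    fix y assume "y \<in> (\<lambda>p. flow (fst p) (snd p)) ` ?S"
    then obtain p where p: "p \<in> ?S" "y = flow (fst p) (snd p)" by blast
    define h x where "h = fst p" and "x = snd p"
    have h: "norm h < \<eta>" "norm (x - x0) < \<eta>" "y = flow h x"
      using p by (auto simp: h_def x_def dist_norm norm_minus_commute)
    have "norm (flow h x - x) \<le> M * norm h" by (rule flow_dist_le)
    also have "\<dots> < M * \<eta>" using h M_pos by simp
    finally have "norm (flow h x - x0) < R"
      using h \<eta> norm_triangle_ineq[of "flow h x - x" "x - x0"] by (simp add: algebra_simps)
    then show "y \<in> ball x0 R" using h by (simp add: dist_norm norm_minus_commute)
  qed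
  \<comment> \<open>The exponent in coordinates: the components of \<open>fst p\<close> leave the
    integral, and the rest has the form treated by \<open>Ck_on_integral_contract\<close> with power
    \<open>0\<close>.\<close>
  define \<mu> where "\<mu> p = (\<Sum>i\<in>Basis. (fst p \<bullet> i) * integral {0..1} (\<lambda>s. s ^ 0 * (a' (flow (fst (contract_fst s p)) (snd (contract_fst s p))) e \<bullet> i)))" for p
  have \<mu>: "integral {0..1} (\<lambda>s. a' (flow (s *\<^sub>R fst p) (snd p)) e \<bullet> fst p) = \<mu> p" if p: "p \<in> ?S" for p
  proof -
    have "continuous_on {0..1} (\<lambda>s. a' (flow (s *\<^sub>R fst p) (snd p)) e)"
    proof (rule continuous_on_compose2[OF ca'])
      show "continuous_on {0..1} (\<lambda>s. flow (s *\<^sub>R fst p) (snd p))" by (intro continuous_intros)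
      show "(\<lambda>s. flow (s *\<^sub>R fst p) (snd p)) ` {0..1} \<subseteq> ball x0 R"
        using stay star[OF p] by (force simp: contract_fst_def)
    qed
    then have int: "(\<lambda>s. (fst p \<bullet> i) * (a' (flow (s *\<^sub>R fst p) (snd p)) e \<bullet> i)) integrable_on {0..1}" for i
      by (intro integrable_continuous_real continuous_intros)
    have "(\<lambda>s. a' (flow (s *\<^sub>R fst p) (snd p)) e \<bullet> fst p) = (\<lambda>s. \<Sum>i\<in>Basis. (fst p \<bullet> i) * (a' (flow (s *\<^sub>R fst p) (snd p)) e \<bullet> i))"
      by (rule ext) (subst euclidean_inner, simp add: mult.commute)
    then have "integral {0..1} (\<lambda>s. a' (flow (s *\<^sub>R fst p) (snd p)) e \<bullet> fst p) =
        (\<Sum>i\<in>Basis. integral {0..1} (\<lambda>s. (fst p \<bullet> i) * (a' (flow (s *\<^sub>R fst p) (snd p)) e \<bullet> i)))"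
      using int by (simp add: integral_sum)
    then show ?thesis by (simp add: \<mu>_def contract_fst_def)
  qed
  have step: "Ck_on (Suc j) ?S (\<lambda>p. flow (fst p) (snd p))" if j: "Ck_on j ?S (\<lambda>p. flow (fst p) (snd p))" "j \<le> k" for j
  proof (rule Ck_on_SucI[OF op, where f'="\<lambda>p q. X (fst q + snd q) (flow (fst p) (snd p)) +
      ((a (snd p) \<bullet> snd q) * exp ((-1) * \<mu> p)) *\<^sub>R e"])
    fix p assume p: "p \<in> ?S"
    obtain h x where hx: "p = (h, x)" by fastforce
    show "((\<lambda>p. flow (fst p) (snd p)) has_derivative (\<lambda>q. X (fst q + snd q) (flow (fst p) (snd p)) +
        ((a (snd p) \<bullet> snd q) * exp ((-1) * \<mu> p)) *\<^sub>R e)) (at p)"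
      using flow_has_derivative[OF a'(1) ca' \<eta>(2,3), of h x] \<mu>[OF p] p
      by (simp add: hx dist_norm norm_minus_commute)
  next
    fix v :: "'a \<times> 'a"
    have ak: "Ck_on j (ball x0 R) a" using Ck by (rule Ck_on_mono) (use \<open>j \<le> k\<close> in simp)
    have a'k: "Ck_on j (ball x0 R) (\<lambda>z. a' z e)" using a'(2) \<open>j \<le> k\<close> by (rule Ck_on_mono)
    have "Ck_on j ?S snd" by (rule Ck_on_bounded_linear[OF op bounded_linear_snd])
    moreover have "snd ` ?S \<subseteq> ball x0 R"
    proof -
      have "\<eta> \<le> (1 + M) * \<eta>" using \<eta>(1) M_pos by (simp add: algebra_simps)
      then have "\<eta> < R" using \<eta>(3) by linarith
      then show ?thesis by auto
    qed
    ultimately have 1: "Ck_on j ?S (\<lambda>p. a (snd p))"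
      by (rule Ck_on_compose[OF op open_ball ak])
    have "Ck_on j ?S (\<lambda>p. a' (flow (fst p) (snd p)) e \<bullet> i)" for i
      by (rule Ck_on_inner[OF op Ck_on_compose[OF op open_ball a'k j(1) stay] Ck_on_const[OF op]])
    from Ck_on_integral_contract[OF op star this, of 0]
    have "Ck_on j ?S (\<lambda>p. integral {0..1} (\<lambda>s. s ^ 0 * (a' (flow (fst (contract_fst s p)) (snd (contract_fst s p))) e \<bullet> i)))" for i .
    then have 2: "Ck_on j ?S \<mu>"
      unfolding \<mu>_def[abs_def]
      by (intro Ck_on_sum[OF op] Ck_on_mult[OF op Ck_on_inner[OF op Ck_on_bounded_linear[OF op bounded_linear_fst] Ck_on_const[OF op]]])
    show "Ck_on j ?S (\<lambda>p. X (fst v + snd v) (flow (fst p) (snd p)) + ((a (snd p) \<bullet> snd v) * exp ((-1) * \<mu> p)) *\<^sub>R e)"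
      by (rule Ck_on_add[OF op Ck_on_frame[OF op open_ball ak j(1) stay] Ck_on_scaleR[OF op Ck_on_mult[OF op
            Ck_on_inner[OF op 1 Ck_on_const[OF op]] Ck_on_exp[OF op Ck_on_mult[OF op Ck_on_const[OF op] 2]]] Ck_on_const[OF op]]])
  qed
  have "Ck_on j ?S (\<lambda>p. flow (fst p) (snd p))" if "j \<le> Suc k" for j
    using that
  proof (induction j)
    case 0
    show ?case by (simp only: Ck_on.simps) (intro continuous_intros)
  next
    case (Suc j)
    then show ?case by (intro step) auto
  qed
  from this[OF order_refl] show ?thesis .
qed

lemma Ck_on_potential:
  assumes Ck: "Ck_on (Suc k) (ball x0 R) a" and \<eta>: "\<eta> > 0" "\<eta> \<le> \<rho>1" "(1 + M) * \<eta> < R" and \<sigma>: "(1 + M) * \<sigma> \<le> \<eta>"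
  shows "Ck_on (Suc k) (tube \<sigma>) potential"
proof -
  have bl: "bounded_linear (\<lambda>x::'a. (- x, x))"
    by (intro bounded_linear_Pair bounded_linear_minus bounded_linear_ident)
  have "Ck_on (Suc k) (tube \<sigma>) (\<lambda>x. (x0, 0) + (- x, x))"
    by (intro Ck_on_add[OF open_tube] Ck_on_const[OF open_tube] Ck_on_bounded_linear[OF open_tube bl])
  moreover have "(\<lambda>x. (x0, 0) + (- x, x)) ` tube \<sigma> \<subseteq> ball 0 \<eta> \<times> ball x0 \<eta>"
    using tube_close[of _ \<sigma>] \<sigma> by (force simp: dist_norm norm_minus_commute)
  ultimately have "Ck_on (Suc k) (tube \<sigma>) (\<lambda>x. flow (fst ((x0, 0) + (- x, x))) (snd ((x0, 0) + (- x, x))))"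
    by (rule Ck_on_compose[OF open_tube open_Times[OF open_ball open_ball] Ck_on_flow[OF Ck \<eta>]])
  then have "Ck_on (Suc k) (tube \<sigma>) (\<lambda>x. flow (x0 - x) x)" by simp
  then have "Ck_on (Suc k) (tube \<sigma>) (\<lambda>x. e \<bullet> (flow (x0 - x) x - x0))"
    by (intro Ck_on_inner[OF open_tube Ck_on_const[OF open_tube]] Ck_on_diff[OF open_tube _ Ck_on_const[OF open_tube]])
  then show ?thesis by (simp add: potential_def[abs_def])
qed

end

section \<open>Normal solutions\<close>

lemma AE_jacobi_condition:
  assumes "jacobi_condition U g"
  shows "AE z in lebesgue. z \<in> U \<longrightarrow> g differentiable (at z) \<and>
    (\<forall>i j k. g z $ i * (jacobian g (at z) $ j $ k - jacobian g (at z) $ k $ j) +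
      g z $ j * (jacobian g (at z) $ k $ i - jacobian g (at z) $ i $ k) +
      g z $ k * (jacobian g (at z) $ i $ j - jacobian g (at z) $ j $ i) = 0)"
proof -
  have "AE z in lebesgue. \<forall>i\<in>UNIV. \<forall>j\<in>UNIV. \<forall>k\<in>UNIV. z \<in> U \<longrightarrow> g differentiable (at z) \<and>
    (g z $ i * (jacobian g (at z) $ j $ k - jacobian g (at z) $ k $ j) +
      g z $ j * (jacobian g (at z) $ k $ i - jacobian g (at z) $ i $ k) +
      g z $ k * (jacobian g (at z) $ i $ j - jacobian g (at z) $ j $ i) = 0)"
    using assms unfolding jacobi_condition_def Let_def by (intro AE_finite_allI finite_UNIV) auto
  then show ?thesis by eventually_elim auto
qed

lemma jacobi_condition_if_normal_solutions:
  fixes U :: "(real^'n) set" and g :: "real^'n \<Rightarrow> real^'n"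
  assumes "open U" "locally_lipschitz_on U g" and g0: "\<And>x. x \<in> U \<Longrightarrow> g x \<noteq> 0"
    and sol: "\<And>x0. x0 \<in> U \<Longrightarrow> \<exists>V u. normal_solution_around U g x0 V u"
  shows "jacobi_condition U g"
proof -
  define N where "N = {x\<in>U. \<not> g differentiable (at x)}"
  have "N \<in> null_sets lebesgue"
    using Rademacher[OF assms(1,2)] by (simp add: N_def negligible_iff_null_sets)
  then have ae: "AE x in lebesgue. x \<notin> N" by (rule AE_not_in)
  have pt: "g differentiable (at x) \<and> (g x $ i * (jacobian g (at x) $ j $ k - jacobian g (at x) $ k $ j) +
      g x $ j * (jacobian g (at x) $ k $ i - jacobian g (at x) $ i $ k) +
      g x $ k * (jacobian g (at x) $ i $ j - jacobian g (at x) $ j $ i) = 0)" if x: "x \<in> U" "x \<notin> N" for x i j k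
  proof -
    have d: "g differentiable (at x)" using x by (simp add: N_def)
    then have G: "(g has_derivative (\<lambda>v. jacobian g (at x) *v v)) (at x)" by (simp add: jacobian_works)
    obtain V u where sol: "normal_solution U g V u" "x \<in> V"
      using sol[OF x(1)] unfolding normal_solution_around_def by blast
    define X where "X = {y\<in>V. u y = u x}"
    have X: "X \<in> level_sets V u" "x \<in> X" using sol by (auto simp: X_def level_sets_def)
    have man: "Ck_manifold 1 (DIM(real^'n) - 1) X" and nor: "normal_vector_field g X"
      using sol(1) X(1) unfolding normal_solution_def by auto
    have "(jacobian g (at x) *v v) \<bullet> w = (jacobian g (at x) *v w) \<bullet> v" if "g x \<bullet> v = 0" "g x \<bullet> w = 0" for v w
      by (rule symmetric_on_kernel_if_manifold[OF man X(2) nor G g0[OF x(1)] that])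
    then show ?thesis
      using jacobi_identity_iff_symmetric_on_kernel[OF g0[OF x(1)], of "jacobian g (at x)"] d by blast
  qed
  show ?thesis
    unfolding jacobi_condition_def Let_def
  proof (intro allI)
    fix i j k
    show "AE x in lebesgue. x \<in> U \<longrightarrow> g differentiable (at x) \<and>
      g x $ i * (jacobian g (at x) $ j $ k - jacobian g (at x) $ k $ j) +
      g x $ j * (jacobian g (at x) $ k $ i - jacobian g (at x) $ i $ k) +
      g x $ k * (jacobian g (at x) $ i $ j - jacobian g (at x) $ j $ i) = 0"
      using ae by eventually_elim (use pt in blast)
  qed
qed

section \<open>The frame of a field satisfying Jacobi's condition\<close>

lemma normalized_field_has_derivative:
  fixes g :: "'a::euclidean_space \<Rightarrow> 'a"
  assumes g: "(g has_derivative g') (at z)" and s: "g z \<bullet> e \<noteq> 0"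
  shows "((\<lambda>z. inverse (g z \<bullet> e) *\<^sub>R g z) has_derivative
    (\<lambda>v. inverse (g z \<bullet> e) *\<^sub>R g' v - ((g' v \<bullet> e) * (inverse (g z \<bullet> e))\<^sup>2) *\<^sub>R g z)) (at z)"
proof -
  have "((\<lambda>z. g z \<bullet> e) has_derivative (\<lambda>v. g' v \<bullet> e)) (at z)"
    using g by (rule has_derivative_inner_left)
  from Deriv.has_derivative_inverse[OF s this]
  have "((\<lambda>z. inverse (g z \<bullet> e)) has_derivative (\<lambda>v. - (inverse (g z \<bullet> e) * (g' v \<bullet> e) * inverse (g z \<bullet> e)))) (at z)" .
  from has_derivative_scaleR[OF this g] show ?thesis
    by (simp add: power2_eq_square mult_ac)
qed

text \<open>The derivative \<open>a'\<close> of the normalised field takes values orthogonal to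
  \<open>e\<close>, so \<open>h\<close> may be replaced by \<open>X h z\<close>; this is orthogonal
  to \<open>g z\<close>, and only a multiple of \<open>g'\<close> survives. Hence
  \<open>a' (X h z) \<bullet> k\<close> is symmetric by \<open>sym\<close>: the bracket of the two
  fields vanishes at \<open>z\<close>.\<close>

lemma frame_derivative_symmetric:
  fixes g :: "'a::euclidean_space \<Rightarrow> 'a" and e :: 'a
  defines "X \<equiv> \<lambda>h z. h - ((inverse (g z \<bullet> e) *\<^sub>R g z) \<bullet> h) *\<^sub>R e"
  assumes g: "(g has_derivative g') (at z)" and s: "g z \<bullet> e \<noteq> 0" and e: "e \<bullet> e = 1"
    and sym: "\<And>v w. g z \<bullet> v = 0 \<Longrightarrow> g z \<bullet> w = 0 \<Longrightarrow> g' v \<bullet> w = g' w \<bullet> v"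
  shows "\<exists>D. \<forall>h. ((\<lambda>z. X h z) has_derivative D h) (at z) \<and> (\<forall>k. D k (X h z) = D h (X k z))"
proof -
  define c where "c = inverse (g z \<bullet> e)"
  have c: "c * (g z \<bullet> e) = 1" using s by (simp add: c_def)
  define a' where "a' v = c *\<^sub>R g' v - ((g' v \<bullet> e) * c\<^sup>2) *\<^sub>R g z" for v
  define D where "D h v = - (a' v \<bullet> h) *\<^sub>R e" for h v
  have a'd: "((\<lambda>z. inverse (g z \<bullet> e) *\<^sub>R g z) has_derivative a') (at z)"
    unfolding a'_def c_def by (rule normalized_field_has_derivative[OF g s])
  have "((\<lambda>z. X h z) has_derivative D h) (at z)" for h
  proof -
    have "((\<lambda>z. h - ((inverse (g z \<bullet> e) *\<^sub>R g z) \<bullet> h) *\<^sub>R e) has_derivative (\<lambda>v. 0 - (a' v \<bullet> h) *\<^sub>R e)) (at z)"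
      by (intro has_derivative_diff has_derivative_const has_derivative_scaleR_left has_derivative_inner_left a'd)
    then show ?thesis by (simp add: X_def D_def[abs_def])
  qed
  moreover have "D k (X h z) = D h (X k z)" for h k
  proof -
    have perp: "g z \<bullet> X h z = 0" for h
      using s by (simp add: X_def inner_diff_right inner_commute)
    have a'e: "a' v \<bullet> e = 0" for v
    proof -
      have "a' v \<bullet> e = (g' v \<bullet> e) * c - (g' v \<bullet> e) * c * (c * (g z \<bullet> e))"
        by (simp add: a'_def inner_diff_left power2_eq_square mult_ac)
      then show ?thesis by (simp add: c)
    qed
    have *: "a' v \<bullet> h = c * (g' v \<bullet> X h z)" for v h
    proof -
      have "h = X h z + ((inverse (g z \<bullet> e) *\<^sub>R g z) \<bullet> h) *\<^sub>R e" by (simp add: X_def)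
      then have "a' v \<bullet> h = a' v \<bullet> X h z" by (metis a'e add.right_neutral inner_add_right inner_scaleR_right mult_zero_right)
      also have "\<dots> = c * (g' v \<bullet> X h z)" by (simp add: a'_def inner_diff_left perp)
      finally show ?thesis .
    qed
    have "a' (X h z) \<bullet> k = a' (X k z) \<bullet> h"
      unfolding * by (simp add: sym[OF perp perp])
    then show ?thesis by (simp add: D_def)
  qed
  ultimately show ?thesis by (intro exI[of _ D]) blast
qed

text \<open>The class \<open>k\<close> is quantified inside: one solution, built from the Lipschitz
  data alone, has whatever regularity \<open>g\<close> provides.\<close>

lemma normal_solution_if_jacobi_condition:
  fixes U :: "(real^'n) set" and g :: "real^'n \<Rightarrow> real^'n"
  assumes "open U" and lip: "locally_lipschitz_on U g" and g0: "\<And>x. x \<in> U \<Longrightarrow> g x \<noteq> 0"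
    and jac: "jacobi_condition U g" and x0: "x0 \<in> U"
  shows "\<exists>V u. normal_solution_around U g x0 V u \<and>
    (\<forall>k\<ge>1. Ck_on k U g \<longrightarrow> Ck_on k V u \<and> (\<forall>X\<in>level_sets V u. Ck_manifold (k + 1) (CARD('n) - 1) X))"
proof -
  define c where "c = norm (g x0)"
  define e where "e = g x0 /\<^sub>R c"
  have c: "c > 0" using g0[OF x0] by (simp add: c_def)
  have ne: "norm e = 1" using c by (simp add: e_def c_def)
  have ge: "g x0 \<bullet> e = c"
    using c by (simp add: e_def c_def power2_norm_eq_inner[symmetric] power2_eq_square)
  obtain R1 where R1: "R1 > 0" "cball x0 R1 \<subseteq> U"
    using \<open>open U\<close> x0 open_contains_cball by blast
  obtain L0 where L0: "L0-lipschitz_on (cball x0 R1) g"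
    using lip R1 compact_cball unfolding locally_lipschitz_on_def by blast
  have L0n: "L0 \<ge> 0" using L0 by (rule lipschitz_on_nonneg)
  \<comment> \<open>The second bound yields \<open>L0 * R \<le> c / 2\<close>, so on the ball
    \<open>g\<close> differs from \<open>g x0\<close> by at most \<open>c / 2\<close> and keeps a
    component of at least \<open>c / 2\<close> along \<open>e\<close>; \<open>+ 1\<close> guards
    against \<open>L0 = 0\<close>.\<close>
  define R where "R = min R1 (c / (2 * (L0 + 1)))"
  have R: "R > 0" "R \<le> R1" using R1 c L0n by (auto simp: R_def)
  have "R * (2 * (L0 + 1)) \<le> c"
    using L0n by (simp add: R_def pos_le_divide_eq[symmetric])
  then have LR: "L0 * R \<le> c / 2" using R(1) by (simp add: algebra_simps)
  define G where "G = g \<circ> closest_point (cball x0 R)"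
  have lipR: "L0-lipschitz_on (cball x0 R) g" using L0 by (rule lipschitz_on_subset) (use R in auto)
  have GL: "L0-lipschitz_on UNIV G"
    unfolding G_def using lipR R by (intro lipschitz_extension_from_cball) auto
  have Gg: "G z = g z" if "z \<in> cball x0 R" for z using that by (simp add: G_def closest_point_self)
  have Gx0: "norm (G z - g x0) \<le> c / 2" for z
  proof -
    have cp: "closest_point (cball x0 R) z \<in> cball x0 R" using R by (intro closest_point_in_set) auto
    then have "dist (g (closest_point (cball x0 R) z)) (g x0) \<le> L0 * dist (closest_point (cball x0 R) z) x0"
      using R by (intro lipschitz_onD[OF lipR]) auto
    also have "\<dots> \<le> L0 * R" using cp L0n by (intro mult_left_mono) (auto simp: dist_commute)
    finally show ?thesis using LR by (simp add: G_def dist_norm)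
  qed
  have Gn: "norm (G z) \<le> 2 * c" for z
  proof -
    have "norm (G z) \<le> norm (G z - g x0) + norm (g x0)" using norm_triangle_ineq[of "G z - g x0" "g x0"] by simp
    then show ?thesis using Gx0[of z] norm_ge_zero[of "g x0"] unfolding c_def by linarith
  qed
  have s: "G z \<bullet> e \<ge> c / 2" for z
  proof -
    have "\<bar>(G z - g x0) \<bullet> e\<bar> \<le> c / 2" using Cauchy_Schwarz_ineq2[of "G z - g x0" e] Gx0[of z] ne by simp
    then have "\<bar>G z \<bullet> e - c\<bar> \<le> c / 2" using ge by (simp only: inner_diff_left)
    then show ?thesis by linarith
  qed
  have s0: "G z \<bullet> e > 0" for z using s[of z] c by linarith
  have inv_le: "inverse (G z \<bullet> e) \<le> 2 / c" "inverse (G z \<bullet> e) > 0" for z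
    using le_imp_inverse_le[OF s[of z]] c s0[of z] by auto
  define a where "a z = inverse (G z \<bullet> e) *\<^sub>R G z" for z
  have a_e: "a z \<bullet> e = 1" for z using s0[of z] by (simp add: a_def)
  have na: "norm (a z) \<le> 4" for z
  proof -
    have "norm (a z) = inverse (G z \<bullet> e) * norm (G z)" using s0[of z] by (simp add: a_def)
    also have "\<dots> \<le> 2 / c * (2 * c)" using inv_le[of z] Gn[of z] c by (intro mult_mono) auto
    finally show ?thesis using c by simp
  qed
  \<comment> \<open>This is \<open>2 / c * (5 * L0)\<close>: the inverse of
    \<open>G y \<bullet> e\<close> is at most \<open>2 / c\<close>, and \<open>5 = 1 + 4\<close>
    because \<open>norm (a z) \<le> 4\<close>.\<close>
  define La where "La = 10 * L0 / c"
  have aL: "norm (a y - a z) \<le> La * norm (y - z)" for y z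
  proof -
    have n: "norm (G y - G z) \<le> L0 * norm (y - z)" using lipschitz_onD[OF GL, of y z] by (simp add: dist_norm)
    have "a y - a z = inverse (G y \<bullet> e) *\<^sub>R ((G y - G z) - ((G y - G z) \<bullet> e) *\<^sub>R a z)"
      using s0[of y] s0[of z] by (simp add: a_def algebra_simps inner_diff_left)
    also have "norm \<dots> = inverse (G y \<bullet> e) * norm ((G y - G z) - ((G y - G z) \<bullet> e) *\<^sub>R a z)"
      using s0[of y] by simp
    also have "\<dots> \<le> 2 / c * (5 * (L0 * norm (y - z)))"
    proof (rule mult_mono)
      have "\<bar>(G y - G z) \<bullet> e\<bar> \<le> L0 * norm (y - z)"
        using Cauchy_Schwarz_ineq2[of "G y - G z" e] n ne by simp
      then have "\<bar>(G y - G z) \<bullet> e\<bar> * norm (a z) \<le> L0 * norm (y - z) * 4"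
        using na[of z] L0n by (intro mult_mono) auto
      then show "norm ((G y - G z) - ((G y - G z) \<bullet> e) *\<^sub>R a z) \<le> 5 * (L0 * norm (y - z))"
        using norm_triangle_ineq4[of "G y - G z" "((G y - G z) \<bullet> e) *\<^sub>R a z"] n by simp
    qed (use inv_le[of y] c in auto)
    finally show ?thesis by (simp add: La_def)
  qed
  define X where "X h z = h - (a z \<bullet> h) *\<^sub>R e" for h z
  \<comment> \<open>The summand \<open>1\<close> keeps \<open>L\<close> positive. The bound
    \<open>5\<close> of the frame is \<open>1 + 4\<close>, again from
    \<open>norm (a z) \<le> 4\<close>.\<close>
  define L where "L = La + 1"
  interpret lipschitz_frame X 5 L
  proof (rule lipschitz_frame.intro)
    show "linear (\<lambda>h. X h z)" for z
      by (rule linearI) (simp_all add: X_def algebra_simps)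
    show "norm (X h z) \<le> 5 * norm h" for h z
    proof -
      have "\<bar>a z \<bullet> h\<bar> \<le> 4 * norm h"
        using Cauchy_Schwarz_ineq2[of "a z" h] mult_right_mono[OF na[of z] norm_ge_zero[of h]] by linarith
      then show ?thesis using norm_triangle_ineq4[of h "(a z \<bullet> h) *\<^sub>R e"] ne by (simp add: X_def)
    qed
    show "norm (X h y - X h z) \<le> L * norm h * norm (y - z)" for h y z
    proof -
      have "X h y - X h z = - ((a y - a z) \<bullet> h) *\<^sub>R e" by (simp add: X_def algebra_simps)
      then have "norm (X h y - X h z) = \<bar>(a y - a z) \<bullet> h\<bar>" using ne by simp
      also have "\<dots> \<le> norm (a y - a z) * norm h" by (rule Cauchy_Schwarz_ineq2)
      also have "\<dots> \<le> L * norm (y - z) * norm h"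
        using aL[of y z] by (intro mult_right_mono) (auto simp: L_def distrib_right intro: order_trans)
      finally show ?thesis by (simp add: mult_ac)
    qed
    show "L > 0" using L0n c by (simp add: L_def La_def add_nonneg_pos)
  qed simp
  have good: "AE z in lebesgue. z \<in> ball x0 R \<longrightarrow>
      (\<exists>D. \<forall>h. ((\<lambda>z. X h z) has_derivative D h) (at z) \<and> (\<forall>k. D k (X h z) = D h (X k z)))"
    using AE_jacobi_condition[OF jac]
  proof eventually_elim
    case (elim z)
    show ?case
    proof
      assume z: "z \<in> ball x0 R"
      then have zU: "z \<in> U" using R R1 by auto
      then have d: "(g has_derivative (\<lambda>v. jacobian g (at z) *v v)) (at z)"
        using elim jacobian_works by blast
      have "(jacobian g (at z) *v v) \<bullet> w = (jacobian g (at z) *v w) \<bullet> v" if "g z \<bullet> v = 0" "g z \<bullet> w = 0" for v w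
        using jacobi_identity_iff_symmetric_on_kernel[OF g0[OF zU], of "jacobian g (at z)"] elim zU that by blast
      moreover have "(G has_derivative (\<lambda>v. jacobian g (at z) *v v)) (at z)"
        by (rule has_derivative_transform_within_open[OF d open_ball z]) (use Gg in auto)
      ultimately show "\<exists>D. \<forall>h. ((\<lambda>z. X h z) has_derivative D h) (at z) \<and> (\<forall>k. D k (X h z) = D h (X k z))"
        unfolding X_def a_def
        using s0[of z] ne Gg[of z] z by (intro frame_derivative_symmetric) (auto simp: norm_eq_1)
    qed
  qed
  \<comment> \<open>\<open>flow_commute\<close> wants one function \<open>D\<close> of direction and
    point, whereas \<open>good\<close> offers a choice at each point separately; the canonical
    derivative agrees with all of these choices.\<close>
  define D where "D l z = frechet_derivative (X l) (at z)" for l z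
  have D: "AE z in lebesgue. z \<in> ball x0 R \<longrightarrow> ((\<lambda>z. X l z) has_derivative D l z) (at z)" for l
    using good by eventually_elim (auto simp: D_def differentiable_def frechet_derivative_works[symmetric])
  have Dsym: "AE z in lebesgue. z \<in> ball x0 R \<longrightarrow> D k z (X h z) = D h z (X k z)" for h k
    using good
  proof eventually_elim
    case (elim z)
    show ?case
    proof
      assume "z \<in> ball x0 R"
      then obtain D' where D': "\<And>h. ((\<lambda>z. X h z) has_derivative D' h) (at z)" "\<And>h k. D' k (X h z) = D' h (X k z)"
        using elim by blast
      then have "D l z = D' l" for l unfolding D_def using frechet_derivative_at by metis
      then show "D k z (X h z) = D h z (X k z)" using D'(2) by simp
    qed
  qed
  \<comment> \<open>\<open>flow_commute\<close> needs room for
    \<open>\<rho> + 5 * \<rho> + 5 * \<rho> = R\<close>, the start and two flows.\<close>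
  define \<rho> where "\<rho> = R / 11"
  interpret graph_frame X 5 L e x0 a \<rho>
  proof
    show "norm e = 1" by (rule ne)
    show "X h z = h - (a z \<bullet> h) *\<^sub>R e" for h z by (simp add: X_def)
    show "a z \<bullet> e = 1" for z by (rule a_e)
    show "\<rho> > 0" using R by (simp add: \<rho>_def)
    show "flow h (flow k x) = flow k (flow h x)" if "norm (x - x0) < \<rho>" "norm h < \<rho>" "norm k < \<rho>" for x h k
      by (rule flow_commute[OF D Dsym, where r=\<rho>]) (use that in \<open>auto simp: \<rho>_def dist_norm norm_minus_commute\<close>)
  qed
  \<comment> \<open>Then \<open>(1 + 5) * \<sigma> = \<rho>1\<close>, and \<open>tube_close\<close>
    keeps the tube within \<open>\<rho>1\<close> of \<open>x0\<close>.\<close>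
  define \<sigma> where "\<sigma> = \<rho>1 / 6"
  have \<rho>R: "(1 + 5) * \<rho>1 < R" using \<rho>1(3) R by (simp add: \<rho>_def)
  have \<sigma>: "\<sigma> > 0" "\<sigma> \<le> \<rho>1" "(1 + 5) * \<sigma> \<le> \<rho>1" using \<rho>1(1) by (auto simp: \<sigma>_def)
  have tube_sub: "tube \<sigma> \<subseteq> ball x0 R"
  proof
    fix x assume "x \<in> tube \<sigma>"
    then show "x \<in> ball x0 R" using tube_close[of x \<sigma>] \<sigma> \<rho>R \<rho>1(1) by (simp add: dist_norm norm_minus_commute)
  qed
  have tubeU: "tube \<sigma> \<subseteq> U" using tube_sub R R1 by fastforce
  have level: "\<exists>w. \<bar>w\<bar> < \<sigma> \<and> S = {y \<in> tube \<sigma>. potential y = w}" if S: "S \<in> level_sets (tube \<sigma>) potential" for S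
  proof -
    obtain x where "x \<in> tube \<sigma>" "S = {y \<in> tube \<sigma>. potential y = potential x}" using S by (auto simp: level_sets_def)
    then show ?thesis by (intro exI[of _ "potential x"]) (simp add: tube_def)
  qed
  have Ck_proj: "Ck_on k UNIV (\<lambda>y. proj (y - x0))" for k
    by (simp only: proj_simps) (intro Ck_on_diff Ck_on_const Ck_on_bounded_linear proj_linear open_UNIV)
  have manifold: "Ck_manifold (Suc k) (CARD('n) - 1) S" if S: "S \<in> level_sets (tube \<sigma>) potential" and Ck: "Ck_on k (ball x0 R) a" for S k
  proof -
    obtain w where w: "\<bar>w\<bar> < \<sigma>" "S = {y \<in> tube \<sigma>. potential y = w}" using level[OF S] by blast
    have "norm (x0 + w *\<^sub>R e - x0) < \<rho>1" using w \<sigma> ne by simp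
    then have "Ck_on (Suc k) (ball 0 \<rho>1) (\<lambda>p. flow p (x0 + w *\<^sub>R e))"
      using \<rho>R by (intro Ck_on_flow_left[OF Ck]) auto
    then have "Ck_on (Suc k) (ball 0 \<sigma>) (\<lambda>p. flow p (x0 + w *\<^sub>R e))"
      by (rule Ck_on_subset) (use \<sigma> in auto)
    then have "Ck_manifold (Suc k) (DIM(real^'n) - 1) S"
      unfolding w(2) by (intro level_set_manifold w(1) Ck_proj)
    then show ?thesis by simp
  qed
  have ca: "continuous_on UNIV a"
  proof (rule lipschitz_on_continuous_on)
    show "La-lipschitz_on UNIV a" using aL L0n c by (intro lipschitz_onI) (auto simp: dist_norm La_def)
  qed
  have "normal_solution_around U g x0 (tube \<sigma>) potential"
    unfolding normal_solution_around_def normal_solution_def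
  proof (intro conjI ballI allI impI notI)
    show "open (tube \<sigma>)" by (rule open_tube)
    show "tube \<sigma> \<subseteq> U" by (rule tubeU)
    show "locally_lipschitz_on (tube \<sigma>) potential"
      unfolding locally_lipschitz_on_def using potential_lipschitz compact_imp_bounded by blast
    \<comment> \<open>The case \<open>k = 0\<close> of \<open>manifold\<close>: continuity of
      \<open>a\<close> already yields level sets of class \<open>1\<close>.\<close>
    show "Ck_manifold 1 (CARD('n) - 1) S" if "S \<in> level_sets (tube \<sigma>) potential" for S
      using manifold[OF that, of 0] continuous_on_subset[OF ca] by simp
    show "normal_vector_field g S" if S: "S \<in> level_sets (tube \<sigma>) potential" for S
      unfolding normal_vector_field_def
    proof (intro ballI)
      fix x v assume x: "x \<in> S" and v: "v \<in> tangent_space S x"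
      obtain w where w: "\<bar>w\<bar> < \<sigma>" "S = {y \<in> tube \<sigma>. potential y = w}" using level[OF S] by blast
      have "a x \<bullet> v = 0" using x v unfolding w(2) by (rule tangent_space_level_set[OF \<sigma>(2) w(1)])
      moreover have "G x = g x" using x tube_sub by (intro Gg) (auto simp: w(2))
      ultimately show "g x \<bullet> v = 0" using s0[of x] by (simp add: a_def)
    qed
    show False if "\<exists>x. local_max_point (tube \<sigma>) potential x" using that not_local_extremum(1)[OF open_tube] by blast
    show False if "\<exists>x. local_min_point (tube \<sigma>) potential x" using that not_local_extremum(2)[OF open_tube] by blast
    show False if "GDERIV potential x :> D" "D = 0" for x D using potential_gradient_nonzero that by blast
    show "x0 \<in> tube \<sigma>" by (rule x0_in_tube[OF \<sigma>(1)])
  qed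
  moreover have "Ck_on k (tube \<sigma>) potential \<and> (\<forall>S\<in>level_sets (tube \<sigma>) potential. Ck_manifold (k + 1) (CARD('n) - 1) S)"
    if k: "k \<ge> 1" "Ck_on k U g" for k
  proof -
    have Gk: "Ck_on k (ball x0 R) g" using k(2) by (rule Ck_on_subset) (use R R1 in auto)
    have ng: "g z \<bullet> e \<noteq> 0" if "z \<in> ball x0 R" for z using s0[of z] Gg[of z] that by auto
    have "Ck_on k (ball x0 R) (\<lambda>z. inverse (g z \<bullet> e) *\<^sub>R g z)"
      by (rule Ck_on_scaleR[OF open_ball Ck_on_inverse[OF open_ball Ck_on_inner[OF open_ball Gk Ck_on_const[OF open_ball]] ng] Gk])
    then have ak: "Ck_on k (ball x0 R) a"
      by (rule Ck_on_cong[OF open_ball, rotated]) (simp add: a_def Gg)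
    obtain j where j: "k = Suc j" using k(1) by (cases k) auto
    have "Ck_on k (tube \<sigma>) potential"
      unfolding j by (rule Ck_on_potential[OF ak[unfolded j] \<rho>1(1) order_refl \<rho>R \<sigma>(3)])
    then show ?thesis using manifold[OF _ ak] by simp
  qed
  ultimately show ?thesis by blast
qed

theorem theorem1:
  fixes U :: "(real^'n) set" and g :: "real^'n \<Rightarrow> real^'n"
  assumes "open U"
    and "locally_lipschitz_on U g"
    and "\<And>x. x \<in> U \<Longrightarrow> g x \<noteq> 0"
  shows "(jacobi_condition U g \<longleftrightarrow>
           (\<forall>x\<^sub>0\<in>U. \<exists>V u. normal_solution_around U g x\<^sub>0 V u)) \<and>
         (\<forall>k::nat. k \<ge> 1 \<and> Ck_on k U g \<longrightarrow>
           (jacobi_condition U g \<longleftrightarrow>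
             (\<forall>x\<^sub>0\<in>U. \<exists>V u. normal_solution_around U g x\<^sub>0 V u \<and>
                Ck_on k V u \<and>
                (\<forall>X\<in>level_sets V u. Ck_manifold (k + 1) (CARD('n) - 1) X))))"
proof (intro conjI allI impI iffI ballI)
  fix x0 assume jac: "jacobi_condition U g" and x0: "x0 \<in> U"
  show "\<exists>V u. normal_solution_around U g x0 V u"
    using normal_solution_if_jacobi_condition[OF assms jac x0] by blast
next
  assume "\<forall>x0\<in>U. \<exists>V u. normal_solution_around U g x0 V u"
  then show "jacobi_condition U g"
    using jacobi_condition_if_normal_solutions[OF assms] by blast
next
  fix k x0 assume "1 \<le> k \<and> Ck_on k U g" and jac: "jacobi_condition U g" and x0: "x0 \<in> U"
  then show "\<exists>V u. normal_solution_around U g x0 V u \<and> Ck_on k V u \<and>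
      (\<forall>X\<in>level_sets V u. Ck_manifold (k + 1) (CARD('n) - 1) X)"
    using normal_solution_if_jacobi_condition[OF assms jac x0] by blast
next
  fix k :: nat
  assume "\<forall>x0\<in>U. \<exists>V u. normal_solution_around U g x0 V u \<and> Ck_on k V u \<and>
      (\<forall>X\<in>level_sets V u. Ck_manifold (k + 1) (CARD('n) - 1) X)"
  then show "jacobi_condition U g"
    using jacobi_condition_if_normal_solutions[OF assms] by blast
qed

end
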